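(* For $n\ge 7$: (i) $n=7$: $\mathrm{ex}^{(2)}_3(7;P)=15$ and $\mathrm{Ex}^{(2)}_3(7;P)=\{S^3_7\}$; (ii) $8\le n\le 12$: $\mathrm{ex}^{(2)}_3(n;P)=20+\binom{n-6}{3}$ and $\mathrm{Ex}^{(2)}_3(n;P)=\{K^3_6\cup K^3_{n-6}\}$; (iii) $n=13$: $\mathrm{ex}^{(2)}_3(13;P)=40$ and $\mathrm{Ex}^{(2)}_3(13;P)=\{K^3_6\cup K^3_6\cup K^3_1,\ \mathrm{Co}(13)\}$; (iv) $n\ge 14$: $\mathrm{ex}^{(2)}_3(n;P)=4+\binom{n-4}{2}$ and $\mathrm{Ex}^{(2)}_3(n;P)=\{\mathrm{Co}(n)\}$. (Families are up to isomorphism.)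
   Context: All hypergraphs are 3-uniform (3-graphs); a 3-graph $H$ contains $F$ (written $F\subseteq H$) if $H$ has a sub-3-graph isomorphic to $F$; $H$ is $F$-free otherwise, and $\mathcal F$-free if it is $F$-free for all $F\in\mathcal F$. $P$ is the loose 3-uniform path of length 3: vertices $a,b,c,d,e,f,g$, edges $\{a,b,c\},\{c,d,e\},\{e,f,g\}$. $K^3_m$ is the complete 3-graph on $m$ vertices; $K^3_1$ is an isolated vertex; $F_1\cup F_2$ denotes the vertex-disjoint union. $S^3_n$ is the full star: $n$ vertices, one vertex (center) and all $\binom{n-1}{2}$ triples containing it. The comet $\mathrm{Co}(n)$ ($n\ge 4$) is the $n$-vertex 3-graph consisting of a copy of $K^3_4$ together with all triples containing a fixed vertex $c$ of that $K^3_4$ (the center); i.e. a star with center $c$ on all $n$ vertices restricted to triples meeting... precisely: vertex set $\{c,h_1,h_2,h_3\}\cup R$ with $|R|=n-4$, edges: all triples containing $c$ and two vertices of $R\cup\{c\}$-complement within $R$ (i.e. $\{c,u,v\}$, $u,v\in R$), together with the four triples of $\{c,h_1,h_2,h_3\}$; it has $4+\binom{n-4}{2}$ edges. Turán numbers of higher order: $\mathrm{ex}^{(1)}_3(n;\mathcal F)=\mathrm{ex}_3(n;\mathcal F)$ is the maximum number of edges of an $n$-vertex $\mathcal F$-free 3-graph, and $\mathrm{Ex}^{(1)}_3(n;\mathcal F)$ is the family of $n$-vertex $\mathcal F$-free 3-graphs attaining it. For $s\ge1$, $\mathrm{ex}^{(s+1)}_3(n;\mathcal F)$ is the maximum number of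 edges of an $n$-vertex $\mathcal F$-free 3-graph $H$ such that $H$ is not contained in (i.e. not a sub-3-graph of any copy, on the same vertex set, of) any member of $\mathrm{Ex}^{(1)}_3(n;\mathcal F)\cup\dots\cup\mathrm{Ex}^{(s)}_3(n;\mathcal F)$; $\mathrm{Ex}^{(s+1)}_3(n;\mathcal F)$ is the family of such $H$ attaining this maximum. (For reference, $\mathrm{Ex}^{(1)}_3(7;P)=\{K^3_6\cup K^3_1\}$ and $\mathrm{Ex}^{(1)}_3(n;P)=\{S^3_n\}$ for $n\ge 8$.) *)

theory Defs
  imports Main
begin

definition hg3 :: "nat \<Rightarrow> nat set set \<Rightarrow> bool" where
  "hg3 n H \<longleftrightarrow> (\<forall>e\<in>H. e \<subseteq> {..<n} \<and> card e = 3)"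

definition contains3 :: "'a set set \<Rightarrow> 'b set set \<Rightarrow> bool" where
  "contains3 F H \<longleftrightarrow> (\<exists>f. inj_on f (\<Union>F) \<and> (\<forall>e\<in>F. f ` e \<in> H))"

definition Ppath :: "nat set set" where
  "Ppath = {{0,1,2},{2,3,4},{4,5,6}}"

definition Pfree :: "'b set set \<Rightarrow> bool" where
  "Pfree H \<longleftrightarrow> \<not> contains3 Ppath H"

definition ex1 :: "nat \<Rightarrow> nat" where
  "ex1 n = Max {card H | H. hg3 n H \<and> Pfree H}"

definition Ex1 :: "nat \<Rightarrow> nat set set set" where
  "Ex1 n = {H. hg3 n H \<and> Pfree H \<and> card H = ex1 n}"

text \<open>Ex1 n contains all labelled extremal graphs, hence is closed under isomorphism,
  so "not contained in any copy of a member" is just "not a subgraph of a member".\<close>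
definition ex2 :: "nat \<Rightarrow> nat" where
  "ex2 n = Max {card H | H. hg3 n H \<and> Pfree H \<and> \<not> (\<exists>G\<in>Ex1 n. H \<subseteq> G)}"

definition Ex2 :: "nat \<Rightarrow> nat set set set" where
  "Ex2 n = {H. hg3 n H \<and> Pfree H \<and> \<not> (\<exists>G\<in>Ex1 n. H \<subseteq> G) \<and> card H = ex2 n}"

definition iso3 :: "nat \<Rightarrow> nat set set \<Rightarrow> nat set set \<Rightarrow> bool" where
  "iso3 n H G \<longleftrightarrow> (\<exists>\<sigma>. bij_betw \<sigma> {..<n} {..<n} \<and> H = (\<lambda>e. \<sigma> ` e) ` G)"

definition iso_class :: "nat \<Rightarrow> nat set set \<Rightarrow> nat set set set" where
  "iso_class n G = {H. iso3 n H G}"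

definition triples :: "nat set \<Rightarrow> nat set set" where
  "triples A = {e. e \<subseteq> A \<and> card e = 3}"

definition star3 :: "nat \<Rightarrow> nat set set" where
  "star3 n = {e \<in> triples {..<n}. 0 \<in> e}"

definition K6_Kn6 :: "nat \<Rightarrow> nat set set" where
  "K6_Kn6 n = triples {..<6} \<union> triples {6..<n}"

definition K6_K6_K1 :: "nat set set" where
  "K6_K6_K1 = triples {..<6} \<union> triples {6..<12}"

definition comet :: "nat \<Rightarrow> nat set set" where
  "comet n = triples {0,1,2,3} \<union> {{0,u,v} | u v. u \<in> {4..<n} \<and> v \<in> {4..<n} \<and> u \<noteq> v}"

end

(* Call a vertex z terminal if every edge avoiding z meets every edge through z in 0 or 2 vertices.
In a connected P-free system with a terminal vertex z that is not a star at z, some edge through z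
contains a pair {x,y} that no edge meets except inside {x,y} together with the apexes v of the edges
{x,y,v}. Deleting the pair leaves a P-free system in which every component contains an apex, and
every apex is again terminal, so induction applies; only the comet has 4 + binom(n-4,2) edges.
A connected system without terminal vertex is much sparser: if it contains a loose triangle, all
other edges are confined to two vertices of the triangle plus one outside vertex, and if not, one of
two small configurations appears and leaves few possible edges. Disconnected systems are handled by
adding up the bounds for the two sides of a partition. *)

theory Submission
  imports Defs
begin

section \<open>Loose paths and terminal vertices\<close>

text \<open>A bare edge bound does not survive the induction: deleting a pair replaces one known
  terminal vertex by the whole apex set D and may disconnect the system. Hence
  \<open>has_rooted_bounds\<close> carries three bounds at once: for edges alone, a sharper one for
  connected systems with two roots, and one for edges plus roots. The last pays for the card D edges
  lost with a pair, as each apex is a root of the remainder. Apexes are terminal because {x,y,v} put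
  in front of a two-edge loose path starting at v would be a copy of P. The final constants come
  from comparing cliques with the comet: two disjoint copies of K6 and the comet both have 40 edges
  at n = 13. For n \<ge> 8 a connected non-star other than the comet has to lose strictly, so
  \<open>conn_bd\<close> lies one below the target. Its tightness at 7, 9 and 10 vertices dictates
  how sharply the systems without terminal vertex must be counted.\<close>

lemma PfreeD:
  assumes "Pfree H" "distinct [a,b,c,d,e,f,g]" "{a,b,c} \<in> H" "{c,d,e} \<in> H" "{e,f,g} \<in> H"
  shows False
proof -
  define \<phi> where "\<phi> = (\<lambda>i::nat. [a,b,c,d,e,f,g] ! i)"
  have U: "\<Union> Ppath = {0,1,2,3,4,5,6}" unfolding Ppath_def by auto
  have "inj_on \<phi> (\<Union> Ppath)" unfolding U \<phi>_def inj_on_def using assms(2) by (auto simp: numeral_eq_Suc)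
  moreover have "\<forall>x\<in>Ppath. \<phi> ` x \<in> H"
    using assms(3-) unfolding Ppath_def \<phi>_def by (auto simp: numeral_eq_Suc)
  ultimately show False using assms(1) unfolding Pfree_def contains3_def by blast
qed

lemma PfreeI:
  assumes "\<And>a b c d e f g. distinct [a,b,c,d,e,f,g] \<Longrightarrow> {a,b,c} \<in> H \<Longrightarrow> {c,d,e} \<in> H \<Longrightarrow> {e,f,g} \<in> H \<Longrightarrow> False"
  shows "Pfree H"
  unfolding Pfree_def contains3_def
proof safe
  fix \<phi> assume inj: "inj_on \<phi> (\<Union> Ppath)" and im: "\<forall>x\<in>Ppath. \<phi> ` x \<in> H"
  have U: "\<Union> Ppath = {0,1,2,3,4,5,6}" unfolding Ppath_def by auto
  have "distinct [\<phi> 0, \<phi> 1, \<phi> 2, \<phi> 3, \<phi> 4, \<phi> 5, \<phi> 6]"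
    using inj unfolding U inj_on_def by auto
  with assms[of "\<phi> 0" "\<phi> 1" "\<phi> 2" "\<phi> 3" "\<phi> 4" "\<phi> 5" "\<phi> 6"] im show False
    unfolding Ppath_def by auto
qed

lemma Pfree_subset: "Pfree H \<Longrightarrow> H' \<subseteq> H \<Longrightarrow> Pfree H'"
  unfolding Pfree_def contains3_def by blast

definition triple_system :: "'a set \<Rightarrow> 'a set set \<Rightarrow> bool" where
  "triple_system V H \<longleftrightarrow> finite V \<and> (\<forall>e\<in>H. e \<subseteq> V \<and> card e = 3)"

definition closed_in :: "'a set set \<Rightarrow> 'a set \<Rightarrow> bool" where
  "closed_in H A \<longleftrightarrow> (\<forall>e\<in>H. e \<subseteq> A \<or> e \<inter> A = {})"

definition connected_on :: "'a set \<Rightarrow> 'a set set \<Rightarrow> bool" where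
  "connected_on V H \<longleftrightarrow> (\<forall>A. A \<subseteq> V \<longrightarrow> A \<noteq> {} \<longrightarrow> closed_in H A \<longrightarrow> A = V)"

text \<open>Phrased as the absence of a two-edge loose path with end z, the form that P-freeness
  yields; \<open>terminalD\<close> turns it into the statement about common vertices.\<close>

definition terminal :: "'a \<Rightarrow> 'a set set \<Rightarrow> bool" where
  "terminal z H \<longleftrightarrow> (\<forall>a b c d. distinct [z,a,b,c,d] \<longrightarrow> {z,a,b} \<in> H \<longrightarrow> {b,c,d} \<notin> H)"

text \<open>Asking for a root in every nonempty closed set, and not only for some terminal vertex,
  lets the property pass to both sides of a split and survive the deletion of a pair. In particular
  every isolated vertex is a root.\<close>

definition rooted :: "'a set \<Rightarrow> 'a set \<Rightarrow> 'a set set \<Rightarrow> bool" where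
  "rooted V Z H \<longleftrightarrow> Z \<subseteq> V \<and> (\<forall>z\<in>Z. terminal z H) \<and>
     (\<forall>A. A \<subseteq> V \<longrightarrow> A \<noteq> {} \<longrightarrow> closed_in H A \<longrightarrow> A \<inter> Z \<noteq> {})"

lemma tsD:
  assumes "triple_system V H" "e \<in> H"
  shows "e \<subseteq> V" "card e = 3"
  using assms unfolding triple_system_def by auto

lemma ts_finite:
  assumes "triple_system V H"
  shows "finite V" "finite H"
proof -
  show "finite V" using assms unfolding triple_system_def by auto
  moreover have "H \<subseteq> Pow V" using assms unfolding triple_system_def by auto
  ultimately show "finite H" by (meson finite_Pow_iff finite_subset)
qed

lemma ts_subset: "triple_system V H \<Longrightarrow> H' \<subseteq> H \<Longrightarrow> triple_system V H'"
  unfolding triple_system_def by blast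

lemma ts_restrict: "triple_system V H \<Longrightarrow> A \<subseteq> V \<Longrightarrow> triple_system A {e \<in> H. e \<subseteq> A}"
  unfolding triple_system_def by (auto intro: finite_subset)

lemma card3_elem:
  assumes "card e = 3" "x \<in> e"
  obtains a b where "e = {x,a,b}" "x \<noteq> a" "x \<noteq> b" "a \<noteq> b"
proof -
  have "card (e - {x}) = 2" using assms by (simp add: card_Diff_singleton)
  then obtain a b where "e - {x} = {a,b}" "a \<noteq> b" by (auto simp: card_2_iff)
  then have "e = {x,a,b}" "x \<noteq> a" "x \<noteq> b" using assms(2) by auto
  then show ?thesis using that \<open>a \<noteq> b\<close> by blast
qed

lemma card3_two_elems:
  assumes "card e = 3" "x \<in> e" "y \<in> e" "x \<noteq> y"
  obtains a where "e = {x,y,a}" "a \<noteq> x" "a \<noteq> y"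
proof -
  obtain a b where ab: "e = {x,a,b}" "x \<noteq> a" "x \<noteq> b" "a \<noteq> b" using card3_elem assms(1,2) by metis
  then have "y = a \<or> y = b" using assms by auto
  then show ?thesis using that ab by (metis insert_commute)
qed

lemma card3_eq:
  assumes "card e = 3" "x \<in> e" "y \<in> e" "z \<in> e" "distinct [x,y,z]"
  shows "e = {x,y,z}"
proof -
  obtain a where "e = {x,y,a}" using card3_two_elems[of e x y] assms by auto
  then show ?thesis using assms by auto
qed

lemma terminal_subset: "terminal z H \<Longrightarrow> H' \<subseteq> H \<Longrightarrow> terminal z H'"
  unfolding terminal_def by blast

lemma terminalD:
  assumes "terminal z H" "{z,a,b} \<in> H" "distinct [z,a,b]" "g \<in> H" "card g = 3" "z \<notin> g" "a \<in> g \<or> b \<in> g"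
  shows "a \<in> g \<and> b \<in> g"
proof (rule ccontr)
  assume n: "\<not> ?thesis"
  show False
  proof (cases "b \<in> g")
    case True
    then have "a \<notin> g" using n by auto
    obtain c d where "g = {b,c,d}" "b \<noteq> c" "b \<noteq> d" "c \<noteq> d" using card3_elem[OF assms(5) True] by metis
    then show False using assms \<open>a \<notin> g\<close> unfolding terminal_def
      by (metis distinct_length_2_or_more distinct_singleton insertCI)
  next
    case False
    then have "a \<in> g" using assms by auto
    obtain c d where "g = {a,c,d}" "a \<noteq> c" "a \<noteq> d" "c \<noteq> d" using card3_elem[OF assms(5) \<open>a \<in> g\<close>] by metis
    moreover have "{z,b,a} \<in> H" using assms(2) by (simp add: insert_commute)
    ultimately show False using assms False unfolding terminal_def
      by (metis distinct_length_2_or_more distinct_singleton insertCI)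
  qed
qed

lemma not_terminal:
  assumes "triple_system V H" "\<not> terminal z H"
  obtains a b c d where "distinct [z,a,b,c,d]" "{z,a,b} \<in> H" "{b,c,d} \<in> H"
  using assms unfolding terminal_def by blast

lemma closed_compl:
  assumes "triple_system V H" "closed_in H A"
  shows "closed_in H (V - A)"
  using assms unfolding triple_system_def closed_in_def by blast

lemma card_split:
  assumes "triple_system V H" "closed_in H A"
  shows "card H = card {e \<in> H. e \<subseteq> A} + card {e \<in> H. e \<subseteq> V - A}"
proof -
  have U: "{e \<in> H. e \<subseteq> A} \<union> {e \<in> H. e \<subseteq> V - A} = H"
    using assms unfolding triple_system_def closed_in_def by blast
  have "{e \<in> H. e \<subseteq> A} \<inter> {e \<in> H. e \<subseteq> V - A} = {}"
  proof -
    have "False" if "e \<in> H" "e \<subseteq> A" "e \<subseteq> V - A" for e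
    proof -
      have "e = {}" using that by blast
      then show False using tsD(2)[OF assms(1) that(1)] by simp
    qed
    then show ?thesis by blast
  qed
  moreover have "finite {e \<in> H. e \<subseteq> A}" "finite {e \<in> H. e \<subseteq> V - A}"
    using ts_finite[OF assms(1)] by auto
  ultimately have "card ({e \<in> H. e \<subseteq> A} \<union> {e \<in> H. e \<subseteq> V - A}) = card {e \<in> H. e \<subseteq> A} + card {e \<in> H. e \<subseteq> V - A}"
    by (intro card_Un_disjoint)
  with U show ?thesis by metis
qed

lemma rooted_restrict:
  assumes "rooted V Z H" "closed_in H A" "A \<subseteq> V"
  shows "rooted A (Z \<inter> A) {e \<in> H. e \<subseteq> A}"
  unfolding rooted_def
proof (intro conjI allI impI ballI)
  show "Z \<inter> A \<subseteq> A" by auto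
  show "terminal z {e \<in> H. e \<subseteq> A}" if "z \<in> Z \<inter> A" for z
    using that assms terminal_subset[of z H "{e \<in> H. e \<subseteq> A}"] unfolding rooted_def by auto
  fix B assume B: "B \<subseteq> A" "B \<noteq> {}" "closed_in {e \<in> H. e \<subseteq> A} B"
  have "closed_in H B" using B assms(2) unfolding closed_in_def by blast
  moreover have "B \<subseteq> V" using B(1) assms(3) by simp
  ultimately have "B \<inter> Z \<noteq> {}" using assms(1) B(2) unfolding rooted_def by simp
  then show "B \<inter> (Z \<inter> A) \<noteq> {}" using B(1) by blast
qed

text \<open>A closed set and its complement, if both nonempty, would each need a root.\<close>

lemma rooted_single_connected:
  assumes "triple_system V H" "rooted V {z} H"
  shows "connected_on V H"
  unfolding connected_on_def
proof (intro allI impI)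
  fix A assume A: "A \<subseteq> V" "A \<noteq> {}" "closed_in H A"
  have "z \<in> A" using A assms(2) unfolding rooted_def by blast
  moreover have "z \<in> V - A" if "V - A \<noteq> {}"
    using that assms(2) closed_compl[OF assms(1) A(3)] unfolding rooted_def by blast
  ultimately show "A = V" using A by blast
qed

lemma connected_vertex_edge:
  assumes "triple_system V H" "connected_on V H" "v \<in> V" "V \<noteq> {v}"
  obtains e where "e \<in> H" "v \<in> e"
proof (rule ccontr)
  assume "\<not> thesis"
  then have "closed_in H {v}" using that unfolding closed_in_def by blast
  then have "{v} = V" using assms(2,3) unfolding connected_on_def by auto
  then show False using assms(4) by auto
qed

text \<open>Every edge meeting the pair \<open>{x,y}\<close> lies in \<open>{x,y} \<union> D\<close>; hence removing the pair leaves a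
  system in which each closed set contains one of the apexes in \<open>D\<close>, and by \<open>P\<close>-freeness these
  apexes are terminal.\<close>

lemma pendant_pair:
  assumes ts: "triple_system V H" and pf: "Pfree H" and con: "connected_on V H"
    and z: "z \<in> V" "terminal z H" and g0: "g0 \<in> H" "z \<notin> g0"
  obtains x y D where "x \<in> V" "y \<in> V" "x \<noteq> y" "D \<subseteq> V - {x,y}" "z \<in> D" "2 \<le> card D"
    "rooted (V - {x,y}) D {e \<in> H. e \<inter> {x,y} = {}}"
    "card H \<le> (if card D = 2 then 4 else card D) + card {e \<in> H. e \<inter> {x,y} = {}}"
    "\<forall>e\<in>H. e \<inter> {x,y} \<noteq> {} \<longrightarrow> e \<subseteq> {x,y} \<union> D"
proof -
  note finV = ts_finite(1)[OF ts] and finH = ts_finite(2)[OF ts]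
  \<comment> \<open>Connectivity has to link the edges through z with \<open>g0\<close>; otherwise z
    and its edges would span a proper closed set.\<close>
  have "\<exists>f g. f \<in> H \<and> g \<in> H \<and> z \<in> f \<and> z \<notin> g \<and> f \<inter> g \<noteq> {}"
  proof (rule ccontr)
    assume no: "\<not> ?thesis"
    let ?A = "{z} \<union> \<Union> {e \<in> H. z \<in> e}"
    have "?A \<subseteq> V" using z tsD[OF ts] by auto
    moreover have "closed_in H ?A" unfolding closed_in_def
    proof
      fix e assume e: "e \<in> H"
      show "e \<subseteq> ?A \<or> e \<inter> ?A = {}"
        using e no by (cases "z \<in> e") blast+
    qed
    ultimately have "?A = V" using con unfolding connected_on_def by auto
    moreover have "g0 \<noteq> {}" using tsD(2)[OF ts g0(1)] by auto
    ultimately obtain v where "v \<in> g0" "v \<in> ?A" using tsD(1)[OF ts g0(1)] by blast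
    then show False using no g0 by blast
  qed
  then obtain f g where fg: "f \<in> H" "g \<in> H" "z \<in> f" "z \<notin> g" "f \<inter> g \<noteq> {}" by blast
  obtain x y where f: "f = {z,x,y}" "z \<noteq> x" "z \<noteq> y" "x \<noteq> y"
    using card3_elem[OF tsD(2)[OF ts fg(1)] fg(3)] by metis
  have "x \<in> g \<and> y \<in> g"
    using terminalD[OF z(2), of x y g] f fg tsD(2)[OF ts] by auto
  then obtain w where g: "g = {x,y,w}" "w \<noteq> x" "w \<noteq> y"
    using card3_two_elems[OF tsD(2)[OF ts fg(2)], of x y] f by metis
  have zw: "z \<noteq> w" using g fg by auto
  define D where "D = {v. {x,y,v} \<in> H}"
  have "card {x,y} = 2" using f(4) by simp
  then have "{x,y} \<notin> H" using tsD(2)[OF ts, of "{x,y}"] by auto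
  then have nD: "x \<notin> D" "y \<notin> D" unfolding D_def by (simp_all add: insert_commute insert_absorb)
  have DV: "D \<subseteq> V - {x,y}" using nD tsD(1)[OF ts] unfolding D_def by blast
  have zD: "z \<in> D" using fg f unfolding D_def by (simp add: insert_commute)
  have wD: "w \<in> D" using fg g unfolding D_def by simp
  have finD: "finite D" using finV DV finite_subset by blast
  have D2: "2 \<le> card D" using card_mono[of D "{z,w}"] zD wD zw finD by auto
  \<comment> \<open>Here a is the vertex of the pair that lies in e, and b the other one.
    Terminality of z first puts z into e, then forces the third vertex to be w; a further apex d
    would give the two-edge loose path {z,w,a}, {a,b,d} from z.\<close>
  have one: "e = {z,a,w} \<and> D = {z,w}" if e: "e \<in> H" "a \<in> e" "b \<notin> e" "{a,b} = {x,y}" for e a b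
  proof -
    have cs: "a = x \<and> b = y \<or> a = y \<and> b = x" using that(4) by (auto simp: doubleton_eq_iff)
    then have ab: "a \<noteq> b" "{a,b,z} = {x,y,z}" "{a,b,w} = {x,y,w}" using f(4) by auto
    have E: "{z,b,a} \<in> H" "{a,b,w} \<in> H" using fg f g ab by (auto simp: insert_commute)
    have az: "a \<noteq> z" "b \<noteq> z" "a \<noteq> w" "b \<noteq> w" using cs f g by metis+
    have ze: "z \<in> e"
      using terminalD[OF z(2) E(1), of e] e(1-3) ab(1) az tsD(2)[OF ts e(1)] by auto
    obtain v where v: "e = {z,a,v}" "v \<noteq> z" "v \<noteq> a"
      using card3_two_elems[OF tsD(2)[OF ts e(1)] ze e(2)] az by metis
    have eH: "{z,v,a} \<in> H" using v e by (simp add: insert_commute)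
    have vb: "v \<noteq> b" using v(1) e(3) by auto
    have vw: "v = w"
    proof (rule ccontr)
      assume "v \<noteq> w"
      then have "distinct [z,v,a,b,w]" using v(2,3) vb az ab(1) zw by auto
      then show False using z(2) eH E(2) unfolding terminal_def by blast
    qed
    have "d \<in> {z,w}" if d: "d \<in> D" for d
    proof (rule ccontr)
      assume "d \<notin> {z,w}"
      moreover have "d \<noteq> a" "d \<noteq> b" using d nD cs by auto
      ultimately have "distinct [z,v,a,b,d]" using v(2,3) vb az ab(1) zw vw by auto
      moreover have "{a,b,d} \<in> H" using d cs unfolding D_def by (auto simp: insert_commute)
      ultimately show False using z(2) eH unfolding terminal_def by blast
    qed
    then show ?thesis using v vw zD wD by blast
  qed
  have shape: "(\<exists>v\<in>D. e = {x,y,v}) \<or> (D = {z,w} \<and> (e = {z,x,w} \<or> e = {z,y,w}))"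
    if e: "e \<in> H" "e \<inter> {x,y} \<noteq> {}" for e
  proof (cases "x \<in> e \<and> y \<in> e")
    case True
    then obtain v where "e = {x,y,v}" using card3_two_elems[OF tsD(2)[OF ts e(1)]] f(4) by metis
    then show ?thesis using e unfolding D_def by auto
  next
    case False
    then show ?thesis using one[OF e(1), of x y] one[OF e(1), of y x] e(2) by (auto simp: insert_commute)
  qed
  let ?R = "{e \<in> H. e \<inter> {x,y} = {}}"
  let ?M = "{e \<in> H. e \<inter> {x,y} \<noteq> {}}"
  have sub: "e \<subseteq> {x,y} \<union> D" if eH: "e \<in> H" "e \<inter> {x,y} \<noteq> {}" for e
  proof -
    consider v where "v \<in> D" "e = {x,y,v}" | "e = {z,x,w}" | "e = {z,y,w}" using shape[OF eH] by blast
    then show ?thesis using zD wD by cases simp_all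
  qed
  \<comment> \<open>With the two apexes z and w all four triples of {x,y,z,w} may occur, hence the
    exceptional 4; in every other case \<open>one\<close> leaves one edge per apex.\<close>
  have "card ?M \<le> (if card D = 2 then 4 else card D)"
  proof (cases "D = {z,w}")
    case True
    have "?M \<subseteq> {{x,y,z},{x,y,w},{z,x,w},{z,y,w}}"
    proof
      fix e assume "e \<in> ?M"
      then consider v where "v \<in> D" "e = {x,y,v}" | "e = {z,x,w}" | "e = {z,y,w}" using shape[of e] by blast
      then show "e \<in> {{x,y,z},{x,y,w},{z,x,w},{z,y,w}}" using True by cases blast+
    qed
    then have "card ?M \<le> card {{x,y,z},{x,y,w},{z,x,w},{z,y,w}}" by (intro card_mono) auto
    also have "\<dots> \<le> 4" by (simp add: card_insert_if)
    finally have "card ?M \<le> 4" .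
    then show ?thesis using True zw by auto
  next
    case False
    have "?M \<subseteq> (\<lambda>v. {x,y,v}) ` D" using shape False by blast
    then have M: "card ?M \<le> card D" using finD by (meson card_image_le card_mono finite_imageI le_trans)
    then show ?thesis by auto
  qed
  moreover have "card H \<le> card ?M + card ?R"
  proof -
    have "H = ?M \<union> ?R" by auto
    then have "card H = card (?M \<union> ?R)" by (rule arg_cong)
    then show ?thesis using card_Un_le[of ?M ?R] by linarith
  qed
  ultimately have cH: "card H \<le> (if card D = 2 then 4 else card D) + card ?R" by linarith
  have "rooted (V - {x,y}) D ?R" unfolding rooted_def
  proof (intro conjI ballI allI impI)
    show "D \<subseteq> V - {x,y}" by fact
    show "terminal d ?R" if d: "d \<in> D" for d unfolding terminal_def
    proof (intro allI impI notI)
      fix a b c e assume h: "distinct [d,a,b,c,e]" "{d,a,b} \<in> ?R" "{b,c,e} \<in> ?R"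
      have "{x,y,d} \<in> H" using d unfolding D_def by auto
      moreover have "distinct [x,y,d,a,b,c,e]" using h f nD d by auto
      ultimately show False using PfreeD[OF pf, of x y d a b c e] h(2,3) by simp
    qed
    fix A assume A: "A \<subseteq> V - {x,y}" "A \<noteq> {}" "closed_in ?R A"
    show "A \<inter> D \<noteq> {}"
    proof
      assume AD: "A \<inter> D = {}"
      have "closed_in H A" unfolding closed_in_def
      proof
        fix e assume e: "e \<in> H"
        show "e \<subseteq> A \<or> e \<inter> A = {}"
        proof (cases "e \<inter> {x,y} = {}")
          case True then show ?thesis using A(3) e unfolding closed_in_def by auto
        next
          case False
          then show ?thesis using sub[OF e False] A(1) AD by blast
        qed
      qed
      then have "A = V" using con A unfolding connected_on_def by blast
      then show False using A(1) fg(1) f tsD(1)[OF ts] by blast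
    qed
  qed
  moreover have "x \<in> V" "y \<in> V" using tsD(1)[OF ts fg(1)] f by auto
  ultimately show ?thesis using that[of x y D] f(4) DV zD D2 cH sub by blast
qed

section \<open>Numerical bounds\<close>

lemma choose_two_Suc: "Suc n choose 2 = (n choose 2) + n"
  by (simp add: numeral_2_eq_2)

lemma twice_choose_two: "2 * (n choose 2) = n * (n - 1)"
proof (induction n)
  case (Suc n) then show ?case by (cases n) (auto simp: choose_two_Suc algebra_simps)
qed simp

lemma choose_two_add: "(a + b choose 2) = (a choose 2) + (b choose 2) + a * b"
proof -
  have "2 * (a + b choose 2) = 2 * ((a choose 2) + (b choose 2) + a * b)"
    unfolding distrib_left twice_choose_two by (cases a; cases b) (auto simp: algebra_simps)
  then show ?thesis by simp
qed

text \<open>Away from \<open>k = 4\<close>, where the complete system has one edge more, the full star is optimal.\<close>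

definition root_bd :: "nat \<Rightarrow> nat" where
  "root_bd k = (if k = 4 then 4 else k - 1 choose 2)"

text \<open>From \<open>k = 4\<close> on, the table solves \<open>r k = max 4 (k - 2) + r (k - 2)\<close>: delete a pair whose
  apexes are all other vertices; a pair with two apexes spans up to four edges. From \<open>k = 12\<close> on, the
  comet is at least as good.\<close>

definition root2_bd :: "nat \<Rightarrow> nat" where
  "root2_bd k = (if k \<le> 12 then [0,0,0,1,4,5,8,10,14,17,22,26,32] ! k else 4 + (k - 4 choose 2))"

text \<open>Bounds the number of edges plus the number of terminal vertices: a deleted pair with \<open>d\<close> apexes
  costs \<open>d\<close> edges, which are charged to the apexes.\<close>

definition apex_bd :: "nat \<Rightarrow> nat" where
  "apex_bd k = (if k \<le> 7 then [0,1,2,4,8,10,14,17] ! k else (k - 1 choose 2) + 1)"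

lemma root2_bd_table:
  "root2_bd 0 = 0" "root2_bd (Suc 0) = 0" "root2_bd 1 = 0" "root2_bd 2 = 0" "root2_bd 3 = 1" "root2_bd 4 = 4" "root2_bd 5 = 5" "root2_bd 6 = 8" "root2_bd 7 = 10" "root2_bd 8 = 14"
  "root2_bd 9 = 17" "root2_bd 10 = 22" "root2_bd 11 = 26" "root2_bd 12 = 32" "root2_bd 13 = 40"
  by (simp_all add: root2_bd_def choose_two)

lemma root_bd_0: "root_bd 0 = 0"
  by (simp add: root_bd_def choose_two)

lemma apex_bd_0: "apex_bd 0 = 0"
  by (simp add: apex_bd_def)

lemma nat_le_12_cases:
  assumes "(k::nat) \<le> 12"
  obtains "k=0" | "k=1" | "k=2" | "k=3" | "k=4" | "k=5" | "k=6" | "k=7" | "k=8" | "k=9" | "k=10" | "k=11" | "k=12"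
  using assms by (auto simp: le_Suc_eq numeral_eq_Suc)

lemma root_bd_Suc_le: "root_bd k \<le> root_bd (Suc k)"
proof (cases "k \<le> 12")
  case True then show ?thesis by (cases rule: nat_le_12_cases) (simp_all add: root_bd_def choose_two)
next
  case False
  then obtain j where "k = Suc j" "j \<ge> 12" by (cases k) auto
  then show ?thesis by (simp add: root_bd_def choose_two_Suc)
qed

lemma apex_bd_Suc: "apex_bd k + 1 \<le> apex_bd (Suc k)"
proof (cases "k \<le> 12")
  case True then show ?thesis by (cases rule: nat_le_12_cases) (simp_all add: apex_bd_def choose_two)
next
  case False
  then obtain j where "k = Suc j" "j \<ge> 12" by (cases k) auto
  then show ?thesis by (simp add: apex_bd_def choose_two_Suc)
qed

lemma root_bd_ge: "k - 1 choose 2 \<le> root_bd k"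
  by (simp add: root_bd_def choose_two)

text \<open>With four explicit successors every C(k - i, 2) with i \<le> 4 becomes C(j, 2) plus a
  linear term, so the inequalities turn linear.\<close>

lemma large_form:
  assumes "\<not> k \<le> 12"
  obtains j where "k = Suc (Suc (Suc (Suc j)))" "9 \<le> j"
proof -
  have "k = Suc (Suc (Suc (Suc (k - 4))))" "9 \<le> k - 4" using assms by auto
  then show ?thesis using that by blast
qed

lemma root2_bd_le_root_bd: "root2_bd k \<le> root_bd k"
proof (cases "k \<le> 12")
  case True then show ?thesis by (cases rule: nat_le_12_cases) (simp_all add: root_bd_def root2_bd_def choose_two)
next
  case False
  then obtain j where "k = Suc (Suc (Suc (Suc j)))" "9 \<le> j" by (rule large_form)
  then show ?thesis by (simp add: root2_bd_def root_bd_def choose_two_Suc)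
qed

lemma root_bd_less_apex_bd: "1 \<le> k \<Longrightarrow> root_bd k + 1 \<le> apex_bd k"
proof (cases "k \<le> 12")
  case True
  assume "1 \<le> k"
  with True show ?thesis by (cases rule: nat_le_12_cases) (simp_all add: root_bd_def apex_bd_def choose_two)
next
  case False then show ?thesis by (simp add: apex_bd_def root_bd_def)
qed

text \<open>Together with \<open>root_bd_less_apex_bd\<close> this explains \<open>apex_bd\<close>:
  for k \<ge> 1 it is the larger of \<open>root2_bd k + k\<close> (all vertices may be roots) and
  \<open>root_bd k + 1\<close> (one root). The former is at least the latter exactly for k \<le>
  8.\<close>

lemma root2_bd_plus_le_apex_bd: "root2_bd k + k \<le> apex_bd k"
proof (cases "k \<le> 12")
  case True then show ?thesis by (cases rule: nat_le_12_cases) (simp_all add: apex_bd_def root2_bd_def choose_two)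
next
  case False
  then obtain j where "k = Suc (Suc (Suc (Suc j)))" "9 \<le> j" by (rule large_form)
  then show ?thesis by (simp add: root2_bd_def apex_bd_def choose_two_Suc)
qed

lemma choose_two_superadd: "(a choose 2) + (b choose 2) \<le> (a + b choose 2)"
proof -
  have "2 * ((a choose 2) + (b choose 2)) \<le> 2 * (a + b choose 2)"
    unfolding distrib_left twice_choose_two by (cases a; cases b) (auto simp: algebra_simps)
  then show ?thesis by simp
qed

text \<open>Two stars glued at their centres lie in a star on a + b - 1 vertices, so a split costs a
  vertex. Only the exceptional value at 4 needs its own arithmetic.\<close>

lemma root_bd_superadd:
  assumes "1 \<le> a" "1 \<le> b"
  shows "root_bd a + root_bd b \<le> root_bd (a + b - 1)"
proof -
  have *: "root_bd 4 + root_bd b \<le> root_bd (4 + b - 1)" if "1 \<le> b" for b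
  proof (cases "b \<le> 12")
    case True then show ?thesis using that
      by (cases rule: nat_le_12_cases) (simp_all add: root_bd_def choose_two)
  next
    case False
    then obtain j where "b = Suc (Suc (Suc (Suc j)))" "9 \<le> j" by (rule large_form)
    moreover have "(6 + j choose 2) = 15 + (j choose 2) + 6 * j"
      using choose_two_add[of 6 j] choose_two[of 6] by simp
    ultimately show ?thesis by (simp add: root_bd_def choose_two_Suc)
  qed
  show ?thesis
  proof (cases "a = 4 \<or> b = 4")
    case True then show ?thesis using *[of a] *[of b] assms by (auto simp: add.commute)
  next
    case False
    have "(a - 1 choose 2) + (b - 1 choose 2) \<le> (a - 1 + (b - 1) choose 2)" by (rule choose_two_superadd)
    also have "a - 1 + (b - 1) = a + b - 1 - 1" using assms by simp
    also have "(\<dots> choose 2) \<le> root_bd (a + b - 1)" by (rule root_bd_ge)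
    finally show ?thesis using False by (simp add: root_bd_def)
  qed
qed

text \<open>When two parts are glued at a root, their edges add up and one root is counted twice,
  hence the + 1. Equality holds for a = 1.\<close>

lemma apex_bd_superadd:
  assumes "1 \<le> a" "1 \<le> b"
  shows "apex_bd a + apex_bd b \<le> apex_bd (a + b - 1) + 1"
proof -
  have *: "apex_bd a + apex_bd b \<le> apex_bd (a + b - 1) + 1" if h: "1 \<le> a" "1 \<le> b" "a \<le> 7" for a b
  proof (cases "b \<le> 12")
    case True
    consider "a=1" | "a=2" | "a=3" | "a=4" | "a=5" | "a=6" | "a=7" using h by linarith
    then show ?thesis using True h(2)
      by cases (cases rule: nat_le_12_cases, simp_all add: apex_bd_def choose_two)+
  next
    case False
    define c where "c = b - 1"
    have b: "b = Suc c" "12 \<le> c" using False c_def by auto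
    consider "a=1" | "a=2" | "a=3" | "a=4" | "a=5" | "a=6" | "a=7" using h by linarith
    then show ?thesis
      using b by cases (simp_all add: apex_bd_def choose_two_Suc eval_nat_numeral)
  qed
  show ?thesis
  proof (cases "a \<le> 7 \<or> b \<le> 7")
    case True then show ?thesis using *[of a b] *[of b a] assms by (auto simp: add.commute)
  next
    case False
    have "(a - 1 choose 2) + (b - 1 choose 2) + (a - 1) * (b - 1) = (a - 1 + (b - 1) choose 2)" by (rule choose_two_add[symmetric])
    moreover have "a - 1 + (b - 1) = a + b - 1 - 1" using assms by simp
    moreover have "1 \<le> (a - 1) * (b - 1)" using mult_le_mono[of 1 "a - 1" 1 "b - 1"] False by linarith
    moreover have "\<not> a + b - 1 \<le> 7" using False by linarith
    ultimately show ?thesis using False unfolding apex_bd_def by auto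
  qed
qed

text \<open>One inequality for each outcome of deleting a pair: connected remainder; disconnected
  remainder with two apexes, where the pair costs up to 4; disconnected remainder with more apexes,
  whose number \<open>apex_bd\<close> absorbs. The argument k - 3 is k - 2 less the vertex that a
  split costs.\<close>

lemma root2_bd_step:
  assumes "4 \<le> k"
  shows "max 4 (k - 2) + root2_bd (k - 2) \<le> root2_bd k" "4 + root_bd (k - 3) \<le> root2_bd k" "apex_bd (k - 3) + 1 \<le> root2_bd k"
proof -
  have "max 4 (k - 2) + root2_bd (k - 2) \<le> root2_bd k \<and> 4 + root_bd (k - 3) \<le> root2_bd k \<and> apex_bd (k - 3) + 1 \<le> root2_bd k"
  proof (cases "k \<le> 12")
    case True then show ?thesis using assms
      by (cases rule: nat_le_12_cases) (simp_all add: root_bd_def root2_bd_def apex_bd_def choose_two)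
  next
    case False
    then obtain j where j: "k = Suc (Suc (Suc (Suc j)))" "9 \<le> j" by (rule large_form)
    show ?thesis
    \<comment> \<open>For k = 13 and k = 14 the argument k - 2 still falls into the table of
      \<open>root2_bd\<close>.\<close>
    proof (cases "j \<le> 10")
      case True
      then consider "j = 9" | "j = 10" using j by linarith
      then show ?thesis using j by cases (simp_all add: root_bd_def root2_bd_def apex_bd_def choose_two)
    next
      case False
      define i where "i = j - 2"
      have "j = Suc (Suc i)" "i \<ge> 9" using False i_def by auto
      with j show ?thesis by (simp add: root_bd_def root2_bd_def apex_bd_def choose_two_Suc)
    qed
  qed
  then show "max 4 (k - 2) + root2_bd (k - 2) \<le> root2_bd k" "4 + root_bd (k - 3) \<le> root2_bd k" "apex_bd (k - 3) + 1 \<le> root2_bd k" by auto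
qed

section \<open>Systems rooted at terminal vertices\<close>

lemma card_triple_system:
  assumes "triple_system V H"
  shows "card H \<le> card V choose 3"
proof -
  have "card H \<le> card {e. e \<subseteq> V \<and> card e = 3}"
  proof (rule card_mono)
    show "finite {e. e \<subseteq> V \<and> card e = 3}" using ts_finite(1)[OF assms] by simp
    show "H \<subseteq> {e. e \<subseteq> V \<and> card e = 3}" using tsD[OF assms] by auto
  qed
  also have "\<dots> = card V choose 3" using n_subsets[OF ts_finite(1)[OF assms]] by simp
  finally show ?thesis .
qed

lemma card_star:
  assumes "triple_system V H" "z \<in> V" "\<forall>e\<in>H. z \<in> e"
  shows "card H \<le> card V - 1 choose 2"
proof -
  have fV: "finite (V - {z})" using ts_finite(1)[OF assms(1)] by simp
  have inj: "inj_on (\<lambda>e. e - {z}) H"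
  proof (rule inj_onI)
    fix e f assume "e \<in> H" "f \<in> H" "e - {z} = f - {z}"
    then show "e = f" using assms(3) by (metis insert_Diff)
  qed
  have "(\<lambda>e. e - {z}) ` H \<subseteq> {p. p \<subseteq> V - {z} \<and> card p = 2}"
  proof
    fix p assume "p \<in> (\<lambda>e. e - {z}) ` H"
    then obtain e where e: "e \<in> H" "p = e - {z}" by blast
    then have "p \<subseteq> V - {z}" using tsD(1)[OF assms(1) e(1)] by blast
    moreover have "card p = 2" using tsD(2)[OF assms(1) e(1)] assms(3) e by (simp add: card_Diff_singleton)
    ultimately show "p \<in> {p. p \<subseteq> V - {z} \<and> card p = 2}" by simp
  qed
  then have "card ((\<lambda>e. e - {z}) ` H) \<le> card {p. p \<subseteq> V - {z} \<and> card p = 2}"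
    by (rule card_mono[rotated]) (use fV in simp)
  also have "\<dots> = card (V - {z}) choose 2" by (rule n_subsets[OF fV])
  finally show ?thesis using inj assms(2) ts_finite(1)[OF assms(1)] by (simp add: card_image)
qed

lemma card_pair_edges:
  assumes "triple_system V H" "x \<in> V" "y \<in> V" "x \<noteq> y" "\<forall>e\<in>H. x \<in> e \<and> y \<in> e"
  shows "card H \<le> card V - 2"
proof -
  have fV: "finite V" using ts_finite(1)[OF assms(1)] .
  have "H \<subseteq> (\<lambda>v. {x,y,v}) ` (V - {x,y})"
  proof
    fix e assume e: "e \<in> H"
    then obtain v where v: "e = {x,y,v}" "v \<noteq> x" "v \<noteq> y"
      using card3_two_elems[OF tsD(2)[OF assms(1) e], of x y] assms(4,5) by metis
    then have "v \<in> V - {x,y}" using tsD(1)[OF assms(1) e] by simp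
    with v show "e \<in> (\<lambda>v. {x,y,v}) ` (V - {x,y})" by simp
  qed
  then have "card H \<le> card (V - {x,y})" using fV by (meson finite_Diff finite_imageI card_image_le card_mono le_trans)
  also have "\<dots> = card V - 2" using assms(2-4) fV by (simp add: card_Diff_subset)
  finally show ?thesis .
qed

text \<open>If the centre of a star is \<open>z\<close> and another vertex \<open>z'\<close> is terminal, the link of \<open>z\<close> is a
  graph star or a triangle.\<close>

lemma card_star_two_terminals:
  assumes ts: "triple_system V H" and con: "connected_on V H" and "z \<in> V" "z' \<in> V" "z \<noteq> z'"
    and t: "terminal z' H" and st: "\<forall>e\<in>H. z \<in> e"
  shows "card H \<le> root2_bd (card V)"
proof -
  note fV = ts_finite[OF ts]
  have "V \<noteq> {z'}" using assms by auto
  then obtain f where f: "f \<in> H" "z' \<in> f" using connected_vertex_edge[OF ts con \<open>z' \<in> V\<close>] by metis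
  then obtain x where x: "f = {z',z,x}" "x \<noteq> z" "x \<noteq> z'"
    using card3_two_elems[OF tsD(2)[OF ts f(1)] f(2), of z] st f assms(5) by metis
  have xV: "x \<in> V" using tsD(1)[OF ts f(1)] x by auto
  have fz: "{z',z,x} \<in> H" "distinct [z',z,x]" using f x \<open>z \<noteq> z'\<close> by auto
  have cV: "3 \<le> card V" using card_mono[OF fV(1) tsD(1)[OF ts f(1)]] tsD(2)[OF ts f(1)] by simp
  have main: "card H \<le> card V - 1"
  \<comment> \<open>If z' lies in a second edge {z',z,x2}, its terminality makes {z,x,x2} the only
    possible edge avoiding z'. Otherwise every edge contains x.\<close>
  proof (cases "\<exists>x2. x2 \<noteq> x \<and> {z',z,x2} \<in> H")
    case True
    then obtain x2 where x2: "x2 \<noteq> x" "{z',z,x2} \<in> H" by blast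
    have d2: "distinct [z',z,x2]"
    proof -
      have "card {z',z,x2} = 3" using tsD(2)[OF ts x2(2)] .
      then show ?thesis by (auto simp: card_insert_if split: if_splits)
    qed
    have "e = {z,x,x2}" if e: "e \<in> H" "z' \<notin> e" for e
    proof -
      have "z \<in> e" using st e by blast
      then have "x \<in> e" "x2 \<in> e"
        using terminalD[OF t fz e(1) tsD(2)[OF ts e(1)] e(2)] terminalD[OF t x2(2) d2 e(1) tsD(2)[OF ts e(1)] e(2)] by auto
      then show ?thesis using card3_eq[OF tsD(2)[OF ts e(1)] \<open>z \<in> e\<close>, of x x2] d2 x x2 by auto
    qed
    then have "H \<subseteq> insert {z,x,x2} {e \<in> H. z \<in> e \<and> z' \<in> e}" using st by blast
    then have "card H \<le> Suc (card {e \<in> H. z \<in> e \<and> z' \<in> e})"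
    proof -
      let ?K = "{e \<in> H. z \<in> e \<and> z' \<in> e}"
      assume "H \<subseteq> insert {z,x,x2} ?K"
      moreover have "finite ?K" using fV(2) by simp
      ultimately have "card H \<le> card (insert {z,x,x2} ?K)" by (intro card_mono) auto
      also have "\<dots> \<le> Suc (card ?K)" using \<open>finite ?K\<close> by (simp add: card_insert_if)
      finally show ?thesis .
    qed
    moreover have "card {e \<in> H. z \<in> e \<and> z' \<in> e} \<le> card V - 2"
      using card_pair_edges[OF ts_subset[OF ts], of "{e \<in> H. z \<in> e \<and> z' \<in> e}" z z'] assms by blast
    ultimately show ?thesis using cV by linarith
  next
    case False
    have "x \<in> e" if e: "e \<in> H" for e
    proof (cases "z' \<in> e")
      case True
      then obtain v where v: "e = {z',z,v}" using card3_two_elems[OF tsD(2)[OF ts e] True, of z] st e \<open>z \<noteq> z'\<close> by metis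
      then have "v = x" using False e by metis
      then show ?thesis using v by simp
    next
      case False
      then show ?thesis using terminalD[OF t fz e tsD(2)[OF ts e] False] st e by auto
    qed
    then have "card H \<le> card V - 2" using card_pair_edges[OF ts \<open>z \<in> V\<close> xV] x st by auto
    then show ?thesis by linarith
  qed
  show ?thesis
  \<comment> \<open>On three vertices \<open>card V - 1\<close> is 2 and exceeds
    \<open>root2_bd 3\<close>, so this size is counted directly.\<close>
  proof (cases "card V = 3")
    case True
    then show ?thesis using card_triple_system[OF ts] by (simp add: root2_bd_table)
  next
    case False
    have "card V - 1 \<le> root2_bd (card V)"
    proof (cases "card V \<le> 12")
      case True then show ?thesis using False cV by (cases rule: nat_le_12_cases) (simp_all add: root2_bd_table)
    next
      case False
      then obtain j where "card V = Suc (Suc (Suc (Suc j)))" "9 \<le> j" by (rule large_form)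
      moreover have "j + 3 \<le> (j choose 2)"
      proof -
        obtain i where i: "j = i + 9" using \<open>9 \<le> j\<close> by (metis add.commute le_Suc_ex)
        have "(i + 9 choose 2) = (i choose 2) + 36 + i * 9" using choose_two_add[of i 9] choose_two[of 9] by simp
        then show ?thesis using i by simp
      qed
      ultimately show ?thesis by (simp add: root2_bd_def)
    qed
    with main show ?thesis by linarith
  qed
qed

lemma rooted_nonempty: "rooted V Z H \<Longrightarrow> V \<noteq> {} \<Longrightarrow> triple_system V H \<Longrightarrow> Z \<noteq> {}"
  unfolding rooted_def triple_system_def closed_in_def by blast

text \<open>The bounds need a joint induction, since each case of \<open>root2_bd_step\<close> uses
  a different one. The second asks for two roots because a large full star, rooted at its centre
  only, exceeds \<open>root2_bd\<close>.\<close>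

definition has_rooted_bounds :: "'a set \<Rightarrow> 'a set \<Rightarrow> 'a set set \<Rightarrow> bool" where
  "has_rooted_bounds V Z H \<longleftrightarrow> card H \<le> root_bd (card V) \<and>
     (connected_on V H \<longrightarrow> 2 \<le> card Z \<longrightarrow> card H \<le> root2_bd (card V)) \<and> card H + card Z \<le> apex_bd (card V)"

lemma card_parts:
  assumes "finite V" "A \<subseteq> V"
  shows "card V = card A + card (V - A)"
  using assms by (metis card_Diff_subset card_mono finite_subset le_add_diff_inverse)

text \<open>Each side is bounded separately, and superadditivity trades the two sides for one system
  with a vertex less. The induction hypothesis is an explicit assumption, so that the lemma serves
  inside the induction and later with \<open>rooted_bounds\<close> in its place.\<close>

lemma rooted_split_bounds:
  fixes V :: "'a set"
  assumes ts: "triple_system V H" and pf: "Pfree H" and r: "rooted V Z H"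
    and A: "A \<subseteq> V" "A \<noteq> {}" "A \<noteq> V" "closed_in H A"
    and IH: "\<And>V' Z' H'. card V' < card V \<Longrightarrow> triple_system V' H' \<Longrightarrow> Pfree H' \<Longrightarrow> rooted V' Z' H' \<Longrightarrow>
      has_rooted_bounds V' Z' (H' :: 'a set set)"
  shows "card H \<le> root_bd (card V - 1)" "card H + card Z \<le> apex_bd (card V - 1) + 1"
proof -
  note fV = ts_finite[OF ts]
  let ?B = "V - A"
  let ?HA = "{e \<in> H. e \<subseteq> A}" and ?HB = "{e \<in> H. e \<subseteq> ?B}"
  have fA: "finite A" "finite ?B" using fV A finite_subset by auto
  have cA: "1 \<le> card A" "1 \<le> card ?B" using A fA by (auto simp: Suc_le_eq card_gt_0_iff)
  note cV = card_parts[OF fV(1) A(1)]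
  have cB: "closed_in H ?B" by (rule closed_compl[OF ts A(4)])
  have BV: "?B \<subseteq> V" by simp
  have lt: "card A < card V" "card ?B < card V" using cA cV by linarith+
  have pfA: "Pfree ?HA" "Pfree ?HB" by (rule Pfree_subset[OF pf], simp)+
  have sub: "has_rooted_bounds A (Z \<inter> A) ?HA" "has_rooted_bounds ?B (Z \<inter> ?B) ?HB"
    by (rule IH[OF lt(1) ts_restrict[OF ts A(1)] pfA(1) rooted_restrict[OF r A(4) A(1)]],
        rule IH[OF lt(2) ts_restrict[OF ts BV] pfA(2) rooted_restrict[OF r cB BV]])
  have cH: "card H = card ?HA + card ?HB" by (rule card_split[OF ts A(4)])
  have "Z = (Z \<inter> A) \<union> (Z \<inter> ?B)" using r unfolding rooted_def by blast
  moreover have "finite Z" using r fV finite_subset unfolding rooted_def by blast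
  ultimately have cZ: "card Z = card (Z \<inter> A) + card (Z \<inter> ?B)"
    using card_Un_disjoint[of "Z \<inter> A" "Z \<inter> ?B"] by (metis Diff_disjoint Int_assoc Int_commute Int_empty_right finite_Int)
  have "card H \<le> root_bd (card A) + root_bd (card ?B)" using sub cH unfolding has_rooted_bounds_def by linarith
  also have "\<dots> \<le> root_bd (card A + card ?B - 1)" by (rule root_bd_superadd[OF cA])
  finally show "card H \<le> root_bd (card V - 1)" using cV by simp
  have "card H + card Z \<le> apex_bd (card A) + apex_bd (card ?B)" using sub cH cZ unfolding has_rooted_bounds_def by linarith
  also have "\<dots> \<le> apex_bd (card A + card ?B - 1) + 1" by (rule apex_bd_superadd[OF cA])
  finally show "card H + card Z \<le> apex_bd (card V - 1) + 1" using cV by simp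
qed

text \<open>The remainder after deleting a pair has at least two roots, so a connected remainder
  falls under the sharper bound again; a disconnected one gains from the vertex lost in a
  split.\<close>

lemma nonstar_terminal_bound_step:
  fixes V :: "'a set"
  assumes ts: "triple_system V H" and pf: "Pfree H" and con: "connected_on V H"
    and z: "z \<in> V" "terminal z H" and g0: "g0 \<in> H" "z \<notin> g0"
    and IH: "\<And>V' Z' H'. card V' < card V \<Longrightarrow> triple_system V' H' \<Longrightarrow> Pfree H' \<Longrightarrow> rooted V' Z' H' \<Longrightarrow>
      has_rooted_bounds V' Z' (H' :: 'a set set)"
  shows "card H \<le> root2_bd (card V)"
proof -
  note fV = ts_finite[OF ts]
  obtain x y D where D: "x \<in> V" "y \<in> V" "x \<noteq> y" "D \<subseteq> V - {x,y}" "z \<in> D" "2 \<le> card D"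
    and rt: "rooted (V - {x,y}) D {e \<in> H. e \<inter> {x,y} = {}}"
    and cH: "card H \<le> (if card D = 2 then 4 else card D) + card {e \<in> H. e \<inter> {x,y} = {}}"
    by (rule pendant_pair[OF ts pf con z g0])
  let ?W = "V - {x,y}" and ?R = "{e \<in> H. e \<inter> {x,y} = {}}"
  have cW: "card ?W = card V - 2" using D fV by (simp add: card_Diff_subset)
  have cD: "card D \<le> card V - 2" using card_mono[OF _ D(4)] fV cW by simp
  have k4: "4 \<le> card V" using cD D(6) by linarith
  have tsW: "triple_system ?W ?R" using ts unfolding triple_system_def by auto
  have pfW: "Pfree ?R" by (rule Pfree_subset[OF pf]) auto
  have b: "has_rooted_bounds ?W D ?R" by (rule IH[OF _ tsW pfW rt]) (use cW k4 in linarith)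
  show ?thesis
  proof (cases "connected_on ?W ?R")
    case True
    then have "card ?R \<le> root2_bd (card V - 2)" using b D(6) cW unfolding has_rooted_bounds_def by metis
    moreover have "(if card D = 2 then 4 else card D) \<le> max 4 (card V - 2)" using cD by auto
    ultimately show ?thesis using cH root2_bd_step(1)[OF k4] by linarith
  next
    case False
    then obtain A where A: "A \<subseteq> ?W" "A \<noteq> {}" "A \<noteq> ?W" "closed_in ?R A" unfolding connected_on_def by blast
    have IH': "has_rooted_bounds V' Z' H'" if "card V' < card ?W" "triple_system V' H'" "Pfree H'" "rooted V' Z' H'"
      for V' Z' and H' :: "'a set set"
      by (rule IH[OF _ that(2-4)]) (use that(1) cW in linarith)
    have c: "card ?R \<le> root_bd (card V - 3)" "card ?R + card D \<le> apex_bd (card V - 3) + 1"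
      using rooted_split_bounds[OF tsW pfW rt A IH'] cW by (auto simp: numeral_3_eq_3 numeral_2_eq_2)
    \<comment> \<open>With two apexes the pair costs 4 and the plain edge bound is used. Otherwise
      the \<open>card D\<close> edges at the pair are exactly the roots in the bound on edges plus
      roots.\<close>
    then show ?thesis using cH root2_bd_step(2,3)[OF k4] by (auto split: if_splits)
  qed
qed

theorem rooted_bounds:
  assumes "triple_system V H" "Pfree H" "rooted V Z H"
  shows "has_rooted_bounds V Z H"
  using assms
proof (induction "card V" arbitrary: V Z H rule: less_induct)
  case less
  note ts = less.prems(1) and pf = less.prems(2) and r = less.prems(3)
  note fV = ts_finite[OF ts]
  show ?case
  proof (cases "V = {}")
    case True
    then have "H = {}" using tsD[OF ts] by fastforce
    moreover have "Z = {}" using r True unfolding rooted_def by auto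
    ultimately show ?thesis using True by (simp add: has_rooted_bounds_def root2_bd_table root_bd_0 apex_bd_0)
  next
    case V: False
    have cV: "1 \<le> card V" using V fV by (simp add: Suc_le_eq card_gt_0_iff)
    have ZV: "Z \<subseteq> V" "finite Z" using r fV finite_subset unfolding rooted_def by blast+
    obtain z where z: "z \<in> Z" using rooted_nonempty[OF r V ts] by blast
    have zt: "z \<in> V" "terminal z H" using z r unfolding rooted_def by auto
    show ?thesis
    proof (cases "connected_on V H")
      case True
      have star: "card H \<le> root_bd (card V)" if "\<forall>e\<in>H. z \<in> e"
        using card_star[OF ts zt(1) that] root_bd_ge[of "card V"] by linarith
      have nonstar: "card H \<le> root2_bd (card V)" if ns: "\<not> (\<forall>e\<in>H. z \<in> e)"
      proof -
        obtain g where "g \<in> H" "z \<notin> g" using ns by blast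
        then show ?thesis using nonstar_terminal_bound_step[OF ts pf True zt _ _ less.hyps] by blast
      qed
      have two: "card H \<le> root2_bd (card V)" if Z2: "2 \<le> card Z"
      proof (cases "\<forall>e\<in>H. z \<in> e")
        case True
        obtain z' where "z' \<in> Z" "z' \<noteq> z"
        proof (rule ccontr)
          assume "\<not> thesis"
          then have "Z \<subseteq> {z}" using that by blast
          then have "card Z \<le> card {z}" by (intro card_mono) auto
          then show False using Z2 by simp
        qed
        moreover from this have "z' \<in> V" "terminal z' H" using r unfolding rooted_def by auto
        ultimately show ?thesis using card_star_two_terminals[OF ts \<open>connected_on V H\<close> zt(1), of z'] True by metis
      qed (rule nonstar)
      have 1: "card H \<le> root_bd (card V)" using star nonstar root2_bd_le_root_bd[of "card V"] by linarith
      have "card H + card Z \<le> apex_bd (card V)"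
      proof (cases "2 \<le> card Z")
        case True
        then show ?thesis using two root2_bd_plus_le_apex_bd[of "card V"] card_mono[OF fV(1) ZV(1)] by linarith
      next
        case False
        then show ?thesis using 1 root_bd_less_apex_bd[OF cV] by linarith
      qed
      then show ?thesis using 1 two unfolding has_rooted_bounds_def by blast
    next
      case False
      then obtain A where A: "A \<subseteq> V" "A \<noteq> {}" "A \<noteq> V" "closed_in H A" unfolding connected_on_def by blast
      have c: "card H \<le> root_bd (card V - 1)" "card H + card Z \<le> apex_bd (card V - 1) + 1"
        using rooted_split_bounds[OF ts pf r A less.hyps] by auto
      have "Suc (card V - 1) = card V" using cV by simp
      \<comment> \<open>The vertex saved by the split makes up for the unit lost in
        \<open>rooted_split_bounds\<close>.\<close>
      then have "card H \<le> root_bd (card V)" "card H + card Z \<le> apex_bd (card V)"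
        using c root_bd_Suc_le[of "card V - 1"] apex_bd_Suc[of "card V - 1"] by (metis le_trans)+
      then show ?thesis using False unfolding has_rooted_bounds_def by blast
    qed
  qed
qed

corollary nonstar_terminal_bound:
  assumes "triple_system V H" "Pfree H" "connected_on V H" "z \<in> V" "terminal z H" "g \<in> H" "z \<notin> g"
  shows "card H \<le> root2_bd (card V)"
  using nonstar_terminal_bound_step[OF assms rooted_bounds] .

section \<open>Comets\<close>

text \<open>S holds the three vertices of the K4 other than the centre. Writing the comet as a
  filter on triples lets \<open>image_triples_filter\<close> carry it along bijections.\<close>

definition comet_on :: "'a \<Rightarrow> 'a set \<Rightarrow> 'a set \<Rightarrow> 'a set set" where
  "comet_on c S V = {e. e \<subseteq> V \<and> card e = 3 \<and> (e \<subseteq> insert c S \<or> c \<in> e \<and> e \<inter> S = {})}"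

lemma comet_on_ts: "finite V \<Longrightarrow> triple_system V (comet_on c S V)"
  unfolding triple_system_def comet_on_def by auto

lemma card_comet_on:
  assumes "finite V" "c \<in> V" "S \<subseteq> V" "card S = 3" "c \<notin> S"
  shows "card (comet_on c S V) = 4 + (card V - 4 choose 2)"
proof -
  let ?K = "insert c S"
  have fS: "finite S" using assms(1,3) finite_subset by blast
  have fK: "finite ?K" "card ?K = 4" "?K \<subseteq> V" using fS assms by auto
  let ?X = "{e. e \<subseteq> ?K \<and> card e = 3}" and ?Y = "{p. p \<subseteq> V - ?K \<and> card p = 2}"
  have cX: "card ?X = 4" using n_subsets[OF fK(1), of 3] fK(2) by (simp add: numeral_eq_Suc)
  have "card (V - ?K) = card V - 4" using fK assms(1) by (simp add: card_Diff_subset)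
  then have cY: "card ?Y = (card V - 4 choose 2)" using n_subsets[of "V - ?K" 2] assms(1) by simp
  have inj: "inj_on (insert c) ?Y"
  proof (rule inj_onI)
    fix p q assume "p \<in> ?Y" "q \<in> ?Y" "insert c p = insert c q"
    moreover from this have "c \<notin> p" "c \<notin> q" by auto
    ultimately show "p = q" by (metis Diff_insert_absorb)
  qed
  have eq: "comet_on c S V = ?X \<union> insert c ` ?Y"
  proof (intro equalityI subsetI)
    fix e assume "e \<in> comet_on c S V"
    then have e: "e \<subseteq> V" "card e = 3" "e \<subseteq> ?K \<or> c \<in> e \<and> e \<inter> S = {}" unfolding comet_on_def by auto
    show "e \<in> ?X \<union> insert c ` ?Y"
    proof (cases "e \<subseteq> ?K")
      case False
      then have ce: "c \<in> e" "e \<inter> S = {}" using e by auto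
      then have "e - {c} \<subseteq> V - ?K" "card (e - {c}) = 2" "e = insert c (e - {c})"
        using e by (auto simp: card_Diff_singleton)
      then show ?thesis by blast
    qed (use e in blast)
  next
    fix e assume "e \<in> ?X \<union> insert c ` ?Y"
    then show "e \<in> comet_on c S V"
    proof
      assume "e \<in> ?X" then show ?thesis using fK(3) unfolding comet_on_def by blast
    next
      assume "e \<in> insert c ` ?Y"
      then obtain p where p: "p \<subseteq> V - ?K" "card p = 2" "e = insert c p" by blast
      have "finite p" using p(1) assms(1) finite_subset by blast
      moreover have "c \<notin> p" using p(1) by blast
      ultimately have "card e = 3" using p by simp
      moreover have "e \<inter> S = {}" using p assms(5) by blast
      moreover have "e \<subseteq> V" using p assms(2) by blast
      ultimately show ?thesis using p unfolding comet_on_def by blast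
    qed
  qed
  have "?X \<inter> insert c ` ?Y = {}"
  proof -
    have "False" if "insert c p \<subseteq> ?K" "p \<subseteq> V - ?K" "card p = 2" for p
    proof -
      have "p = {}" using that by blast
      then show False using that by simp
    qed
    then show ?thesis by blast
  qed
  moreover have "finite ?X" "finite (insert c ` ?Y)" using fK assms(1) by auto
  ultimately have "card (comet_on c S V) = card ?X + card (insert c ` ?Y)"
    unfolding eq by (rule card_Un_disjoint[rotated 2])
  then show ?thesis using card_image[OF inj] cX cY by simp
qed

text \<open>The left side bounds the total when the remainder is connected; by strictness, a system
  of comet size leaves a disconnected one.\<close>

lemma root2_bd_conn_strict:
  assumes "13 \<le> k"
  shows "(k - 2) + root2_bd (k - 2) < 4 + (k - 4 choose 2)"
proof (cases "k \<le> 14")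
  case True
  then consider "k = 13" | "k = 14" using assms by linarith
  then show ?thesis by cases (simp_all add: root2_bd_def choose_two)
next
  case False
  define j where "j = k - 6"
  have "k = Suc (Suc (Suc (Suc (Suc (Suc j)))))" "j \<ge> 9" using False j_def by auto
  then show ?thesis by (simp add: root2_bd_def choose_two_Suc)
qed

text \<open>Forces the large part of the remainder to be a star: a non-star would stay below the
  full star.\<close>

lemma root2_bd_less_choose:
  assumes "10 \<le> k"
  shows "root2_bd k < (k - 1 choose 2)"
proof (cases "k \<le> 12")
  case True
  then consider "k = 10" | "k = 11" | "k = 12" using assms by linarith
  then show ?thesis by cases (simp_all add: root2_bd_def choose_two)
next
  case False
  then obtain j where "k = Suc (Suc (Suc (Suc j)))" "9 \<le> j" by (rule large_form)
  then show ?thesis by (simp add: root2_bd_def choose_two_Suc)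
qed

text \<open>A part of size 1 would give equality, so in an extremal split one part is a single
  vertex. The 11 is 13 vertices minus the deleted pair.\<close>

lemma root_bd_superadd_strict:
  assumes "2 \<le> a" "2 \<le> b" "11 \<le> a + b"
  shows "root_bd a + root_bd b < (a + b - 2 choose 2)"
proof -
  have *: "root_bd a + root_bd b < (a + b - 2 choose 2)" if h: "2 \<le> a" "7 \<le> b" "11 \<le> a + b" "a = 4" for a b
  proof -
    define c where "c = b - 7"
    have "b = c + 7" using h c_def by simp
    moreover have "(9 + c choose 2) = 36 + (c choose 2) + 9 * c" using choose_two_add[of 9 c] choose_two[of 9] by simp
    moreover have "(6 + c choose 2) = 15 + (c choose 2) + 6 * c" using choose_two_add[of 6 c] choose_two[of 6] by simp
    ultimately show ?thesis using h(4) by (simp add: root_bd_def)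
  qed
  show ?thesis
  proof (cases "a = 4 \<or> b = 4")
    case True then show ?thesis using *[of a b] *[of b a] assms by (auto simp: add.commute)
  next
    case False
    have "(a - 1 choose 2) + (b - 1 choose 2) + (a - 1) * (b - 1) = (a - 1 + (b - 1) choose 2)" by (rule choose_two_add[symmetric])
    moreover have "a - 1 + (b - 1) = a + b - 2" using assms by simp
    moreover have "1 \<le> (a - 1) * (b - 1)" using mult_le_mono[of 1 "a - 1" 1 "b - 1"] assms by linarith
    ultimately have "(a - 1 choose 2) + (b - 1 choose 2) + (a - 1) * (b - 1) = (a + b - 2 choose 2)" "1 \<le> (a - 1) * (b - 1)"
      by simp_all
    then have "(a - 1 choose 2) + (b - 1 choose 2) < (a + b - 2 choose 2)" by linarith
    then show ?thesis using False unfolding root_bd_def by simp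
  qed
qed

text \<open>Comet size forces in turn a disconnected remainder, exactly two apexes, and a split of
  the remainder into one isolated apex \<open>d2\<close> and a star at the other apex c. Then
  {x,y,d2} serves as S.\<close>

theorem terminal_extremal:
  assumes ts: "triple_system V H" and pf: "Pfree H" and con: "connected_on V H"
    and z: "z \<in> V" "terminal z H" and g0: "g0 \<in> H" "z \<notin> g0"
    and V13: "13 \<le> card V" and big: "4 + (card V - 4 choose 2) \<le> card H"
  shows "\<exists>c S. c \<in> V \<and> S \<subseteq> V \<and> card S = 3 \<and> c \<notin> S \<and> H = comet_on c S V"
proof -
  note fV = ts_finite[OF ts]
  obtain x y D where D: "x \<in> V" "y \<in> V" "x \<noteq> y" "D \<subseteq> V - {x,y}" "z \<in> D" "2 \<le> card D"
    and rt: "rooted (V - {x,y}) D {e \<in> H. e \<inter> {x,y} = {}}"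
    and cH: "card H \<le> (if card D = 2 then 4 else card D) + card {e \<in> H. e \<inter> {x,y} = {}}"
    and meet: "\<forall>e\<in>H. e \<inter> {x,y} \<noteq> {} \<longrightarrow> e \<subseteq> {x,y} \<union> D"
    by (rule pendant_pair[OF ts pf con z g0])
  define W where "W = V - {x,y}"
  define R where "R = {e \<in> H. e \<inter> {x,y} = {}}"
  note rt = rt[folded W_def R_def] and cH = cH[folded R_def]
  have fW: "finite W" using fV W_def by simp
  have cW: "card W = card V - 2" using D fV unfolding W_def by (simp add: card_Diff_subset)
  have DW: "D \<subseteq> W" using D W_def by simp
  have cD: "card D \<le> card V - 2" using card_mono[OF fW DW] cW by simp
  have tsW: "triple_system W R" using ts unfolding triple_system_def R_def W_def by auto
  have pfW: "Pfree R" by (rule Pfree_subset[OF pf]) (auto simp: R_def)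
  have bW: "has_rooted_bounds W D R" by (rule rooted_bounds[OF tsW pfW rt])
  have "\<not> connected_on W R"
  proof
    assume "connected_on W R"
    then have "card R \<le> root2_bd (card V - 2)" using bW D(6) cW unfolding has_rooted_bounds_def by metis
    moreover have "(if card D = 2 then 4 else card D) \<le> card V - 2" using cD V13 by auto
    ultimately show False using cH big root2_bd_conn_strict[OF V13] by linarith
  qed
  then obtain A where A: "A \<subseteq> W" "A \<noteq> {}" "A \<noteq> W" "closed_in R A" unfolding connected_on_def by blast
  have sp: "card R + card D \<le> apex_bd (card W - 1) + 1"
    by (rule rooted_split_bounds(2)[OF tsW pfW rt A rooted_bounds])
  have "\<not> card V - 3 \<le> 7" "card V - 3 - 1 = card V - 4" using V13 by auto
  then have "apex_bd (card W - 1) = (card V - 4 choose 2) + 1" unfolding cW apex_bd_def by (simp add: numeral_eq_Suc)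
  \<comment> \<open>More than two apexes would leave at most C(card V - 4, 2) + 2 edges, two short
    of comet size.\<close>
  then have D2: "card D = 2" using sp cH big by (auto split: if_splits)
  then have R: "(card V - 4 choose 2) \<le> card R" using cH big by simp
  \<comment> \<open>Either side of the split can be the single vertex, so the argument is given for
    any closed A' with a one-point complement.\<close>
  have key: ?thesis if A': "A' \<subseteq> W" "A' \<noteq> {}" "closed_in R A'" "card (W - A') = 1" for A'
  proof -
    obtain d2 where d2: "W - A' = {d2}" using A'(4) card_1_singletonE by blast
    have cl: "closed_in R {d2}" using closed_compl[OF tsW A'(3)] d2 by simp
    have "{d2} \<inter> D \<noteq> {}" using rt cl d2 unfolding rooted_def by blast
    then have d2D: "d2 \<in> D" by simp
    obtain c where c: "c \<in> D" "c \<in> A'" using rt A' unfolding rooted_def by blast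
    have cd: "c \<noteq> d2" using c d2 by blast
    have "{c,d2} \<subseteq> D" "finite D" using c d2D DW fW finite_subset by auto
    then have Dcd: "D = {c,d2}" using D2 cd by (metis card_2_iff card_subset_eq)
    have nd2: "d2 \<notin> e" if "e \<in> R" for e
    proof
      assume "d2 \<in> e"
      then have "e \<subseteq> {d2}" using cl that unfolding closed_in_def by blast
      then have "card e \<le> card {d2}" by (intro card_mono) auto
      then show False using tsD(2)[OF tsW that] by simp
    qed
    have Rsub: "e \<subseteq> A'" if "e \<in> R" for e
    proof -
      have "e - A' \<subseteq> {d2}" using tsD(1)[OF tsW that] d2 by (metis Diff_mono order_refl)
      then show ?thesis using nd2[OF that] by blast
    qed
    have tsA: "triple_system A' R" using tsW Rsub A'(1) finite_subset unfolding triple_system_def by blast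
    have "{e \<in> R. e \<subseteq> A'} = R" using Rsub by blast
    moreover have "D \<inter> A' = {c}" using Dcd c d2 by blast
    ultimately have rA: "rooted A' {c} R" using rooted_restrict[OF rt A'(3) A'(1)] by simp
    have conA: "connected_on A' R" by (rule rooted_single_connected[OF tsA rA])
    have ct: "terminal c R" using rA unfolding rooted_def by blast
    have cA: "card A' = card V - 3" using card_parts[OF fW A'(1)] A'(4) cW by simp
    \<comment> \<open>A' is connected with the single root c. An edge missing c would bring it under
      \<open>root2_bd\<close>, too little for the edges it has to hold.\<close>
    have st: "c \<in> e" if "e \<in> R" for e
    proof (rule ccontr)
      assume "c \<notin> e"
      then have "card R \<le> root2_bd (card A')"
        by (rule nonstar_terminal_bound[OF tsA pfW conA c(2) ct that])
      also have "\<dots> < (card A' - 1 choose 2)" by (rule root2_bd_less_choose) (use cA V13 in simp)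
      finally show False using R cA by (simp add: numeral_eq_Suc)
    qed
    let ?S = "{x,y,d2}"
    have S: "c \<in> V" "?S \<subseteq> V" "card ?S = 3" "c \<notin> ?S"
      using D c d2D Dcd cd by (auto simp: card_insert_if)
    have sub: "H \<subseteq> comet_on c ?S V"
    proof
      fix e assume e: "e \<in> H"
      show "e \<in> comet_on c ?S V"
      proof (cases "e \<inter> {x,y} = {}")
        case True
        then have "e \<in> R" using e R_def by simp
        then have "c \<in> e \<and> e \<inter> ?S = {}" using st nd2 True by blast
        then show ?thesis using tsD[OF ts e] unfolding comet_on_def by blast
      next
        case False
        then have "e \<subseteq> insert c ?S" using meet e False Dcd by blast
        then show ?thesis using tsD[OF ts e] unfolding comet_on_def by blast
      qed
    qed
    have "H = comet_on c ?S V"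
    proof (rule card_seteq[OF _ sub])
      show "finite (comet_on c ?S V)" by (rule ts_finite(2)[OF comet_on_ts[OF fV(1)]])
      show "card (comet_on c ?S V) \<le> card H" using card_comet_on[OF fV(1) S] big by simp
    qed
    then show ?thesis using S by blast
  qed
  have cB: "closed_in R (W - A)" by (rule closed_compl[OF tsW A(4)])
  have fA: "finite A" "finite (W - A)" using fW A finite_subset by auto
  have ne: "1 \<le> card A" "1 \<le> card (W - A)" using A fA by (auto simp: Suc_le_eq card_gt_0_iff)
  note cAW = card_parts[OF fW A(1)]
  have BW: "W - A \<subseteq> W" by simp
  have RA: "card {e \<in> R. e \<subseteq> A} \<le> root_bd (card A)"
    using rooted_bounds[OF ts_restrict[OF tsW A(1)] Pfree_subset[OF pfW] rooted_restrict[OF rt A(4) A(1)]]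
    unfolding has_rooted_bounds_def by blast
  have RB: "card {e \<in> R. e \<subseteq> W - A} \<le> root_bd (card (W - A))"
    using rooted_bounds[OF ts_restrict[OF tsW BW] Pfree_subset[OF pfW] rooted_restrict[OF rt cB BW]]
    unfolding has_rooted_bounds_def by blast
  have "card A = 1 \<or> card (W - A) = 1"
  proof (rule ccontr)
    assume "\<not> ?thesis"
    then have "2 \<le> card A" "2 \<le> card (W - A)" using ne by auto
    then have "root_bd (card A) + root_bd (card (W - A)) < (card A + card (W - A) - 2 choose 2)"
      by (rule root_bd_superadd_strict) (use cAW cW V13 in linarith)
    moreover have "card A + card (W - A) - 2 = card V - 4" using cAW cW by simp
    ultimately show False using RA RB R card_split[OF tsW A(4)] by simp
  qed
  then show ?thesis
  proof
    assume "card A = 1"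
    moreover have "W - (W - A) = A" using A by blast
    moreover have "W - A \<noteq> {}" using A by blast
    ultimately show ?thesis using key[OF BW _ cB] by simp
  next
    assume "card (W - A) = 1" then show ?thesis using key[OF A(1,2,4)] by simp
  qed
qed

section \<open>Systems containing a loose triangle\<close>

lemma card2_subset_insert: "p \<subseteq> insert a A \<Longrightarrow> card p = 2 \<Longrightarrow> p \<subseteq> A \<or> (\<exists>q\<in>A. p = {a,q})"
proof (cases "a \<in> p")
  case True
  assume p: "p \<subseteq> insert a A" "card p = 2"
  then have "card (p - {a}) = 1" using True by (simp add: card_Diff_singleton)
  then obtain q where q: "p - {a} = {q}" using card_1_singletonE by blast
  then have "p = {a,q}" "q \<in> A" using True p(1) by blast+
  then show ?thesis by blast
qed blast

lemma card3_subset_insert: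
  "e \<subseteq> insert a A \<Longrightarrow> card e = 3 \<Longrightarrow> e \<subseteq> A \<or> (\<exists>p. p \<subseteq> A \<and> card p = 2 \<and> e = insert a p)"
proof (cases "a \<in> e")
  case True
  assume e: "e \<subseteq> insert a A" "card e = 3"
  then have "card (e - {a}) = 2" "e - {a} \<subseteq> A" "e = insert a (e - {a})" using True by (auto simp: card_Diff_singleton)
  then show ?thesis by blast
qed blast

lemma card3_subset_small: "e \<subseteq> {a,b} \<Longrightarrow> card e \<noteq> 3"
  using card_mono[of "{a,b}" e] card_insert_le_m1[of 2 "{b}" a] by (auto simp: card_insert_if split: if_splits)

lemma card2_subset_small: "p \<subseteq> {a} \<Longrightarrow> card p \<noteq> 2"
  using card_mono[of "{a}" p] by auto

text \<open>Peeling off one vertex at a time reduces the triples to pairs. The explicit list permits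
  counting by a sum of indicators.\<close>

lemma six_triples:
  assumes "e \<subseteq> {a,b,c,d,f,g}" "card e = 3"
  shows "e \<in> {{a,b,c},{a,b,d},{a,b,f},{a,b,g},{a,c,d},{a,c,f},{a,c,g},{a,d,f},{a,d,g},{a,f,g},{b,c,d},{b,c,f},{b,c,g},{b,d,f},{b,d,g},{b,f,g},{c,d,f},{c,d,g},{c,f,g},{d,f,g}}"
proof -
  have two: "p \<in> {{b,c},{b,d},{b,f},{b,g},{c,d},{c,f},{c,g},{d,f},{d,g},{f,g}}" if pc: "p \<subseteq> {b,c,d,f,g}" "card p = 2" for p
  proof -
    obtain r s where rs: "p = {r,s}" "r \<noteq> s" using pc(2) by (auto simp: card_2_iff)
    have "r \<in> {b,c,d,f,g}" "s \<in> {b,c,d,f,g}" using pc(1) rs by auto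
    then show ?thesis using rs by (elim insertE emptyE) (simp_all add: insert_commute)
  qed
  from card3_subset_insert[OF assms(1,2)] consider "e \<subseteq> {b,c,d,f,g}" | p where "p \<subseteq> {b,c,d,f,g}" "card p = 2" "e = insert a p" by blast
  then show ?thesis
  proof cases
    case 2
    from two[OF 2(1,2)] show ?thesis unfolding 2(3) by (elim insertE emptyE) simp_all
  next
    case 1
    have two': "p \<in> {{c,d},{c,f},{c,g},{d,f},{d,g},{f,g}}" if pc: "p \<subseteq> {c,d,f,g}" "card p = 2" for p
    proof -
      obtain r s where rs: "p = {r,s}" "r \<noteq> s" using pc(2) by (auto simp: card_2_iff)
      have "r \<in> {c,d,f,g}" "s \<in> {c,d,f,g}" using pc(1) rs by auto
      then show ?thesis using rs by (elim insertE emptyE) (simp_all add: insert_commute)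
    qed
    from card3_subset_insert[OF 1 assms(2)] consider "e \<subseteq> {c,d,f,g}" | p where "p \<subseteq> {c,d,f,g}" "card p = 2" "e = insert b p" by blast
    then show ?thesis
    proof cases
      case 2
      from two'[OF 2(1,2)] show ?thesis unfolding 2(3) by (elim insertE emptyE) simp_all
    next
      case 1
      have two'': "p \<in> {{d,f},{d,g},{f,g}}" if pc: "p \<subseteq> {d,f,g}" "card p = 2" for p
      proof -
        obtain r s where rs: "p = {r,s}" "r \<noteq> s" using pc(2) by (auto simp: card_2_iff)
        have "r \<in> {d,f,g}" "s \<in> {d,f,g}" using pc(1) rs by auto
        then show ?thesis using rs by (elim insertE emptyE) (simp_all add: insert_commute)
      qed
      from card3_subset_insert[OF 1 assms(2)] consider "e \<subseteq> {d,f,g}" | p where "p \<subseteq> {d,f,g}" "card p = 2" "e = insert c p" by blast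
      then show ?thesis
      proof cases
        case 2
        from two''[OF 2(1,2)] show ?thesis unfolding 2(3) by (elim insertE emptyE) simp_all
      next
        case 1
        from card3_subset_insert[OF 1 assms(2)] card3_subset_small[of e f g] assms(2)
        obtain p where p: "p \<subseteq> {f,g}" "card p = 2" "e = insert d p" by blast
        have "p = {f,g}" using card2_subset_insert[of p f "{g}"] card2_subset_small[of p g] p by auto
        then show ?thesis using p by simp
      qed
    qed
  qed
qed

text \<open>Repetitions in L only raise the right-hand side, so lists can be written down without
  comparing their entries.\<close>

lemma card_le_sum_list: "card {e \<in> H. e \<in> set L} \<le> (\<Sum>t\<leftarrow>L. if t \<in> H then 1 else 0)"
proof (induction L)
  case (Cons a L)
  have "{e \<in> H. e \<in> set (a # L)} \<subseteq> (if a \<in> H then {a} else {}) \<union> {e \<in> H. e \<in> set L}" by auto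
  then have "card {e \<in> H. e \<in> set (a # L)} \<le> card ((if a \<in> H then {a} else {}) \<union> {e \<in> H. e \<in> set L})"
    by (intro card_mono) auto
  also have "\<dots> \<le> card (if a \<in> H then {a} else {}) + card {e \<in> H. e \<in> set L}" by (rule card_Un_le)
  finally show ?case using Cons by auto
qed simp

text \<open>The corners are x1, x2, x3, and each y lies on the edge opposite the corner with the
  same index. With this labelling the symmetries permute indices (\<open>rot\<close>,
  \<open>swap\<close>).\<close>

locale loose_triangle =
  fixes V :: "'a set" and H x1 x2 x3 y1 y2 y3
  assumes ts: "triple_system V H" and pf: "Pfree H"
    and dist: "distinct [x1,x2,x3,y1,y2,y3]"
    and edges: "{x1,y3,x2} \<in> H" "{x2,y1,x3} \<in> H" "{x1,y2,x3} \<in> H"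
begin

definition Y :: "'a set" where "Y = {x1,x2,x3,y1,y2,y3}"

text \<open>Every vertex of the triangle is the end of a two-edge loose path inside it, which
  {s,u,v} would prolong to P.\<close>

lemma no_one_vertex:
  assumes "s \<in> Y" "u \<notin> Y" "v \<notin> Y" "u \<noteq> v"
  shows "{s,u,v} \<notin> H"
proof
  assume a: "{s,u,v} \<in> H"
  have n: "distinct [u,v,x1,x2,x3,y1,y2,y3]" "distinct [y3,y2,y1,x3,x2,x1,v,u]" using assms(2-4) dist unfolding Y_def by auto
  consider "s = x1" | "s = x2" | "s = x3" | "s = y1" | "s = y2" | "s = y3" using assms(1) unfolding Y_def by auto
  then show False
  proof cases
    case 1 show ?thesis using PfreeD[OF pf, of x3 y1 x2 y3 x1 u v] a n edges unfolding 1 by (simp add: insert_commute)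
  next
    case 2 show ?thesis using PfreeD[OF pf, of x3 y2 x1 y3 x2 u v] a n edges unfolding 2 by (simp add: insert_commute)
  next
    case 3 show ?thesis using PfreeD[OF pf, of x1 y3 x2 y1 x3 u v] a n edges unfolding 3 by (simp add: insert_commute)
  next
    case 4 show ?thesis using PfreeD[OF pf, of x1 y3 x2 x3 y1 u v] a n edges unfolding 4 by (simp add: insert_commute)
  next
    case 5 show ?thesis using PfreeD[OF pf, of x2 y3 x1 x3 y2 u v] a n edges unfolding 5 by (simp add: insert_commute)
  next
    case 6 show ?thesis using PfreeD[OF pf, of x3 y1 x2 x1 y3 u v] a n edges unfolding 6 by (simp add: insert_commute)
  qed
qed

text \<open>A pair is excluded if a two-edge path of the triangle ends in one of its vertices and
  avoids the other. This fails only for two corners and for a corner with its opposite y, which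
  leaves six of the fifteen pairs.\<close>

lemma no_pair:
  assumes "u \<notin> Y"
  shows "{u,x1,y2} \<notin> H" "{u,x1,y3} \<notin> H" "{u,x2,y1} \<notin> H" "{u,x2,y3} \<notin> H" "{u,x3,y1} \<notin> H" "{u,x3,y2} \<notin> H" "{u,y1,y2} \<notin> H" "{u,y1,y3} \<notin> H" "{u,y2,y3} \<notin> H"
proof -
  have n: "distinct [u,x1,x2,x3,y1,y2,y3]" "distinct [y3,y2,y1,x3,x2,x1,u]" using assms dist unfolding Y_def by auto
  show "{u,x1,y2} \<notin> H"
    "{u,x1,y3} \<notin> H"
    "{u,x2,y1} \<notin> H"
    "{u,x2,y3} \<notin> H"
    "{u,x3,y1} \<notin> H"
    "{u,x3,y2} \<notin> H"
    "{u,y1,y2} \<notin> H"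
    "{u,y1,y3} \<notin> H"
    "{u,y2,y3} \<notin> H"
    using n edges
      PfreeD[OF pf, of x3 y1 x2 y3 x1 u y2]
      PfreeD[OF pf, of x2 y1 x3 y2 x1 u y3]
      PfreeD[OF pf, of x3 y2 x1 y3 x2 u y1]
      PfreeD[OF pf, of x1 y2 x3 y1 x2 u y3]
      PfreeD[OF pf, of x2 y3 x1 y2 x3 u y1]
      PfreeD[OF pf, of x1 y3 x2 y1 x3 u y2]
      PfreeD[OF pf, of x1 y3 x2 x3 y1 u y2]
      PfreeD[OF pf, of x3 y2 x1 x2 y3 u y1]
      PfreeD[OF pf, of x3 y1 x2 x1 y3 u y2]
    by (auto simp: insert_commute)
qed

lemma pair_cases:
  assumes "{s,t,u} \<in> H" "s \<in> Y" "t \<in> Y" "s \<noteq> t" "u \<notin> Y"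
  shows "{s,t,u} \<in> {{u,x1,x2},{u,x1,x3},{u,x2,x3},{u,x1,y1},{u,x2,y2},{u,x3,y3}}"
proof -
  define e where "e = {u,s,t}"
  have "s \<in> {x1,x2,x3,y1,y2,y3}" "t \<in> {x1,x2,x3,y1,y2,y3}" using assms(2,3) unfolding Y_def by auto
  then have "e \<in> {{u,x1,x2},{u,x1,x3},{u,x1,y1},{u,x1,y2},{u,x1,y3},{u,x2,x3},{u,x2,y1},{u,x2,y2},{u,x2,y3},{u,x3,y1},{u,x3,y2},{u,x3,y3},{u,y1,y2},{u,y1,y3},{u,y2,y3}}"
    using assms(4) unfolding e_def by (elim insertE emptyE) (simp_all add: insert_commute)
  moreover have e: "e \<in> H" "{s,t,u} = e" using assms(1) unfolding e_def by (simp_all add: insert_commute)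
  ultimately have "e \<in> {{u,x1,x2},{u,x1,x3},{u,x2,x3},{u,x1,y1},{u,x2,y2},{u,x3,y3}}"
    using no_pair[OF assms(5)] by (elim insertE emptyE) simp_all
  then show ?thesis using e(2) by simp
qed

text \<open>For each surviving pair some triangle edge meets {s,t,u} in exactly one vertex; this
  edge, {s,t,u} and {u,v,w} would form P.\<close>

lemma no_far_edge:
  assumes "{s,t,u} \<in> H" "s \<in> Y" "t \<in> Y" "s \<noteq> t" "u \<notin> Y" "v \<notin> Y" "w \<notin> Y" "distinct [u,v,w]"
  shows "{u,v,w} \<notin> H"
proof
  assume a: "{u,v,w} \<in> H"
  have n: "distinct [u,v,w,x1,x2,x3,y1,y2,y3]" "distinct [y3,y2,y1,x3,x2,x1,w,v,u]" using assms(5-8) dist unfolding Y_def by auto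
  obtain e where e: "e = {s,t,u}" by simp
  have eH: "e \<in> H" using assms(1) e by simp
  have "e \<in> {{u,x1,x2},{u,x1,x3},{u,x2,x3},{u,x1,y1},{u,x2,y2},{u,x3,y3}}" using pair_cases[OF assms(1-5)] e by simp
  then show False
  proof (elim insertE emptyE)
    assume "e = {u,x1,x2}" then show False using PfreeD[OF pf, of x3 y1 x2 x1 u v w] a n edges eH by (simp add: insert_commute)
  next
    assume "e = {u,x1,x3}" then show False using PfreeD[OF pf, of x2 y3 x1 x3 u v w] a n edges eH by (simp add: insert_commute)
  next
    assume "e = {u,x2,x3}" then show False using PfreeD[OF pf, of x1 y3 x2 x3 u v w] a n edges eH by (simp add: insert_commute)
  next
    assume "e = {u,x1,y1}" then show False using PfreeD[OF pf, of x2 y3 x1 y1 u v w] a n edges eH by (simp add: insert_commute)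
  next
    assume "e = {u,x2,y2}" then show False using PfreeD[OF pf, of x1 y3 x2 y2 u v w] a n edges eH by (simp add: insert_commute)
  next
    assume "e = {u,x3,y3}" then show False using PfreeD[OF pf, of x1 x2 y3 x3 u v w] a n edges eH by (simp add: insert_commute)
  qed
qed

definition B :: "'a set \<Rightarrow> nat" where "B t = (if t \<in> H then 1 else 0)"

text \<open>The summands are grouped into complementary pairs: if \<open>u\<close> lies outside and an edge \<open>{u,p,q}\<close>
  has \<open>p\<close> and \<open>q\<close> on different sides of such a pair, then not both members of the pair are edges.\<close>

lemma inside_sum:
  "card {e \<in> H. e \<subseteq> Y} \<le> (B {x1,x2,x3} + B {y1,y2,y3})
    + (B {x1,x2,y1} + B {x3,y2,y3})
    + (B {x1,x2,y2} + B {x3,y1,y3})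
    + (B {x1,x2,y3} + B {x3,y1,y2})
    + (B {x1,x3,y1} + B {x2,y2,y3})
    + (B {x1,x3,y2} + B {x2,y1,y3})
    + (B {x1,x3,y3} + B {x2,y1,y2})
    + (B {x1,y1,y2} + B {x2,x3,y3})
    + (B {x1,y1,y3} + B {x2,x3,y2})
    + (B {x1,y2,y3} + B {x2,x3,y1})"
proof -
  let ?L = "[{x1,x2,x3},
     {x1,x2,y1},
     {x1,x2,y2},
     {x1,x2,y3},
     {x1,x3,y1},
     {x1,x3,y2},
     {x1,x3,y3},
     {x1,y1,y2},
     {x1,y1,y3},
     {x1,y2,y3},
     {x2,x3,y1},
     {x2,x3,y2},
     {x2,x3,y3},
     {x2,y1,y2},
     {x2,y1,y3},
     {x2,y2,y3},
     {x3,y1,y2},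
     {x3,y1,y3},
     {x3,y2,y3},
     {y1,y2,y3}]"
  have "e \<in> set ?L" if "e \<in> H" "e \<subseteq> Y" for e
    using six_triples[of e x1 x2 x3 y1 y2 y3] that(2)[unfolded Y_def] tsD(2)[OF ts that(1)] by simp
  then have "{e \<in> H. e \<subseteq> Y} \<subseteq> {e \<in> H. e \<in> set ?L}" by blast
  then have "card {e \<in> H. e \<subseteq> Y} \<le> card {e \<in> H. e \<in> set ?L}" by (intro card_mono) auto
  also have "\<dots> \<le> (\<Sum>t\<leftarrow>?L. B t)" unfolding B_def by (rule card_le_sum_list)
  also have "\<dots> = (B {x1,x2,x3} + B {y1,y2,y3})
    + (B {x1,x2,y1} + B {x3,y2,y3})
    + (B {x1,x2,y2} + B {x3,y1,y3})
    + (B {x1,x2,y3} + B {x3,y1,y2})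
    + (B {x1,x3,y1} + B {x2,y2,y3})
    + (B {x1,x3,y2} + B {x2,y1,y3})
    + (B {x1,x3,y3} + B {x2,y1,y2})
    + (B {x1,y1,y2} + B {x2,x3,y3})
    + (B {x1,y1,y3} + B {x2,x3,y2})
    + (B {x1,y2,y3} + B {x2,x3,y1})" by simp
  finally show ?thesis .
qed

lemma B_le: "B t \<le> 1" unfolding B_def by simp

lemma inside_xx:
  assumes "u \<notin> Y" "{u,x1,x2} \<in> H"
  shows "card {e \<in> H. e \<subseteq> Y} \<le> 11"
proof -
  have n: "distinct [u,x1,x2,x3,y1,y2,y3]" "distinct [y3,y2,y1,x3,x2,x1,u]" using assms(1) dist unfolding Y_def by auto
  note h = assms(2-)
  \<comment> \<open>In this and the next two sums x1 and x2 are on the same side. Instead {u,x1,x2},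
    continued by a triangle edge, rules out the second triple outright.\<close>
  have i0: "B {x1,x2,x3} + B {y1,y2,y3} \<le> 1" unfolding B_def
    using PfreeD[OF pf, of u x1 x2 x3 y1 y2 y3] n edges h by (auto simp: insert_commute)
  have i1: "B {x1,x2,y1} + B {x3,y2,y3} \<le> 1" unfolding B_def
    using PfreeD[OF pf, of u x1 x2 y1 x3 y2 y3] n edges h by (auto simp: insert_commute)
  have i2: "B {x1,x2,y2} + B {x3,y1,y3} \<le> 1" unfolding B_def
    using PfreeD[OF pf, of u x2 x1 y2 x3 y1 y3] n edges h by (auto simp: insert_commute)
  \<comment> \<open>The one pair counted in full; its first member is a triangle edge. The total is
    9 + 2 = 11.\<close>
  have i3: "B {x1,x2,y3} + B {x3,y1,y2} \<le> 2" using B_le[of "{x1,x2,y3}"] B_le[of "{x3,y1,y2}"] by linarith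
  have i4: "B {x1,x3,y1} + B {x2,y2,y3} \<le> 1" unfolding B_def
    using PfreeD[OF pf, of x3 y1 x1 u x2 y2 y3] n edges h by (auto simp: insert_commute)
  have i5: "B {x1,x3,y2} + B {x2,y1,y3} \<le> 1" unfolding B_def
    using PfreeD[OF pf, of x3 y2 x1 u x2 y1 y3] n edges h by (auto simp: insert_commute)
  have i6: "B {x1,x3,y3} + B {x2,y1,y2} \<le> 1" unfolding B_def
    using PfreeD[OF pf, of x3 y3 x1 u x2 y1 y2] n edges h by (auto simp: insert_commute)
  have i7: "B {x1,y1,y2} + B {x2,x3,y3} \<le> 1" unfolding B_def
    using PfreeD[OF pf, of y1 y2 x1 u x2 x3 y3] n edges h by (auto simp: insert_commute)
  have i8: "B {x1,y1,y3} + B {x2,x3,y2} \<le> 1" unfolding B_def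
    using PfreeD[OF pf, of y1 y3 x1 u x2 x3 y2] n edges h by (auto simp: insert_commute)
  have i9: "B {x1,y2,y3} + B {x2,x3,y1} \<le> 1" unfolding B_def
    using PfreeD[OF pf, of x3 y1 x2 u x1 y2 y3] n edges h by (auto simp: insert_commute)
  show ?thesis using inside_sum i0 i1 i2 i3 i4 i5 i6 i7 i8 i9 by linarith
qed

text \<open>Every pair now loses a member. Six pairs separate x1 from y1; in the other four a
  triangle edge leads from {u,x1,y1} to the triple containing neither.\<close>

lemma inside_xy:
  assumes "u \<notin> Y" "{u,x1,y1} \<in> H"
  shows "card {e \<in> H. e \<subseteq> Y} \<le> 10"
proof -
  have n: "distinct [u,x1,x2,x3,y1,y2,y3]" "distinct [y3,y2,y1,x3,x2,x1,u]" using assms(1) dist unfolding Y_def by auto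
  note h = assms(2-)
  have i0: "B {x1,x2,x3} + B {y1,y2,y3} \<le> 1" unfolding B_def
    using PfreeD[OF pf, of x2 x3 x1 u y1 y2 y3] n edges h by (auto simp: insert_commute)
  have i1: "B {x1,x2,y1} + B {x3,y2,y3} \<le> 1" unfolding B_def
    using PfreeD[OF pf, of u y1 x1 x2 y3 x3 y2] n edges h by (auto simp: insert_commute)
  have i2: "B {x1,x2,y2} + B {x3,y1,y3} \<le> 1" unfolding B_def
    using PfreeD[OF pf, of x2 y2 x1 u y1 x3 y3] n edges h by (auto simp: insert_commute)
  have i3: "B {x1,x2,y3} + B {x3,y1,y2} \<le> 1" unfolding B_def
    using PfreeD[OF pf, of x2 y3 x1 u y1 x3 y2] n edges h by (auto simp: insert_commute)
  have i4: "B {x1,x3,y1} + B {x2,y2,y3} \<le> 1" unfolding B_def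
    using PfreeD[OF pf, of u x1 y1 x3 x2 y2 y3] n edges h by (auto simp: insert_commute)
  have i5: "B {x1,x3,y2} + B {x2,y1,y3} \<le> 1" unfolding B_def
    using PfreeD[OF pf, of x3 y2 x1 u y1 x2 y3] n edges h by (auto simp: insert_commute)
  have i6: "B {x1,x3,y3} + B {x2,y1,y2} \<le> 1" unfolding B_def
    using PfreeD[OF pf, of x3 y3 x1 u y1 x2 y2] n edges h by (auto simp: insert_commute)
  have i7: "B {x1,y1,y2} + B {x2,x3,y3} \<le> 1" unfolding B_def
    using PfreeD[OF pf, of u y1 x1 y2 x3 x2 y3] n edges h by (auto simp: insert_commute)
  have i8: "B {x1,y1,y3} + B {x2,x3,y2} \<le> 1" unfolding B_def
    using PfreeD[OF pf, of u y1 x1 y3 x2 x3 y2] n edges h by (auto simp: insert_commute)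
  have i9: "B {x1,y2,y3} + B {x2,x3,y1} \<le> 1" unfolding B_def
    using PfreeD[OF pf, of x2 x3 y1 u x1 y2 y3] n edges h by (auto simp: insert_commute)
  show ?thesis using inside_sum i0 i1 i2 i3 i4 i5 i6 i7 i8 i9 by linarith
qed

text \<open>With three edges at u, three of the ten pairs lose both members. This serves the
  seven-vertex case, where u may have five or six edges.\<close>

lemma inside_kill:
  assumes "u \<notin> Y" "{u,x1,x2} \<in> H" "{u,x3,y3} \<in> H" "{u,x1,y1} \<in> H"
  shows "card {e \<in> H. e \<subseteq> Y} \<le> 7"
proof -
  have n: "distinct [u,x1,x2,x3,y1,y2,y3]" "distinct [y3,y2,y1,x3,x2,x1,u]" using assms(1) dist unfolding Y_def by auto
  note h = assms(2-)
  have i0: "B {x1,x2,x3} + B {y1,y2,y3} \<le> 1" unfolding B_def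
    using PfreeD[OF pf, of u x1 x2 x3 y1 y2 y3] n edges h by (auto simp: insert_commute)
  have i1: "B {x1,x2,y1} + B {x3,y2,y3} \<le> 0" unfolding B_def
    using PfreeD[OF pf, of u y3 x3 y2 x1 x2 y1]
      PfreeD[OF pf, of u y1 x1 x2 y3 x3 y2] n edges h by (auto simp: insert_commute)
  have i2: "B {x1,x2,y2} + B {x3,y1,y3} \<le> 0" unfolding B_def
    using PfreeD[OF pf, of u y3 x3 y1 x2 x1 y2]
      PfreeD[OF pf, of u x2 x1 y2 x3 y1 y3] n edges h by (auto simp: insert_commute)
  have i3: "B {x1,x2,y3} + B {x3,y1,y2} \<le> 1" unfolding B_def
    using PfreeD[OF pf, of x1 x2 y3 u x3 y1 y2] n edges h by (auto simp: insert_commute)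
  have i4: "B {x1,x3,y1} + B {x2,y2,y3} \<le> 1" unfolding B_def
    using PfreeD[OF pf, of u x1 y1 x3 x2 y2 y3] n edges h by (auto simp: insert_commute)
  have i5: "B {x1,x3,y2} + B {x2,y1,y3} \<le> 1" unfolding B_def
    using PfreeD[OF pf, of x3 y2 x1 u x2 y1 y3] n edges h by (auto simp: insert_commute)
  have i6: "B {x1,x3,y3} + B {x2,y1,y2} \<le> 1" unfolding B_def
    using PfreeD[OF pf, of u x3 y3 x1 x2 y1 y2] n edges h by (auto simp: insert_commute)
  have i7: "B {x1,y1,y2} + B {x2,x3,y3} \<le> 0" unfolding B_def
    using PfreeD[OF pf, of u x3 y3 x2 x1 y1 y2]
      PfreeD[OF pf, of u y1 x1 y2 x3 x2 y3] n edges h by (auto simp: insert_commute)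
  have i8: "B {x1,y1,y3} + B {x2,x3,y2} \<le> 1" unfolding B_def
    using PfreeD[OF pf, of u y1 x1 y3 x2 x3 y2] n edges h by (auto simp: insert_commute)
  have i9: "B {x1,y2,y3} + B {x2,x3,y1} \<le> 1" unfolding B_def
    using PfreeD[OF pf, of x3 y1 x2 u x1 y2 y3] n edges h by (auto simp: insert_commute)
  show ?thesis using inside_sum i0 i1 i2 i3 i4 i5 i6 i7 i8 i9 by linarith
qed

text \<open>{u,x1,y1} and the triangle edge {x1,y3,x2} form a two-edge path that can be read as
  ending in x2 or in y3, where each of the edges at v would complete P.\<close>

lemma other_vertex:
  assumes "u \<notin> Y" "v \<notin> Y" "u \<noteq> v" "{u,x1,y1} \<in> H"
  shows "{v,x2,x3} \<notin> H" "{v,x2,y2} \<notin> H" "{v,x3,y3} \<notin> H"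
proof -
  have n: "distinct [u,v,x1,x2,x3,y1,y2,y3]" "distinct [y3,y2,y1,x3,x2,x1,v,u]" using assms(1-3) dist unfolding Y_def by auto
  show "{v,x2,x3} \<notin> H" "{v,x2,y2} \<notin> H" "{v,x3,y3} \<notin> H"
    using n edges assms(4)
      PfreeD[OF pf, of u y1 x1 y3 x2 v x3]
      PfreeD[OF pf, of u y1 x1 y3 x2 v y2]
      PfreeD[OF pf, of u y1 x1 x2 y3 v x3]
    by (auto simp: insert_commute)
qed

end

section \<open>Connected systems around a core vertex set\<close>

lemma card3_trichotomy:
  assumes "card e = 3"
  shows "e \<inter> Y = {} \<or> (\<exists>s u v. e = {s,u,v} \<and> s \<in> Y \<and> u \<notin> Y \<and> v \<notin> Y \<and> u \<noteq> v) \<or>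
    (\<exists>s t u. e = {s,t,u} \<and> s \<in> Y \<and> t \<in> Y \<and> s \<noteq> t \<and> u \<notin> Y) \<or> e \<subseteq> Y"
proof (cases "e \<inter> Y = {}")
  case False
  then obtain s where s: "s \<in> e" "s \<in> Y" by blast
  obtain a b where ab: "e = {s,a,b}" "s \<noteq> a" "s \<noteq> b" "a \<noteq> b" using card3_elem[OF assms s(1)] by metis
  consider "a \<in> Y" "b \<in> Y" | "a \<in> Y" "b \<notin> Y" | "a \<notin> Y" "b \<in> Y" | "a \<notin> Y" "b \<notin> Y" by blast
  then show ?thesis
  proof cases
    case 1 then show ?thesis using ab s by simp
  next
    case 2 then show ?thesis using ab s by metis
  next
    case 3
    have "e = {s,b,a}" using ab(1) by (simp add: insert_commute)
    then show ?thesis using ab s 3 by metis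
  next
    case 4 then show ?thesis using ab s by metis
  qed
qed simp

text \<open>The conditions \<open>one\<close> and \<open>far\<close> make the core together with its
  attached vertices a closed set, hence everything; an edge avoiding the core would then start at an
  attached vertex.\<close>

lemma connected_span:
  assumes ts: "triple_system V H" and con: "connected_on V H" and Y: "Y \<subseteq> V" "Y \<noteq> {}"
    and one: "\<And>s u v. s \<in> Y \<Longrightarrow> u \<notin> Y \<Longrightarrow> v \<notin> Y \<Longrightarrow> u \<noteq> v \<Longrightarrow> {s,u,v} \<notin> H"
    and far: "\<And>s t u v w. {s,t,u} \<in> H \<Longrightarrow> s \<in> Y \<Longrightarrow> t \<in> Y \<Longrightarrow> s \<noteq> t \<Longrightarrow> u \<notin> Y \<Longrightarrow> v \<notin> Y \<Longrightarrow> w \<notin> Y \<Longrightarrow>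
      distinct [u,v,w] \<Longrightarrow> {u,v,w} \<notin> H"
    and e: "e \<in> H"
  shows "e \<subseteq> Y \<or> (\<exists>s t u. e = {s,t,u} \<and> s \<in> Y \<and> t \<in> Y \<and> s \<noteq> t \<and> u \<in> V - Y)"
proof -
  define A where "A = Y \<union> {u \<in> V - Y. \<exists>s t. {s,t,u} \<in> H \<and> s \<in> Y \<and> t \<in> Y \<and> s \<noteq> t}"
  have "closed_in H A" unfolding closed_in_def
  proof
    fix f assume f: "f \<in> H"
    note fV = tsD[OF ts f]
    from card3_trichotomy[OF fV(2), of Y] consider "f \<inter> Y = {}" | s u v where "f = {s,u,v}" "s \<in> Y" "u \<notin> Y" "v \<notin> Y" "u \<noteq> v"
      | s t u where "f = {s,t,u}" "s \<in> Y" "t \<in> Y" "s \<noteq> t" "u \<notin> Y" | "f \<subseteq> Y" by metis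
    then show "f \<subseteq> A \<or> f \<inter> A = {}"
    proof cases
      case 1
      have "f \<inter> A = {}"
      proof (rule ccontr)
        assume "f \<inter> A \<noteq> {}"
        then obtain u where u: "u \<in> f" "u \<in> A" by blast
        then have "u \<notin> Y" using 1 by blast
        then obtain s t where st: "{s,t,u} \<in> H" "s \<in> Y" "t \<in> Y" "s \<noteq> t" using u(2) unfolding A_def by blast
        obtain v w where "f = {u,v,w}" "u \<noteq> v" "u \<noteq> w" "v \<noteq> w" using card3_elem[OF fV(2) u(1)] by metis
        then show False using far[OF st \<open>u \<notin> Y\<close>, of v w] f 1 by auto
      qed
      then show ?thesis by simp
    next
      case 2 then show ?thesis using one[of s u v] f by simp
    next
      case (3 s t u)
      then have "u \<in> V" using fV(1) by simp
      then have "u \<in> A" using 3 f unfolding A_def by blast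
      then show ?thesis using 3 unfolding A_def by simp
    next
      case 4 then show ?thesis unfolding A_def by blast
    qed
  qed
  moreover have "A \<subseteq> V" "A \<noteq> {}" using Y unfolding A_def by auto
  ultimately have AV: "A = V" using con unfolding connected_on_def by blast
  note eV = tsD[OF ts e]
  from card3_trichotomy[OF eV(2), of Y] consider "e \<inter> Y = {}" | s u v where "e = {s,u,v}" "s \<in> Y" "u \<notin> Y" "v \<notin> Y" "u \<noteq> v"
    | s t u where "e = {s,t,u}" "s \<in> Y" "t \<in> Y" "s \<noteq> t" "u \<notin> Y" | "e \<subseteq> Y" by metis
  then show ?thesis
  proof cases
    case 1
    obtain u where u: "u \<in> e" using eV(2) by fastforce
    then have uY: "u \<notin> Y" using 1 by blast
    have "u \<in> A" using u eV(1) AV by blast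
    then obtain s t where st: "{s,t,u} \<in> H" "s \<in> Y" "t \<in> Y" "s \<noteq> t" using uY unfolding A_def by blast
    obtain v w where "e = {u,v,w}" "u \<noteq> v" "u \<noteq> w" "v \<noteq> w" using card3_elem[OF eV(2) u] by metis
    then show ?thesis using far[OF st uY, of v w] e 1 by auto
  next
    case 2 then show ?thesis using one[of s u v] e by simp
  next
    case (3 s t u)
    then have "u \<in> V - Y" using eV(1) by simp
    then show ?thesis using 3 by blast
  qed simp
qed


text \<open>One less than the largest edge number of a non-star on \<open>m \<ge> 8\<close> vertices, and one less
  than the star for \<open>m = 7\<close>.\<close>

definition conn_bd :: "nat \<Rightarrow> nat" where
  "conn_bd m = (if m \<le> 12 then [0,0,0,0,0,0,0,14,19,20,23,29,39] ! m else 3 + (m - 4 choose 2))"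

lemma conn_bd_large:
  assumes "12 < m"
  shows "3 * m \<le> 7 + conn_bd m" "12 + apex_bd (m - 5) \<le> conn_bd m"
proof -
  define j where "j = m - 13"
  have m: "m = j + 13" using assms j_def by simp
  have "(9 + j choose 2) = 36 + (j choose 2) + 9 * j" "(7 + j choose 2) = 21 + (j choose 2) + 7 * j"
    using choose_two_add[of 9 j] choose_two[of 9] choose_two_add[of 7 j] choose_two[of 7] by simp_all
  then show "3 * m \<le> 7 + conn_bd m" "12 + apex_bd (m - 5) \<le> conn_bd m" by (simp_all add: conn_bd_def apex_bd_def m add.commute)
qed

text \<open>These are the totals that arise without terminal vertices: 3 m - 7 for corner
  attachments to a loose triangle, and 12 plus \<open>apex_bd\<close> of the vertices outside the
  five-vertex core of a fan. Both are tight at m = 7 and m = 9.\<close>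

lemma conn_bd_bounds:
  assumes "7 \<le> m"
  shows "3 * m \<le> 7 + conn_bd m" "12 + apex_bd (m - 5) \<le> conn_bd m"
proof -
  have "3 * m \<le> 7 + conn_bd m \<and> 12 + apex_bd (m - 5) \<le> conn_bd m"
  proof (cases "m \<le> 12")
    case True then show ?thesis using assms by (cases rule: nat_le_12_cases) (simp_all add: conn_bd_def apex_bd_def choose_two)
  qed (simp add: conn_bd_large)
  then show "3 * m \<le> 7 + conn_bd m" "12 + apex_bd (m - 5) \<le> conn_bd m" by auto
qed

lemma root2_bd_le_conn_bd: "7 \<le> m \<Longrightarrow> m \<le> 12 \<Longrightarrow> root2_bd m \<le> conn_bd m"
  by (cases m rule: nat_le_12_cases) (simp_all add: conn_bd_def root2_bd_table)

lemma card_le_inside_plus: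
  assumes fH: "finite H" and fO: "finite W" and cov: "\<And>e. e \<in> H \<Longrightarrow> e \<subseteq> Y \<or> (\<exists>u\<in>W. u \<in> e)"
  shows "card H \<le> card {e \<in> H. e \<subseteq> Y} + (\<Sum>u\<in>W. card {e \<in> H. u \<in> e})"
proof -
  have "H \<subseteq> {e \<in> H. e \<subseteq> Y} \<union> (\<Union>u\<in>W. {e \<in> H. u \<in> e})" using cov by blast
  then have "card H \<le> card ({e \<in> H. e \<subseteq> Y} \<union> (\<Union>u\<in>W. {e \<in> H. u \<in> e}))"
    by (rule card_mono[rotated]) (use fH fO in simp)
  also have "\<dots> \<le> card {e \<in> H. e \<subseteq> Y} + card (\<Union>u\<in>W. {e \<in> H. u \<in> e})" by (rule card_Un_le)
  also have "card (\<Union>u\<in>W. {e \<in> H. u \<in> e}) \<le> (\<Sum>u\<in>W. card {e \<in> H. u \<in> e})" by (rule card_UN_le[OF fO])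
  finally show ?thesis by simp
qed

section \<open>Edge count around a loose triangle\<close>

context loose_triangle
begin

lemma Y_facts: "Y \<subseteq> V" "Y \<noteq> {}" "card Y = 6"
  using tsD(1)[OF ts edges(1)] tsD(1)[OF ts edges(2)] tsD(1)[OF ts edges(3)] dist unfolding Y_def by auto

lemma rot: "loose_triangle V H x2 x3 x1 y2 y3 y1" "loose_triangle V H x3 x1 x2 y3 y1 y2"
  using ts pf dist edges by unfold_locales (auto simp: insert_commute)

lemma swap: "loose_triangle V H x1 x3 x2 y1 y3 y2"
  using ts pf dist edges by unfold_locales (auto simp: insert_commute)

lemma rot_Y: "loose_triangle.Y x2 x3 x1 y2 y3 y1 = Y" "loose_triangle.Y x3 x1 x2 y3 y1 y2 = Y" "loose_triangle.Y x1 x3 x2 y1 y3 y2 = Y"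
  unfolding Y_def loose_triangle.Y_def[OF rot(1)] loose_triangle.Y_def[OF rot(2)] loose_triangle.Y_def[OF swap] by auto

lemma star_edges:
  assumes con: "connected_on V H" and "u \<notin> Y"
  shows "{e \<in> H. u \<in> e} \<subseteq> {{u,x1,x2},{u,x1,x3},{u,x2,x3},{u,x1,y1},{u,x2,y2},{u,x3,y3}}"
proof
  fix e assume "e \<in> {e \<in> H. u \<in> e}"
  then have e: "e \<in> H" "u \<in> e" by auto
  then have "\<not> e \<subseteq> Y" using assms(2) by blast
  moreover have "e \<subseteq> Y \<or> (\<exists>s t u. e = {s,t,u} \<and> s \<in> Y \<and> t \<in> Y \<and> s \<noteq> t \<and> u \<in> V - Y)"
  proof (rule connected_span[OF ts con Y_facts(1,2)])
    show "{s,u,v} \<notin> H" if "s \<in> Y" "u \<notin> Y" "v \<notin> Y" "u \<noteq> v" for s u v by (rule no_one_vertex[OF that])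
    show "{u,v,w} \<notin> H" if "{s,t,u} \<in> H" "s \<in> Y" "t \<in> Y" "s \<noteq> t" "u \<notin> Y" "v \<notin> Y" "w \<notin> Y" "distinct [u,v,w]" for s t u v w
      by (rule no_far_edge[OF that])
  qed (rule e(1))
  ultimately obtain s t v where v: "e = {s,t,v}" "s \<in> Y" "t \<in> Y" "s \<noteq> t" "v \<in> V - Y" by blast
  then have "v = u" using e(2) assms(2) by auto
  then show "e \<in> {{u,x1,x2},{u,x1,x3},{u,x2,x3},{u,x1,y1},{u,x2,y2},{u,x3,y3}}"
    using pair_cases[of s t u] v e(1) assms(2) by simp
qed

lemma total_bound:
  assumes con: "connected_on V H"
  shows "card H \<le> card {e \<in> H. e \<subseteq> Y} + (\<Sum>u\<in>V - Y. card {e \<in> H. u \<in> e})"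
proof (rule card_le_inside_plus)
  show "finite H" "finite (V - Y)" using ts_finite[OF ts] by auto
  show "e \<subseteq> Y \<or> (\<exists>u\<in>V - Y. u \<in> e)" if "e \<in> H" for e using tsD(1)[OF ts that] by blast
qed

lemma star_sum:
  assumes con: "connected_on V H" and "u \<notin> Y"
  shows "card {e \<in> H. u \<in> e} \<le> B {u,x1,x2} + B {u,x1,x3} + B {u,x2,x3} + B {u,x1,y1} + B {u,x2,y2} + B {u,x3,y3}"
proof -
  let ?L = "[{u,x1,x2},{u,x1,x3},{u,x2,x3},{u,x1,y1},{u,x2,y2},{u,x3,y3}]"
  have "{e \<in> H. u \<in> e} \<subseteq> {e \<in> H. e \<in> set ?L}"
  proof
    fix e assume e: "e \<in> {e \<in> H. u \<in> e}"
    then have "e \<in> set ?L" using subsetD[OF star_edges[OF assms] e] by simp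
    then show "e \<in> {e \<in> H. e \<in> set ?L}" using e by blast
  qed
  then have "card {e \<in> H. u \<in> e} \<le> card {e \<in> H. e \<in> set ?L}" by (intro card_mono) auto
  also have "\<dots> \<le> (\<Sum>t\<leftarrow>?L. B t)" unfolding B_def by (rule card_le_sum_list)
  finally show ?thesis by simp
qed

text \<open>Attachments occur at corner pairs only, so each outside vertex has at most three edges,
  and 11 + 3 (m - 6) = 3 m - 7.\<close>

lemma bound_xx:
  assumes con: "connected_on V H" and m: "7 \<le> card V"
    and no: "\<And>u. u \<in> V - Y \<Longrightarrow> {u,x1,y1} \<notin> H \<and> {u,x2,y2} \<notin> H \<and> {u,x3,y3} \<notin> H"
  shows "card H \<le> 3 * card V - 7"
proof -
  note fV = ts_finite(1)[OF ts]
  have cO: "card (V - Y) = card V - 6" using Y_facts fV by (simp add: card_Diff_subset finite_subset)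
  have "V - Y \<noteq> {}"
  proof
    assume "V - Y = {}"
    then have "card (V - Y) = 0" by (simp only: card.empty)
    then show False using cO m by linarith
  qed
  then obtain u where u: "u \<in> V" "u \<notin> Y" by blast
  have "V \<noteq> {u}" using m by auto
  then obtain e where e: "e \<in> H" "u \<in> e" using connected_vertex_edge[OF ts con u(1)] by metis
  have "e \<in> {e \<in> H. u \<in> e}" using e by simp
  then have "e \<in> {{u,x1,x2},{u,x1,x3},{u,x2,x3},{u,x1,y1},{u,x2,y2},{u,x3,y3}}" by (rule subsetD[OF star_edges[OF con u(2)]])
  then have "{u,x1,x2} \<in> H \<or> {u,x3,x1} \<in> H \<or> {u,x2,x3} \<in> H"
    using no[of u] u e(1) by (elim insertE emptyE) (simp_all add: insert_commute)
  then have I: "card {e \<in> H. e \<subseteq> Y} \<le> 11"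
    using inside_xx[OF u(2)] loose_triangle.inside_xx[OF rot(1), unfolded rot_Y, OF u(2)]
      loose_triangle.inside_xx[OF rot(2), unfolded rot_Y, OF u(2)] by blast
  have "card {e \<in> H. v \<in> e} \<le> 3" if "v \<in> V - Y" for v
    using star_sum[OF con, of v] that no[OF that] B_le[of "{v,x1,x2}"] B_le[of "{v,x1,x3}"] B_le[of "{v,x2,x3}"]
    by (simp add: B_def)
  then have "(\<Sum>u\<in>V - Y. card {e \<in> H. u \<in> e}) \<le> of_nat (card (V - Y)) * 3" by (rule sum_bounded_above)
  then show ?thesis using total_bound[OF con] I cO m by simp
qed

text \<open>Besides lowering the inside count to 10, {u,x1,y1} restricts all other outside vertices
  by \<open>other_vertex\<close>. If a second vertex is attached at {x1,y1}, then u is restricted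
  too and all have at most three edges; if not, u has at most six and the others two.\<close>

lemma bound_xy:
  assumes con: "connected_on V H" and m: "7 \<le> card V" and u: "u \<in> V - Y" "{u,x1,y1} \<in> H"
  shows "card H \<le> conn_bd (card V)"
proof -
  note fV = ts_finite(1)[OF ts]
  have cO: "card (V - Y) = card V - 6" using Y_facts fV by (simp add: card_Diff_subset finite_subset)
  have uY: "u \<notin> Y" using u by blast
  have I: "card {e \<in> H. e \<subseteq> Y} \<le> 10" by (rule inside_xy[OF uY u(2)])
  note tot = total_bound[OF con]
  note su = star_sum[OF con uY]
  note bl = B_le[of "{u,x1,x2}"] B_le[of "{u,x1,x3}"] B_le[of "{u,x2,x3}"] B_le[of "{u,x1,y1}"] B_le[of "{u,x2,y2}"] B_le[of "{u,x3,y3}"]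
  have s6: "card {e \<in> H. u \<in> e} \<le> 6" using su bl by linarith
  have split: "(\<Sum>v\<in>V - Y. card {e \<in> H. v \<in> e}) = card {e \<in> H. u \<in> e} + (\<Sum>v\<in>V - Y - {u}. card {e \<in> H. v \<in> e})"
    using u(1) fV by (simp add: sum.remove)
  have cO': "card (V - Y - {u}) = card V - 7" using u(1) cO by simp
  show ?thesis
  proof (cases "card V = 7")
    case True
    then have "card (V - Y - {u}) = 0" "finite (V - Y - {u})" using cO' fV by simp_all
    then have "V - Y - {u} = {}" by (metis card_0_eq)
    then have "(\<Sum>v\<in>V - Y - {u}. card {e \<in> H. v \<in> e}) = 0" by (simp only: sum.empty)
    then have tot7: "card H \<le> card {e \<in> H. e \<subseteq> Y} + card {e \<in> H. u \<in> e}" using tot split by linarith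
    have "card H \<le> 14"
    \<comment> \<open>Here u is the only outside vertex: 10 + 4 suffices, and more than four edges
      at u trigger \<open>inside_kill\<close>, giving 7 + 6.\<close>
    proof (cases "card {e \<in> H. u \<in> e} \<le> 4")
      case True then show ?thesis using tot7 I by linarith
    next
      case False
      have k1: "card {e \<in> H. e \<subseteq> Y} \<le> 7" if "{u,x1,x2} \<in> H" "{u,x3,y3} \<in> H"
        by (rule inside_kill[OF uY that u(2)])
      have k2: "card {e \<in> H. e \<subseteq> Y} \<le> 7" if "{u,x1,x3} \<in> H" "{u,x2,y2} \<in> H"
        using loose_triangle.inside_kill[OF swap, unfolded rot_Y, OF uY that u(2)] .
      have k3: "card {e \<in> H. e \<subseteq> Y} \<le> 7" if "{u,x2,x3} \<in> H" "{u,x2,y2} \<in> H"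
        using loose_triangle.inside_kill[OF rot(1), unfolded rot_Y, OF uY that(1) u(2) that(2)] .
      have "card {e \<in> H. e \<subseteq> Y} \<le> 7"
      proof (rule ccontr)
        assume "\<not> ?thesis"
        then have "\<not> ({u,x1,x2} \<in> H \<and> {u,x3,y3} \<in> H)" "\<not> ({u,x1,x3} \<in> H \<and> {u,x2,y2} \<in> H)"
          using k1 k2 by blast+
        \<comment> \<open>Two disjoint pairs of attachments each lose a member, so at most four of
          the six edges at u remain.\<close>
        then have "B {u,x1,x2} + B {u,x3,y3} \<le> 1" "B {u,x1,x3} + B {u,x2,y2} \<le> 1" unfolding B_def by auto
        then show False using False su bl by linarith
      qed
      then show ?thesis using tot7 s6 by linarith
    qed
    then show ?thesis using True by (simp add: conn_bd_def)
  next
    case False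
    then have m8: "8 \<le> card V" using m by simp
    show ?thesis
    proof (cases "\<exists>v\<in>V - Y - {u}. {v,x1,y1} \<in> H")
      case True
      then obtain v where v: "v \<in> V" "v \<notin> Y" "v \<noteq> u" "{v,x1,y1} \<in> H" by blast
      have "card {e \<in> H. w \<in> e} \<le> 3" if w: "w \<in> V - Y" for w
      proof -
        have wY: "w \<notin> Y" using w by blast
        have "{w,x2,x3} \<notin> H \<and> {w,x2,y2} \<notin> H \<and> {w,x3,y3} \<notin> H"
          using other_vertex[OF uY wY _ u(2)] other_vertex[OF v(2) wY _ v(4)] v(3) by blast
        then show ?thesis using star_sum[OF con wY] B_le[of "{w,x1,x2}"] B_le[of "{w,x1,x3}"] B_le[of "{w,x1,y1}"]
          by (simp add: B_def)
      qed
      then have "(\<Sum>u\<in>V - Y. card {e \<in> H. u \<in> e}) \<le> of_nat (card (V - Y)) * 3" by (rule sum_bounded_above)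
      then show ?thesis using tot I cO m conn_bd_bounds(1)[OF m] by simp
    next
      case False
      have "card {e \<in> H. w \<in> e} \<le> 2" if w: "w \<in> V - Y - {u}" for w
      proof -
        have wY: "w \<notin> Y" "u \<noteq> w" using w by auto
        have "{w,x2,x3} \<notin> H" "{w,x2,y2} \<notin> H" "{w,x3,y3} \<notin> H" "{w,x1,y1} \<notin> H"
          using other_vertex[OF uY wY u(2)] False w by auto
        then show ?thesis using star_sum[OF con wY(1)] B_le[of "{w,x1,x2}"] B_le[of "{w,x1,x3}"]
          by (simp add: B_def)
      qed
      then have "(\<Sum>v\<in>V - Y - {u}. card {e \<in> H. v \<in> e}) \<le> of_nat (card (V - Y - {u})) * 2" by (rule sum_bounded_above)
      then have le: "card H \<le> 16 + 2 * (card V - 7)" using tot split I s6 cO' by simp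
      show ?thesis
      \<comment> \<open>16 + 2 (m - 7) is at most 3 m - 7 only from m = 9 on; at m = 8 it is 18,
        below \<open>conn_bd 8\<close> = 19.\<close>
      proof (cases "card V = 8")
        case True then show ?thesis using le by (simp add: conn_bd_def)
      next
        case False then show ?thesis using le m8 conn_bd_bounds(1)[OF m] by linarith
      qed
    qed
  qed
qed

theorem loose_triangle_bound:
  assumes con: "connected_on V H" and m: "7 \<le> card V"
  shows "card H \<le> conn_bd (card V)"
proof (cases "\<exists>u\<in>V - Y. {u,x1,y1} \<in> H \<or> {u,x2,y2} \<in> H \<or> {u,x3,y3} \<in> H")
  case True
  then obtain u where "u \<in> V - Y" "{u,x1,y1} \<in> H \<or> {u,x2,y2} \<in> H \<or> {u,x3,y3} \<in> H" by blast
  then show ?thesis using bound_xy[OF con m] loose_triangle.bound_xy[OF rot(1) con m, unfolded rot_Y]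
    loose_triangle.bound_xy[OF rot(2) con m, unfolded rot_Y] by blast
next
  case False
  then have "card H \<le> 3 * card V - 7" by (intro bound_xx[OF con m]) blast
  then show ?thesis using conn_bd_bounds(1)[OF m] by linarith
qed

end

section \<open>Triangle-free systems without terminal vertices\<close>

definition triangle_free :: "'a set set \<Rightarrow> bool" where
  "triangle_free H \<longleftrightarrow> (\<forall>a b c d e f. distinct [a,b,c,d,e,f] \<longrightarrow> {a,b,c} \<in> H \<longrightarrow> {c,d,e} \<in> H \<longrightarrow> {e,f,a} \<notin> H)"

lemma triangle_freeD:
  assumes "triangle_free H" "distinct [a,b,c,d,e,f]" "{a,b,c} \<in> H" "{c,d,e} \<in> H" "{e,f,a} \<in> H"
  shows False
  using assms unfolding triangle_free_def by blast

lemma not_triangle_free: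
  assumes "triple_system V H" "Pfree H" "\<not> triangle_free H"
  obtains x1 x2 x3 y1 y2 y3 where "loose_triangle V H x1 x2 x3 y1 y2 y3"
proof -
  obtain a b c d e f where h: "distinct [a,b,c,d,e,f]" "{a,b,c} \<in> H" "{c,d,e} \<in> H" "{e,f,a} \<in> H"
    using assms(3) unfolding triangle_free_def by blast
  have "loose_triangle V H a c e d f b"
    by unfold_locales (use assms(1,2) h in \<open>auto simp: insert_commute\<close>)
  then show ?thesis by (rule that)
qed

lemma apex_bd_Suc_2: "2 \<le> k \<Longrightarrow> apex_bd k + 2 \<le> apex_bd (Suc k)"
proof (cases "k \<le> 12")
  case True
  assume "2 \<le> k"
  with True show ?thesis by (cases rule: nat_le_12_cases) (simp_all add: apex_bd_def choose_two)
next
  case False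
  then obtain j where "k = Suc j" "j \<ge> 12" by (cases k) auto
  then show ?thesis by (simp add: apex_bd_def choose_two_Suc)
qed

text \<open>An outer vertex of a fan is charged two edges. From two vertices on
  \<open>apex_bd\<close> grows by at least 2 per vertex; the + 1 pays for the step from 1 to
  2.\<close>

lemma apex_bd_shift:
  assumes "1 \<le> b"
  shows "2 * j + apex_bd b \<le> apex_bd (b + j) + 1"
proof (induction j)
  case (Suc j)
  show ?case
  proof (cases "b + j = 1")
    case True
    then have "b = 1" "j = 0" using assms by auto
    then show ?thesis by (simp add: apex_bd_def)
  next
    case False
    then have "2 \<le> b + j" using assms by simp
    from apex_bd_Suc_2[OF this] Suc show ?thesis by simp
  qed
qed simp

text \<open>Arises at a non-terminal c when a two-edge path leaving c enters {a1,a2,u} in the link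
  vertex a1, by an edge {c,a1,b1} across two disjoint link pairs of c.\<close>

locale chain_config =
  fixes V :: "'a set" and H c a1 a2 b1 b2 u
  assumes ts: "triple_system V H" and pf: "Pfree H" and cf: "triangle_free H"
    and dist: "distinct [c,a1,a2,b1,b2,u]"
    and edges: "{c,a1,a2} \<in> H" "{c,b1,b2} \<in> H" "{a1,a2,u} \<in> H" "{c,a1,b1} \<in> H"
begin

definition Y :: "'a set" where "Y = {c,a1,a2,b1,b2,u}"

lemma no_one_vertex:
  assumes "s \<in> Y" "p \<notin> Y" "q \<notin> Y" "p \<noteq> q"
  shows "{s,p,q} \<notin> H"
proof
  assume a: "{s,p,q} \<in> H"
  have n: "distinct [p,q,c,a1,a2,b1,b2,u]" "distinct [u,b2,b1,a2,a1,c,q,p]" using assms(2-4) dist unfolding Y_def by auto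
  from assms(1) show False unfolding Y_def
  proof (elim insertE emptyE)
    assume "s = c" then show False using PfreeD[OF pf, of a2 u a1 b1 c p q] a n edges by (simp add: insert_commute)
  next
    assume "s = a1" then show False using PfreeD[OF pf, of b1 b2 c a2 a1 p q] a n edges by (simp add: insert_commute)
  next
    assume "s = a2" then show False using PfreeD[OF pf, of b1 b2 c a1 a2 p q] a n edges by (simp add: insert_commute)
  next
    assume "s = b1" then show False using PfreeD[OF pf, of a1 a2 c b2 b1 p q] a n edges by (simp add: insert_commute)
  next
    assume "s = b2" then show False using PfreeD[OF pf, of a1 a2 c b1 b2 p q] a n edges by (simp add: insert_commute)
  next
    assume "s = u" then show False using PfreeD[OF pf, of b1 c a1 a2 u p q] a n edges by (simp add: insert_commute)
  qed
qed

text \<open>Thirteen of fifteen pairs would complete P; {c,b1} and {a1,a2} remain, so an outside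
  vertex has at most two edges.\<close>

lemma no_pair:
  assumes "p \<notin> Y"
  shows "{p,c,a1} \<notin> H" "{p,c,a2} \<notin> H" "{p,c,b2} \<notin> H" "{p,c,u} \<notin> H" "{p,a1,b1} \<notin> H" "{p,a1,b2} \<notin> H" "{p,a1,u} \<notin> H" "{p,a2,b1} \<notin> H" "{p,a2,b2} \<notin> H" "{p,a2,u} \<notin> H" "{p,b1,b2} \<notin> H" "{p,b1,u} \<notin> H" "{p,b2,u} \<notin> H"
proof -
  have n: "distinct [p,c,a1,a2,b1,b2,u]" "distinct [u,b2,b1,a2,a1,c,p]" using assms dist unfolding Y_def by auto
  show "{p,c,a1} \<notin> H"
    "{p,c,a2} \<notin> H"
    "{p,c,b2} \<notin> H"
    "{p,c,u} \<notin> H"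
    "{p,a1,b1} \<notin> H"
    "{p,a1,b2} \<notin> H"
    "{p,a1,u} \<notin> H"
    "{p,a2,b1} \<notin> H"
    "{p,a2,b2} \<notin> H"
    "{p,a2,u} \<notin> H"
    "{p,b1,b2} \<notin> H"
    "{p,b1,u} \<notin> H"
    "{p,b2,u} \<notin> H"
    using n edges
      PfreeD[OF pf, of b1 b2 c p a1 a2 u]
      PfreeD[OF pf, of b1 b2 c p a2 a1 u]
      PfreeD[OF pf, of a2 u a1 b1 c b2 p]
      PfreeD[OF pf, of b1 b2 c p u a1 a2]
      PfreeD[OF pf, of b2 c b1 p a1 a2 u]
      PfreeD[OF pf, of b1 c b2 p a1 a2 u]
      PfreeD[OF pf, of b1 b2 c a2 a1 p u]
      PfreeD[OF pf, of b2 c b1 p a2 a1 u]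
      PfreeD[OF pf, of b1 c a1 u a2 b2 p]
      PfreeD[OF pf, of b1 b2 c a1 a2 p u]
      PfreeD[OF pf, of a2 u a1 c b1 b2 p]
      PfreeD[OF pf, of a1 a2 c b2 b1 p u]
      PfreeD[OF pf, of a1 a2 c b1 b2 p u]
    by (auto simp: insert_commute)
qed

lemma pair_cases:
  assumes "{s,t,p} \<in> H" "s \<in> Y" "t \<in> Y" "s \<noteq> t" "p \<notin> Y"
  shows "{s,t,p} \<in> {{p,c,b1},{p,a1,a2}}"
proof -
  define e where "e = {p,s,t}"
  have "s \<in> {c,a1,a2,b1,b2,u}" "t \<in> {c,a1,a2,b1,b2,u}" using assms(2,3) unfolding Y_def by auto
  then have "e \<in> {{p,c,a1},{p,c,a2},{p,c,b1},{p,c,b2},{p,c,u},{p,a1,a2},{p,a1,b1},{p,a1,b2},{p,a1,u},{p,a2,b1},{p,a2,b2},{p,a2,u},{p,b1,b2},{p,b1,u},{p,b2,u}}"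
    using assms(4) unfolding e_def by (elim insertE emptyE) (simp_all add: insert_commute)
  moreover have e: "e \<in> H" "{s,t,p} = e" using assms(1) unfolding e_def by (simp_all add: insert_commute)
  ultimately have "e \<in> {{p,c,b1},{p,a1,a2}}"
    using no_pair[OF assms(5)] by (elim insertE emptyE) simp_all
  then show ?thesis using e(2) by simp
qed

lemma no_far_edge:
  assumes "{s,t,p} \<in> H" "s \<in> Y" "t \<in> Y" "s \<noteq> t" "p \<notin> Y" "q \<notin> Y" "r \<notin> Y" "distinct [p,q,r]"
  shows "{p,q,r} \<notin> H"
proof
  assume a: "{p,q,r} \<in> H"
  have n: "distinct [p,q,r,c,a1,a2,b1,b2,u]" "distinct [u,b2,b1,a2,a1,c,r,q,p]" using assms(5-8) dist unfolding Y_def by auto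
  obtain e where e: "e = {s,t,p}" by simp
  have eH: "e \<in> H" using assms(1) e by simp
  have "e \<in> {{p,c,b1},{p,a1,a2}}" using pair_cases[OF assms(1-5)] e by simp
  then show False
  proof (elim insertE emptyE)
    assume "e = {p,c,b1}" then show False using PfreeD[OF pf, of a1 a2 c b1 p q r] a n edges eH by (simp add: insert_commute)
  next
    assume "e = {p,a1,a2}" then show False using PfreeD[OF pf, of b1 c a1 a2 p q r] a n edges eH by (simp add: insert_commute)
  qed
qed

text \<open>Each of these eight triples would close a loose triangle, which leaves 12 of the 20
  triples in the core.\<close>

lemma no_inside:
  shows "{c,a2,b2} \<notin> H" "{c,b2,u} \<notin> H" "{a1,b1,u} \<notin> H" "{a1,b2,u} \<notin> H" "{a2,b1,b2} \<notin> H" "{a2,b1,u} \<notin> H" "{a2,b2,u} \<notin> H" "{b1,b2,u} \<notin> H"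
proof -
  have n: "distinct [u,b2,b1,a2,a1,c]" using dist by auto
  show "{c,a2,b2} \<notin> H" "{c,b2,u} \<notin> H" "{a1,b1,u} \<notin> H" "{a1,b2,u} \<notin> H" "{a2,b1,b2} \<notin> H" "{a2,b1,u} \<notin> H" "{a2,b2,u} \<notin> H" "{b1,b2,u} \<notin> H"
    using n dist edges
      triangle_freeD[OF cf, of a2 u a1 b1 c b2]
      triangle_freeD[OF cf, of u a2 a1 b1 c b2]
      triangle_freeD[OF cf, of a1 a2 c b2 b1 u]
      triangle_freeD[OF cf, of a1 a2 c b1 b2 u]
      triangle_freeD[OF cf, of a2 u a1 c b1 b2]
      triangle_freeD[OF cf, of a2 a1 c b2 b1 u]
      triangle_freeD[OF cf, of a2 a1 c b1 b2 u]
      triangle_freeD[OF cf, of u a2 a1 c b1 b2]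
    by (auto simp: insert_commute)
qed

lemma inside: "card {e \<in> H. e \<subseteq> Y} \<le> 12"
proof -
  let ?L = "[{c,a1,a2},{c,a1,b1},{c,a1,b2},{c,a1,u},{c,a2,b1},{c,a2,u},{c,b1,b2},{c,b1,u},{a1,a2,b1},{a1,a2,b2},{a1,a2,u},{a1,b1,b2}]"
  have "e \<in> set ?L" if "e \<in> H" "e \<subseteq> Y" for e
    using six_triples[OF that(2)[unfolded Y_def] tsD(2)[OF ts that(1)]] that(1) no_inside
    by (elim insertE emptyE) simp_all
  then have "{e \<in> H. e \<subseteq> Y} \<subseteq> set ?L" by blast
  then have "card {e \<in> H. e \<subseteq> Y} \<le> card (set ?L)" by (rule card_mono[rotated]) simp
  also have "\<dots> \<le> length ?L" by (rule card_length)
  finally show ?thesis by simp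
qed

lemma Y_facts: "Y \<subseteq> V" "Y \<noteq> {}" "card Y = 6"
  using tsD(1)[OF ts edges(1)] tsD(1)[OF ts edges(2)] tsD(1)[OF ts edges(3)] dist unfolding Y_def by auto

text \<open>12 + 2 (m - 6) = 2 m, and this is at most 3 m - 7 since m \<ge> 7.\<close>

theorem chain_bound:
  assumes con: "connected_on V H" and m: "7 \<le> card V"
  shows "card H \<le> conn_bd (card V)"
proof -
  note fV = ts_finite(1)[OF ts]
  have cO: "card (V - Y) = card V - 6" using Y_facts fV by (simp add: card_Diff_subset finite_subset)
  have "card {e \<in> H. p \<in> e} \<le> 2" if p: "p \<in> V - Y" for p
  proof -
    have pY: "p \<notin> Y" using p by blast
    have "{e \<in> H. p \<in> e} \<subseteq> {{p,c,b1},{p,a1,a2}}"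
    proof
      fix e assume "e \<in> {e \<in> H. p \<in> e}"
      then have e: "e \<in> H" "p \<in> e" by auto
      then have "\<not> e \<subseteq> Y" using pY by blast
      moreover have "e \<subseteq> Y \<or> (\<exists>s t u. e = {s,t,u} \<and> s \<in> Y \<and> t \<in> Y \<and> s \<noteq> t \<and> u \<in> V - Y)"
      proof (rule connected_span[OF ts con Y_facts(1,2)])
        show "{s,u,v} \<notin> H" if "s \<in> Y" "u \<notin> Y" "v \<notin> Y" "u \<noteq> v" for s u v by (rule no_one_vertex[OF that])
        show "{u,v,w} \<notin> H" if "{s,t,u} \<in> H" "s \<in> Y" "t \<in> Y" "s \<noteq> t" "u \<notin> Y" "v \<notin> Y" "w \<notin> Y" "distinct [u,v,w]" for s t u v w
          by (rule no_far_edge[OF that])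
      qed (rule e(1))
      ultimately obtain s t v where v: "e = {s,t,v}" "s \<in> Y" "t \<in> Y" "s \<noteq> t" "v \<in> V - Y" by blast
      then have "v = p" using e(2) pY by auto
      then show "e \<in> {{p,c,b1},{p,a1,a2}}" using pair_cases[of s t p] v e(1) pY by simp
    qed
    then have "card {e \<in> H. p \<in> e} \<le> card {{p,c,b1},{p,a1,a2}}" by (intro card_mono) auto
    also have "\<dots> \<le> 2" by (simp add: card_insert_if)
    finally show ?thesis .
  qed
  then have "(\<Sum>p\<in>V - Y. card {e \<in> H. p \<in> e}) \<le> of_nat (card (V - Y)) * 2" by (rule sum_bounded_above)
  moreover have "card H \<le> card {e \<in> H. e \<subseteq> Y} + (\<Sum>p\<in>V - Y. card {e \<in> H. p \<in> e})"
  proof (rule card_le_inside_plus)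
    show "finite H" "finite (V - Y)" using ts_finite[OF ts] by auto
    show "e \<subseteq> Y \<or> (\<exists>u\<in>V - Y. u \<in> e)" if "e \<in> H" for e using tsD(1)[OF ts that] by blast
  qed
  ultimately show ?thesis using inside cO m conn_bd_bounds(1)[OF m] by simp
qed

end

text \<open>Two apexes of the pair {a1,a2}, joined by an edge that avoids the pair. Edges off the
  core remain possible at further apexes of {a1,a2}, so \<open>connected_span\<close> is replaced by
  a rooted system outside the core.\<close>

locale fan_config =
  fixes V :: "'a set" and H c u w a1 a2
  assumes ts: "triple_system V H" and pf: "Pfree H" and cf: "triangle_free H"
    and dist: "distinct [c,u,w,a1,a2]"
    and edges: "{c,a1,a2} \<in> H" "{u,a1,a2} \<in> H" "{c,u,w} \<in> H"
begin

definition Y :: "'a set" where "Y = {c,u,w,a1,a2}"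

lemma no_one_vertex:
  assumes "s \<in> Y" "p \<notin> Y" "q \<notin> Y" "p \<noteq> q"
  shows "{s,p,q} \<notin> H"
proof
  assume a: "{s,p,q} \<in> H"
  have n: "distinct [p,q,c,u,w,a1,a2]" "distinct [a2,a1,w,u,c,q,p]" using assms(2-4) dist unfolding Y_def by auto
  from assms(1) show False unfolding Y_def
  proof (elim insertE emptyE)
    assume "s = c" then show False using PfreeD[OF pf, of a1 a2 u w c p q] a n edges by (simp add: insert_commute)
  next
    assume "s = u" then show False using PfreeD[OF pf, of a1 a2 c w u p q] a n edges by (simp add: insert_commute)
  next
    assume "s = w" then show False using PfreeD[OF pf, of a1 a2 c u w p q] a n edges by (simp add: insert_commute)
  next
    assume "s = a1" then show False using PfreeD[OF pf, of u w c a2 a1 p q] a n edges by (simp add: insert_commute)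
  next
    assume "s = a2" then show False using PfreeD[OF pf, of u w c a1 a2 p q] a n edges by (simp add: insert_commute)
  qed
qed

text \<open>Each such edge would close a loose triangle with {c,u,w} and an edge on {a1,a2}.\<close>

lemma no_pair:
  assumes "p \<notin> Y"
  shows "{p,c,a1} \<notin> H" "{p,c,a2} \<notin> H" "{p,u,a1} \<notin> H" "{p,u,a2} \<notin> H" "{p,w,a1} \<notin> H" "{p,w,a2} \<notin> H"
proof -
  have n: "distinct [p,c,u,w,a1,a2]" "distinct [a2,a1,w,u,c,p]" using assms dist unfolding Y_def by auto
  show "{p,c,a1} \<notin> H"
    "{p,c,a2} \<notin> H"
    "{p,u,a1} \<notin> H"
    "{p,u,a2} \<notin> H"
    "{p,w,a1} \<notin> H"
    "{p,w,a2} \<notin> H"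
    using n edges
      triangle_freeD[OF cf, of a1 a2 u w c p]
      triangle_freeD[OF cf, of a2 a1 u w c p]
      triangle_freeD[OF cf, of a1 a2 c w u p]
      triangle_freeD[OF cf, of a2 a1 c w u p]
      triangle_freeD[OF cf, of a1 a2 c u w p]
      triangle_freeD[OF cf, of a2 a1 c u w p]
    by (auto simp: insert_commute)
qed

lemma pair_cases:
  assumes "{s,t,p} \<in> H" "s \<in> Y" "t \<in> Y" "s \<noteq> t" "p \<notin> Y"
  shows "{s,t,p} \<in> {{p,c,u},{p,c,w},{p,u,w},{p,a1,a2}}"
proof -
  define e where "e = {p,s,t}"
  have "s \<in> {c,u,w,a1,a2}" "t \<in> {c,u,w,a1,a2}" using assms(2,3) unfolding Y_def by auto
  then have "e \<in> {{p,c,u},{p,c,w},{p,c,a1},{p,c,a2},{p,u,w},{p,u,a1},{p,u,a2},{p,w,a1},{p,w,a2},{p,a1,a2}}"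
    using assms(4) unfolding e_def by (elim insertE emptyE) (simp_all add: insert_commute)
  moreover have e: "e \<in> H" "{s,t,p} = e" using assms(1) unfolding e_def by (simp_all add: insert_commute)
  ultimately have "e \<in> {{p,c,u},{p,c,w},{p,u,w},{p,a1,a2}}"
    using no_pair[OF assms(5)] by (elim insertE emptyE) simp_all
  then show ?thesis using e(2) by simp
qed

lemma Y_facts: "Y \<subseteq> V" "card Y = 5"
  using tsD(1)[OF ts edges(1)] tsD(1)[OF ts edges(2)] tsD(1)[OF ts edges(3)] dist unfolding Y_def by auto

lemma no_far_edge:
  assumes "p \<notin> Y" "q \<notin> Y" "r \<notin> Y" "distinct [p,q,r]" "{p,c,u} \<in> H \<or> {p,c,w} \<in> H \<or> {p,u,w} \<in> H"
  shows "{p,q,r} \<notin> H"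
proof
  assume a: "{p,q,r} \<in> H"
  have n: "distinct [p,q,r,c,u,w,a1,a2]" "distinct [a2,a1,w,u,c,r,q,p]" using assms(1-4) dist unfolding Y_def by auto
  from assms(5) show False
  proof (elim disjE)
    assume "{p,c,u} \<in> H" then show False using PfreeD[OF pf, of a1 a2 c u p q r] a n edges by (simp add: insert_commute)
  next
    assume "{p,c,w} \<in> H" then show False using PfreeD[OF pf, of a1 a2 c w p q r] a n edges by (simp add: insert_commute)
  next
    assume "{p,u,w} \<in> H" then show False using PfreeD[OF pf, of a1 a2 u w p q r] a n edges by (simp add: insert_commute)
  qed
qed

text \<open>An edge on {a1,a2} followed by edges at p and q through different pairs of {c,u,w} would
  be P. So two or more outer vertices all use the same pair.\<close>

lemma unique_pair:
  assumes "p \<notin> Y" "q \<notin> Y" "p \<noteq> q"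
  shows "{p,c,u} \<in> H \<Longrightarrow> {q,c,w} \<notin> H" "{p,c,u} \<in> H \<Longrightarrow> {q,u,w} \<notin> H" "{p,c,w} \<in> H \<Longrightarrow> {q,c,u} \<notin> H" "{p,c,w} \<in> H \<Longrightarrow> {q,u,w} \<notin> H" "{p,u,w} \<in> H \<Longrightarrow> {q,c,u} \<notin> H" "{p,u,w} \<in> H \<Longrightarrow> {q,c,w} \<notin> H"
proof -
  have n: "distinct [p,q,c,u,w,a1,a2]" "distinct [a2,a1,w,u,c,q,p]" using assms dist unfolding Y_def by auto
  show "{p,c,u} \<in> H \<Longrightarrow> {q,c,w} \<notin> H"
    using PfreeD[OF pf, of a1 a2 u p c q w] n edges by (auto simp: insert_commute)
  show "{p,c,u} \<in> H \<Longrightarrow> {q,u,w} \<notin> H"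
    using PfreeD[OF pf, of a1 a2 c p u q w] n edges by (auto simp: insert_commute)
  show "{p,c,w} \<in> H \<Longrightarrow> {q,c,u} \<notin> H"
    using PfreeD[OF pf, of a1 a2 u q c p w] n edges by (auto simp: insert_commute)
  show "{p,c,w} \<in> H \<Longrightarrow> {q,u,w} \<notin> H"
    using PfreeD[OF pf, of a1 a2 c p w q u] n edges by (auto simp: insert_commute)
  show "{p,u,w} \<in> H \<Longrightarrow> {q,c,u} \<notin> H"
    using PfreeD[OF pf, of a1 a2 c q u p w] n edges by (auto simp: insert_commute)
  show "{p,u,w} \<in> H \<Longrightarrow> {q,c,w} \<notin> H"
    using PfreeD[OF pf, of a1 a2 u p w c q] n edges by (auto simp: insert_commute)
qed

text \<open>{a2,p,a1}, {a1,u,c}, {c,w,a2} would be a loose triangle. The edge saved inside the core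
  is needed where \<open>conn_bd\<close> is tight.\<close>

lemma apex_conflict:
  assumes "p \<notin> Y" "{p,a1,a2} \<in> H" "{c,a1,u} \<in> H"
  shows "{c,a2,w} \<notin> H"
proof -
  have n: "distinct [p,c,u,w,a1,a2]" "distinct [a2,a1,w,u,c,p]" using assms(1) dist unfolding Y_def by auto
  show ?thesis using triangle_freeD[OF cf, of a2 p a1 u c w] n edges assms(2,3) by (auto simp: insert_commute)
qed

text \<open>By \<open>no_far_edge\<close> every edge at such a vertex meets the core, so these
  vertices share no edge with \<open>rest\<close>.\<close>

definition outer :: "'a set" where
  "outer = {p \<in> V - Y. {p,c,u} \<in> H \<or> {p,c,w} \<in> H \<or> {p,u,w} \<in> H}"

definition rest :: "'a set" where "rest = V - Y - outer"

definition apexes :: "'a set" where "apexes = {p \<in> rest. {p,a1,a2} \<in> H}"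

lemma edge_cases:
  assumes e: "e \<in> H"
  obtains "e \<subseteq> Y" | p where "p \<in> outer" "e \<in> {{p,c,u},{p,c,w},{p,u,w}}" | p where "p \<in> outer" "e = {p,a1,a2}"
    | p where "p \<in> apexes" "e = {p,a1,a2}" | "e \<subseteq> rest"
proof -
  note eV = tsD[OF ts e]
  from card3_trichotomy[OF eV(2), of Y] consider "e \<inter> Y = {}" | s p q where "e = {s,p,q}" "s \<in> Y" "p \<notin> Y" "q \<notin> Y" "p \<noteq> q"
    | s t p where "e = {s,t,p}" "s \<in> Y" "t \<in> Y" "s \<noteq> t" "p \<notin> Y" | "e \<subseteq> Y" by metis
  then show ?thesis
  proof cases
    case 1
    have "p \<notin> outer" if p: "p \<in> e" for p
    proof
      assume po: "p \<in> outer"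
      obtain q r where qr: "e = {p,q,r}" "p \<noteq> q" "p \<noteq> r" "q \<noteq> r" using card3_elem[OF eV(2) p] by metis
      have "p \<notin> Y" "q \<notin> Y" "r \<notin> Y" using qr 1 by auto
      then have "{p,q,r} \<notin> H" by (rule no_far_edge) (use qr po in \<open>auto simp: outer_def\<close>)
      then show False using e qr by simp
    qed
    then have "e \<subseteq> rest" using eV(1) 1 unfolding rest_def by blast
    then show ?thesis using that(5) by simp
  next
    case 2 then show ?thesis using no_one_vertex[of s p q] e by simp
  next
    case (3 s t p)
    have pV: "p \<in> V - Y" using 3 eV(1) by simp
    have "e \<in> {{p,c,u},{p,c,w},{p,u,w},{p,a1,a2}}" using pair_cases[of s t p] 3 e by simp
    then consider "e \<in> {{p,c,u},{p,c,w},{p,u,w}}" | "e = {p,a1,a2}" by blast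
    then show ?thesis
    proof cases
      case 1
      then have "p \<in> outer" using pV e unfolding outer_def by (elim insertE emptyE) simp_all
      then show ?thesis using that(2) 1 by simp
    next
      case 2
      show ?thesis
      proof (cases "p \<in> outer")
        case True then show ?thesis using that(3) 2 by simp
      next
        case False
        then have "p \<in> apexes" using pV e 2 unfolding apexes_def rest_def by simp
        then show ?thesis using that(4) 2 by simp
      qed
    qed
  next
    case 4 then show ?thesis using that(1) by simp
  qed
qed

text \<open>The edge {a1,a2,z} in front of a two-edge path from an apex z would be P, and a closed
  set without apexes would be closed in H. Thus the bound on edges plus roots applies, with the
  edges {p,a1,a2} at apexes p counted as roots.\<close>

lemma rooted_rest:
  assumes con: "connected_on V H"
  shows "rooted rest apexes {e \<in> H. e \<subseteq> rest}"
  unfolding rooted_def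
proof (intro conjI ballI allI impI)
  show "apexes \<subseteq> rest" unfolding apexes_def by blast
  show "terminal z {e \<in> H. e \<subseteq> rest}" if z: "z \<in> apexes" for z unfolding terminal_def
  proof (intro allI impI notI)
    fix a b d f assume h: "distinct [z,a,b,d,f]" "{z,a,b} \<in> {e \<in> H. e \<subseteq> rest}" "{b,d,f} \<in> {e \<in> H. e \<subseteq> rest}"
    have "a1 \<notin> rest" "a2 \<notin> rest" unfolding rest_def Y_def by auto
    moreover have "{a1,a2,z} \<in> H" using z unfolding apexes_def by (simp add: insert_commute)
    moreover have "distinct [a1,a2,z,a,b,d,f]" using h calculation(1,2) dist by auto
    ultimately show False using PfreeD[OF pf, of a1 a2 z a b d f] h(2,3) by simp
  qed
  fix A assume A: "A \<subseteq> rest" "A \<noteq> {}" "closed_in {e \<in> H. e \<subseteq> rest} A"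
  show "A \<inter> apexes \<noteq> {}"
  proof
    assume no: "A \<inter> apexes = {}"
    have AY: "A \<inter> Y = {}" "A \<inter> outer = {}" using A(1) unfolding rest_def by auto
    have Ys: "c \<in> Y" "u \<in> Y" "w \<in> Y" "a1 \<in> Y" "a2 \<in> Y" unfolding Y_def by auto
    have Yn: "c \<notin> A" "u \<notin> A" "w \<notin> A" "a1 \<notin> A" "a2 \<notin> A" using AY(1) Ys by auto
    have "closed_in H A" unfolding closed_in_def
    proof
      fix e assume e: "e \<in> H"
      from e show "e \<subseteq> A \<or> e \<inter> A = {}"
      proof (cases e rule: edge_cases)
        case 1 then show ?thesis using AY by blast
      next
        case (2 p)
        then have "p \<notin> A" using AY by blast
        then show ?thesis using 2(2) Yn by (elim insertE emptyE) simp_all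
      next
        case (3 p)
        then have "p \<notin> A" using AY by blast
        then show ?thesis using 3(2) Yn by simp
      next
        case (4 p)
        then have "p \<notin> A" using no by blast
        then show ?thesis using 4(2) Yn by simp
      next
        case 5 then show ?thesis using A(3) e unfolding closed_in_def by blast
      qed
    qed
    moreover have "A \<subseteq> V" using A(1) unfolding rest_def by blast
    ultimately have "A = V" using con A(2) unfolding connected_on_def by blast
    then show False using AY(1) Y_facts(1) Ys(1) by blast
  qed
qed

text \<open>A single outer vertex may have three edges to {c,u,w}; as soon as there are two,
  \<open>unique_pair\<close> leaves one each.\<close>

lemma card_outer_edges:
  "card {e \<in> H. \<exists>p\<in>outer. e \<in> {{p,c,u},{p,c,w},{p,u,w}}} \<le> card outer + 2"
  "2 \<le> card outer \<Longrightarrow> card {e \<in> H. \<exists>p\<in>outer. e \<in> {{p,c,u},{p,c,w},{p,u,w}}} \<le> card outer"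
proof -
  let ?N = "\<lambda>p. {e \<in> H. e \<in> set [{p,c,u},{p,c,w},{p,u,w}]}"
  let ?X = "{e \<in> H. \<exists>p\<in>outer. e \<in> {{p,c,u},{p,c,w},{p,u,w}}}"
  have fo: "finite outer" using ts_finite(1)[OF ts] unfolding outer_def by simp
  have "?X = (\<Union>p\<in>outer. ?N p)" by auto
  then have X: "card ?X \<le> (\<Sum>p\<in>outer. card (?N p))" using card_UN_le[OF fo, of ?N] by simp
  have N: "card (?N p) \<le> (if {p,c,u} \<in> H then 1 else 0) + (if {p,c,w} \<in> H then 1 else 0) + (if {p,u,w} \<in> H then 1 else 0)" for p
    using card_le_sum_list[of H "[{p,c,u},{p,c,w},{p,u,w}]"] by simp
  have N3: "card (?N p) \<le> 3" for p by (rule order_trans[OF N]) simp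
  show big: "card ?X \<le> card outer" if c2: "2 \<le> card outer"
  proof -
    have "card (?N p) \<le> 1" if p: "p \<in> outer" for p
    proof -
      have "card (outer - {p}) \<noteq> 0" using p c2 by simp
      then obtain q where q: "q \<in> outer" "q \<noteq> p" by (metis card.empty Diff_iff equals0I insertI1)
      have "p \<notin> Y" "q \<notin> Y" "p \<noteq> q" using p q unfolding outer_def by auto
      note U = unique_pair[OF this]
      have "{q,c,u} \<in> H \<or> {q,c,w} \<in> H \<or> {q,u,w} \<in> H" using q(1) unfolding outer_def by simp
      then have "(if {p,c,u} \<in> H then 1 else 0) + (if {p,c,w} \<in> H then 1 else 0) + (if {p,u,w} \<in> H then 1 else 0) \<le> (1::nat)"
        using U by auto
      then show ?thesis by (rule order_trans[OF N])
    qed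
    then have "(\<Sum>p\<in>outer. card (?N p)) \<le> of_nat (card outer) * 1" by (rule sum_bounded_above)
    then show ?thesis using X by simp
  qed
  show "card ?X \<le> card outer + 2"
  proof (cases "2 \<le> card outer")
    case True then show ?thesis using big by linarith
  next
    case False
    have "(\<Sum>p\<in>outer. card (?N p)) \<le> of_nat (card outer) * 3" using N3 by (rule sum_bounded_above)
    then have "card ?X \<le> card outer * 3" using X by simp
    then show ?thesis using False by linarith
  qed
qed

lemma inside: "card {e \<in> H. e \<subseteq> Y} \<le> 10" "apexes \<noteq> {} \<Longrightarrow> card {e \<in> H. e \<subseteq> Y} \<le> 9"
proof -
  let ?T = "{e. e \<subseteq> Y \<and> card e = 3}"
  have fY: "finite Y" unfolding Y_def by simp
  have cT: "card ?T = 10" using n_subsets[OF fY, of 3] Y_facts(2) by (simp add: numeral_eq_Suc)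
  have fT: "finite ?T" using fY by simp
  have sub: "{e \<in> H. e \<subseteq> Y} \<subseteq> ?T" using tsD(2)[OF ts] by blast
  show "card {e \<in> H. e \<subseteq> Y} \<le> 10" using card_mono[OF fT sub] cT by simp
  assume "apexes \<noteq> {}"
  then obtain p where p: "p \<in> apexes" by blast
  have pY: "p \<notin> Y" "{p,a1,a2} \<in> H" using p unfolding apexes_def rest_def by auto
  have in_T: "{c,a1,u} \<in> ?T" "{c,a2,w} \<in> ?T" using dist unfolding Y_def by auto
  have "{c,a1,u} \<notin> H \<or> {c,a2,w} \<notin> H" using apex_conflict[OF pY] by blast
  then have "{e \<in> H. e \<subseteq> Y} \<noteq> ?T" using in_T by blast
  then have "{e \<in> H. e \<subseteq> Y} \<subset> ?T" using sub by blast
  then have "card {e \<in> H. e \<subseteq> Y} < card ?T" by (rule psubset_card_mono[OF fT])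
  then show "card {e \<in> H. e \<subseteq> Y} \<le> 9" using cT by simp
qed

lemma total:
  "card H \<le> card {e \<in> H. e \<subseteq> Y} + card {e \<in> H. \<exists>p\<in>outer. e \<in> {{p,c,u},{p,c,w},{p,u,w}}}
     + card outer + (card apexes + card {e \<in> H. e \<subseteq> rest})"
proof -
  let ?I = "{e \<in> H. e \<subseteq> Y}" and ?X = "{e \<in> H. \<exists>p\<in>outer. e \<in> {{p,c,u},{p,c,w},{p,u,w}}}"
  let ?g = "\<lambda>p. {p,a1,a2}" and ?R = "{e \<in> H. e \<subseteq> rest}"
  have fin: "finite outer" "finite apexes" "finite H" using ts_finite[OF ts] unfolding outer_def apexes_def rest_def by auto
  have "H \<subseteq> ?I \<union> ?X \<union> ?g ` outer \<union> ?g ` apexes \<union> ?R"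
  proof
    fix e assume e: "e \<in> H"
    from e show "e \<in> ?I \<union> ?X \<union> ?g ` outer \<union> ?g ` apexes \<union> ?R"
      by (cases e rule: edge_cases) (use e in blast)+
  qed
  then have "card H \<le> card (?I \<union> ?X \<union> ?g ` outer \<union> ?g ` apexes \<union> ?R)"
    by (rule card_mono[rotated]) (use fin in simp)
  also have "\<dots> \<le> card (?I \<union> ?X \<union> ?g ` outer \<union> ?g ` apexes) + card ?R" by (rule card_Un_le)
  also have "card (?I \<union> ?X \<union> ?g ` outer \<union> ?g ` apexes) \<le> card (?I \<union> ?X \<union> ?g ` outer) + card (?g ` apexes)" by (rule card_Un_le)
  also have "card (?I \<union> ?X \<union> ?g ` outer) \<le> card (?I \<union> ?X) + card (?g ` outer)" by (rule card_Un_le)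
  also have "card (?I \<union> ?X) \<le> card ?I + card ?X" by (rule card_Un_le)
  also have "card (?g ` outer) \<le> card outer" by (rule card_image_le[OF fin(1)])
  also have "card (?g ` apexes) \<le> card apexes" by (rule card_image_le[OF fin(2)])
  finally show ?thesis by simp
qed

text \<open>If \<open>rest\<close> is nonempty it contains an apex, so the core has at most 9 edges.
  With o outer vertices the total is 9 + (o + 2) + o + \<open>apex_bd (m - 5 - o)\<close>, at most
  12 + \<open>apex_bd (m - 5)\<close>. If \<open>rest\<close> is empty, it is 10 + 2 (m - 5) = 2
  m.\<close>

theorem fan_bound:
  assumes con: "connected_on V H" and m: "7 \<le> card V"
  shows "card H \<le> conn_bd (card V)"
proof -
  note fV = ts_finite(1)[OF ts]
  have cO: "card (V - Y) = card V - 5" using Y_facts fV by (simp add: card_Diff_subset finite_subset)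
  have "outer \<subseteq> V - Y" unfolding outer_def by blast
  then have parts: "card V - 5 = card outer + card rest"
    using card_parts[of "V - Y" outer] fV cO unfolding rest_def by simp
  have rV: "rest \<subseteq> V" unfolding rest_def by blast
  note rt = rooted_rest[OF con]
  have tsr: "triple_system rest {e \<in> H. e \<subseteq> rest}" by (rule ts_restrict[OF ts rV])
  have pfr: "Pfree {e \<in> H. e \<subseteq> rest}" by (rule Pfree_subset[OF pf]) simp
  have psi: "card {e \<in> H. e \<subseteq> rest} + card apexes \<le> apex_bd (card rest)"
    using rooted_bounds[OF tsr pfr rt] unfolding has_rooted_bounds_def by blast
  show ?thesis
  proof (cases "rest = {}")
    case True
    then have "card rest = 0" by simp
    then have c: "card outer = card V - 5" "apex_bd (card rest) = 0" using parts by (simp_all add: apex_bd_0)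
    then have "2 \<le> card outer" using m by simp
    then show ?thesis using total inside(1) card_outer_edges(2) psi c m conn_bd_bounds(1)[OF m] by linarith
  next
    case False
    have "apexes \<noteq> {}" by (rule rooted_nonempty[OF rt False tsr])
    have "finite rest" using rV fV finite_subset by blast
    then have r1: "1 \<le> card rest" using False by (simp add: Suc_le_eq card_gt_0_iff)
    have "2 * card outer + apex_bd (card rest) \<le> apex_bd (card V - 5) + 1"
      using apex_bd_shift[OF r1, of "card outer"] parts by (simp add: add.commute)
    then show ?thesis using total inside(2)[OF \<open>apexes \<noteq> {}\<close>] card_outer_edges(1) psi conn_bd_bounds(2)[OF m] by linarith
  qed
qed

end

text \<open>An edge meeting each of the two link pairs in at most one vertex would close a loose triangle or
  extend the two edges to a loose path.\<close>

lemma two_link_edges: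
  assumes pf: "Pfree H" and cf: "triangle_free H" and d: "distinct [c,p1,p2,q1,q2]"
    and E: "{c,p1,p2} \<in> H" "{c,q1,q2} \<in> H" and h: "h \<in> H" "card h = 3" "c \<notin> h"
  shows "(p1 \<in> h \<and> p2 \<in> h) \<or> (q1 \<in> h \<and> q2 \<in> h) \<or> h \<inter> {p1,p2,q1,q2} = {}"
proof (rule ccontr)
  assume n: "\<not> ?thesis"
  have alone: False if h': "distinct [c,p,p',q,q']" "{c,p,p'} \<in> H" "{c,q,q'} \<in> H" "p \<in> h" "p' \<notin> h" "q' \<notin> h" for p p' q q'
  proof (cases "q \<in> h")
    case True
    obtain r where r: "h = {p,q,r}" "r \<noteq> p" "r \<noteq> q" using card3_two_elems[OF h(2) h'(4) True] h'(1) by auto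
    have "{p,p',c} \<in> H" "{c,q',q} \<in> H" "{q,r,p} \<in> H" using h' h(1) r by (simp_all add: insert_commute)
    moreover have "distinct [p,p',c,q',q,r]" using h' h(3) r by auto
    ultimately show False using triangle_freeD[OF cf, of p p' c q' q r] by simp
  next
    case False
    obtain r s where r: "h = {p,r,s}" "p \<noteq> r" "p \<noteq> s" "r \<noteq> s" using card3_elem[OF h(2) h'(4)] by metis
    have "{r,s,p} \<in> H" "{p,p',c} \<in> H" "{c,q,q'} \<in> H" using h' h(1) r by (simp_all add: insert_commute)
    moreover have "distinct [r,s,p,p',c,q,q']" using h' h(3) r False by auto
    ultimately show False using PfreeD[OF pf, of r s p p' c q q'] by simp
  qed
  have E': "{c,p2,p1} \<in> H" "{c,q2,q1} \<in> H" using E by (simp_all add: insert_commute)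
  have ds: "distinct [c,p1,p2,q1,q2]" "distinct [c,p1,p2,q2,q1]" "distinct [c,p2,p1,q1,q2]" "distinct [c,p2,p1,q2,q1]"
    "distinct [c,q1,q2,p1,p2]" "distinct [c,q1,q2,p2,p1]" "distinct [c,q2,q1,p1,p2]" "distinct [c,q2,q1,p2,p1]" using d by auto
  have "p1 \<in> h \<or> p2 \<in> h \<or> q1 \<in> h \<or> q2 \<in> h" using n by blast
  then show False
    using alone[OF ds(1) E(1,2)] alone[OF ds(2) E(1) E'(2)] alone[OF ds(3) E'(1) E(2)] alone[OF ds(4) E'(1,2)]
      alone[OF ds(5) E(2,1)] alone[OF ds(6) E(2) E'(1)] alone[OF ds(7) E'(2) E(1)] alone[OF ds(8) E'(2,1)] n
    by blast
qed

text \<open>One non-terminal vertex gives two edges meeting only in some c; non-terminality of c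
  gives {c,w,v} and an edge h off c through v. By \<open>two_link_edges\<close> h contains a link
  pair. If v is the third vertex of h, a fan arises; if v is in the pair, a chain, or a fan in case
  the third vertex of h lies in the other link pair.\<close>

lemma chain_or_fan:
  assumes ts: "triple_system V H" and pf: "Pfree H" and cf: "triangle_free H"
    and V: "V \<noteq> {}" and nt: "\<And>z. z \<in> V \<Longrightarrow> \<not> terminal z H"
  obtains c a1 a2 b1 b2 u where "chain_config V H c a1 a2 b1 b2 u" | c u w a1 a2 where "fan_config V H c u w a1 a2"
proof -
  note chainI = that(1) and fanI = that(2)
  obtain z0 where "z0 \<in> V" using V by blast
  then obtain p1 p2 q1 q2 c where "distinct [p1,p2,c,q1,q2]" "{p1,p2,c} \<in> H" "{c,q1,q2} \<in> H"
    using not_terminal[OF ts nt] by metis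
  then have d: "distinct [c,p1,p2,q1,q2]" and E: "{c,p1,p2} \<in> H" "{c,q1,q2} \<in> H" by (auto simp: insert_commute)
  have "c \<in> V" using tsD(1)[OF ts E(1)] by simp
  then obtain w v r s where k: "distinct [c,w,v,r,s]" "{c,w,v} \<in> H" "{v,r,s} \<in> H"
    using not_terminal[OF ts nt] by metis
  define h where "h = {v,r,s}"
  have h: "h \<in> H" "card h = 3" "c \<notin> h" "v \<in> h" "w \<notin> h" using k tsD(2)[OF ts] unfolding h_def by auto
  have key: thesis if q: "distinct [c,p,p',q,q']" "{c,p,p'} \<in> H" "{c,q,q'} \<in> H" "p \<in> h" "p' \<in> h" for p p' q q'
  proof -
    obtain u where u: "h = {p,p',u}" "u \<noteq> p" "u \<noteq> p'" using card3_two_elems[OF h(2) q(4,5)] q(1) by auto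
    have uc: "u \<noteq> c" using u h by auto
    have fan: "fan_config V H c u y p p'" if y: "{c,u,y} \<in> H" "y \<noteq> u" "y \<noteq> c" "y \<notin> {p,p'}" for y
      by unfold_locales (use ts pf cf q u h y uc in \<open>auto simp: insert_commute\<close>)
    have chain: thesis if vp: "{c,x,w} \<in> H" "distinct [c,x,x',q,q']" "{c,x,x'} \<in> H" "{x,x'} = {p,p'}" for x x'
    proof (cases "u = q \<or> u = q'")
      case True
      then consider "u = q" | "u = q'" by blast
      then show ?thesis
      proof cases
        case 1
        have "fan_config V H c u q' p p'" by (rule fan) (use 1 q in \<open>auto simp: insert_commute\<close>)
        then show ?thesis by (rule fanI)
      next
        case 2
        have "fan_config V H c u q p p'" by (rule fan) (use 2 q in \<open>auto simp: insert_commute\<close>)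
        then show ?thesis by (rule fanI)
      qed
    next
      case False
      have xh: "x \<in> h" "x' \<in> h" "h = {x,x',u}" using vp(4) u(1) by (auto simp: doubleton_eq_iff)
      have xu: "u \<noteq> x" "u \<noteq> x'" using vp(4) u by (auto simp: doubleton_eq_iff)
      have wx: "w \<noteq> x" "w \<noteq> x'" "w \<noteq> u" using xh h(5) by auto
      have qh: "q \<notin> h" "q' \<notin> h" using xh(3) False vp(2) by auto
      \<comment> \<open>Otherwise {c,x,w} and {c,q,q'} meet only in c, while h contains x but none
        of w, q, q', against \<open>two_link_edges\<close>.\<close>
      have "w = q \<or> w = q'"
      proof (rule ccontr)
        assume "\<not> ?thesis"
        then have "distinct [c,x,w,q,q']" using vp(2) wx k(1) by auto
        from two_link_edges[OF pf cf this vp(1) q(3) h(1-3)] show False using h(5) qh xh(1) by blast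
      qed
      then obtain y where y: "{c,w,y} \<in> H" "y \<noteq> w" "y \<notin> h" "y \<noteq> c" "y \<noteq> x" "y \<noteq> x'"
      proof
        assume "w = q"
        then show thesis using that[of q'] q(3) vp(2) qh by auto
      next
        assume "w = q'"
        moreover have "{c,q',q} \<in> H" using q(3) by (simp add: insert_commute)
        ultimately show thesis using that[of q] vp(2) qh by auto
      qed
      have "chain_config V H c x x' w y u"
        by unfold_locales (use ts pf cf vp wx xu y xh uc k h in \<open>auto simp: insert_commute\<close>)
      then show ?thesis by (rule chainI)
    qed
    have "v = p \<or> v = p' \<or> v = u" using h(4) u by blast
    then consider "v = p" | "v = p'" | "v = u" by blast
    then show thesis
    proof cases
      case 1 show thesis by (rule chain[of p p']) (use 1 k q in \<open>auto simp: insert_commute\<close>)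
    next
      case 2 show thesis by (rule chain[of p' p]) (use 2 k q in \<open>auto simp: insert_commute\<close>)
    next
      case 3
      have "fan_config V H c u w p p'" by (rule fan) (use 3 k h u in \<open>auto simp: insert_commute\<close>)
      then show thesis by (rule fanI)
    qed
  qed
  from two_link_edges[OF pf cf d E h(1-3)] consider "p1 \<in> h" "p2 \<in> h" | "q1 \<in> h" "q2 \<in> h" | "h \<inter> {p1,p2,q1,q2} = {}" by blast
  then show thesis
  proof cases
    case 1 show thesis by (rule key[OF d E 1])
  next
    case 2
    have "distinct [c,q1,q2,p1,p2]" using d by auto
    then show thesis using key[OF _ E(2,1) 2] by simp
  next
    case 3
    have K: "{c,w,v} \<in> H" by (rule k(2))
    \<comment> \<open>If h misses both link pairs, comparing {c,w,v} with each of the two edges at c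
      puts w into both pairs, which are disjoint.\<close>
    have "w \<in> {p1,p2}"
    proof (rule ccontr)
      assume "w \<notin> {p1,p2}"
      moreover have "v \<notin> {p1,p2}" using 3 h(4) by blast
      ultimately have "distinct [c,w,v,p1,p2]" using d k(1) by auto
      from two_link_edges[OF pf cf this K E(1) h(1-3)] show False using h(4,5) 3 by blast
    qed
    moreover have "w \<in> {q1,q2}"
    proof (rule ccontr)
      assume "w \<notin> {q1,q2}"
      moreover have "v \<notin> {q1,q2}" using 3 h(4) by blast
      ultimately have "distinct [c,w,v,q1,q2]" using d k(1) by auto
      from two_link_edges[OF pf cf this K E(2) h(1-3)] show False using h(4,5) 3 by blast
    qed
    ultimately have False using d by auto
    then show thesis ..
  qed
qed

definition is_comet :: "'a set \<Rightarrow> 'a set set \<Rightarrow> bool" where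
  "is_comet V H \<longleftrightarrow> (\<exists>c S. c \<in> V \<and> S \<subseteq> V \<and> card S = 3 \<and> c \<notin> S \<and> H = comet_on c S V)"

theorem connected_bound:
  assumes ts: "triple_system V H" and pf: "Pfree H" and con: "connected_on V H" and m: "7 \<le> card V"
    and ns: "\<And>z. z \<in> V \<Longrightarrow> \<exists>e\<in>H. z \<notin> e"
  shows "card H \<le> conn_bd (card V) \<or> 13 \<le> card V \<and> is_comet V H"
proof (cases "\<exists>z\<in>V. terminal z H")
  case True
  then obtain z where z: "z \<in> V" "terminal z H" by blast
  then obtain g where g: "g \<in> H" "z \<notin> g" using ns by blast
  show ?thesis
  proof (cases "card V \<le> 12")
    case True then show ?thesis using nonstar_terminal_bound[OF ts pf con z g] root2_bd_le_conn_bd[OF m] by linarith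
  next
    case False
    show ?thesis
    proof (cases "4 + (card V - 4 choose 2) \<le> card H")
      case True then show ?thesis using terminal_extremal[OF ts pf con z g] False unfolding is_comet_def by simp
    next
      case le: False
      then have "card H \<le> conn_bd (card V)" using False unfolding conn_bd_def by simp
      then show ?thesis ..
    qed
  qed
next
  case False
  then have nt: "\<And>z. z \<in> V \<Longrightarrow> \<not> terminal z H" by blast
  have "card H \<le> conn_bd (card V)"
  proof (cases "triangle_free H")
    case True
    have "V \<noteq> {}" using m by auto
    from chain_or_fan[OF ts pf True this nt] show ?thesis
      using chain_config.chain_bound[OF _ con m] fan_config.fan_bound[OF _ con m] by metis
  next
    case False
    then obtain x1 x2 x3 y1 y2 y3 where "loose_triangle V H x1 x2 x3 y1 y2 y3" by (rule not_triangle_free[OF ts pf])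
    then show ?thesis using loose_triangle.loose_triangle_bound[OF _ con m] by blast
  qed
  then show ?thesis ..
qed

section \<open>Disconnected systems\<close>

lemma triples_ts: "finite A \<Longrightarrow> triple_system A (triples A)"
  unfolding triple_system_def triples_def by auto

lemma finite_triples: "finite A \<Longrightarrow> finite (triples A)"
  by (rule ts_finite(2)[OF triples_ts])

lemma card_triples: "finite A \<Longrightarrow> card (triples A) = card A choose 3"
  unfolding triples_def by (rule n_subsets)

lemma ts_subset_triples: "triple_system V H \<Longrightarrow> H \<subseteq> triples V"
  unfolding triple_system_def triples_def by auto

lemma ts_eq_triples:
  assumes "triple_system V H" "card V choose 3 \<le> card H"
  shows "H = triples V"
proof (rule card_seteq)
  show "finite (triples V)" using finite_triples ts_finite(1)[OF assms(1)] .
  show "H \<subseteq> triples V" by (rule ts_subset_triples[OF assms(1)])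
  show "card (triples V) \<le> card H" using card_triples[OF ts_finite(1)[OF assms(1)]] assms(2) by simp
qed

text \<open>Closed sets and their complements are interchangeable, so A can be the smaller side; if
  it has at most two vertices, they are isolated.\<close>

lemma disconnected_small_part:
  assumes ts: "triple_system V H" and "\<not> connected_on V H"
  obtains A where "A \<subseteq> V" "A \<noteq> {}" "closed_in H A" "card A \<le> card (V - A)" "card V = card A + card (V - A)"
    "card H = card {e \<in> H. e \<subseteq> A} + card {e \<in> H. e \<subseteq> V - A}"
proof -
  note fV = ts_finite(1)[OF ts]
  obtain A where A: "A \<subseteq> V" "A \<noteq> {}" "A \<noteq> V" "closed_in H A" using assms(2) unfolding connected_on_def by blast
  have B: "V - A \<subseteq> V" "V - A \<noteq> {}" "closed_in H (V - A)" "V - (V - A) = A"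
    using A closed_compl[OF ts A(4)] by auto
  show ?thesis
  proof (cases "card A \<le> card (V - A)")
    case True then show ?thesis using that[OF A(1,2,4)] card_parts[OF fV A(1)] card_split[OF ts A(4)] by simp
  next
    case False then show ?thesis using that[OF B(1-3)] card_parts[OF fV B(1)] card_split[OF ts B(3)] B(4) by simp
  qed
qed

lemma closed_small_isolated:
  assumes ts: "triple_system V H" and "A \<subseteq> V" "closed_in H A" "card A \<le> 2" "v \<in> A" "e \<in> H"
  shows "v \<notin> e"
proof
  assume "v \<in> e"
  then have "e \<subseteq> A" using assms unfolding closed_in_def by blast
  moreover have "finite A" using assms(2) ts_finite(1)[OF ts] finite_subset by blast
  ultimately have "card e \<le> card A" by (rule card_mono[rotated])
  then show False using tsD(2)[OF ts assms(6)] assms(4) by simp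
qed

lemma ts_remove_isolated:
  assumes "triple_system V H" "\<And>e. e \<in> H \<Longrightarrow> v \<notin> e"
  shows "triple_system (V - {v}) H"
  using assms unfolding triple_system_def by blast

text \<open>At seven vertices K6 with an isolated vertex beats the star, so containment in a
  six-vertex clique is a separate outcome. The 14 is one below the star.\<close>

lemma seven_vertices:
  assumes ts: "triple_system V H" and pf: "Pfree H" and V7: "card V = 7"
  shows "(\<exists>z\<in>V. \<forall>e\<in>H. z \<in> e) \<or> (\<exists>A\<subseteq>V. card A = 6 \<and> H \<subseteq> triples A) \<or> card H \<le> 14"
proof (cases "connected_on V H")
  case True
  show ?thesis
  proof (cases "\<exists>z\<in>V. \<forall>e\<in>H. z \<in> e")
    case False
    then show ?thesis using connected_bound[OF ts pf True] V7 by (auto simp: conn_bd_def)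
  qed simp
next
  case False
  note fV = ts_finite(1)[OF ts]
  obtain A where A: "A \<subseteq> V" "A \<noteq> {}" "closed_in H A" "card A \<le> card (V - A)" "card V = card A + card (V - A)"
    "card H = card {e \<in> H. e \<subseteq> A} + card {e \<in> H. e \<subseteq> V - A}"
    by (rule disconnected_small_part[OF ts False])
  show ?thesis
  proof (cases "card A \<le> 2")
    case True
    obtain v where v: "v \<in> A" using A(2) by blast
    have "triple_system (V - {v}) H" by (rule ts_remove_isolated[OF ts closed_small_isolated[OF ts A(1,3) True v]])
    then have "H \<subseteq> triples (V - {v})" by (rule ts_subset_triples)
    moreover have "card (V - {v}) = 6" using v A(1) V7 fV by (simp add: subsetD)
    ultimately show ?thesis by blast
  next
    case False
    then have c: "card A = 3" "card (V - A) = 4" using A(4,5) V7 by auto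
    have "card {e \<in> H. e \<subseteq> A} \<le> 1"
      using card_triple_system[OF ts_restrict[OF ts A(1)]] c by simp
    moreover have "card {e \<in> H. e \<subseteq> V - A} \<le> 4"
      using card_triple_system[OF ts_restrict[OF ts Diff_subset[of V A]]] c by (simp add: numeral_eq_Suc)
    ultimately show ?thesis using A(6) by simp
  qed
qed

text \<open>The ordinary Turan numbers of P: complete up to six vertices, K6 with an isolated vertex
  at seven, the star from eight on.\<close>

definition all_bd :: "nat \<Rightarrow> nat" where
  "all_bd n = (if n \<le> 6 then n choose 3 else if n = 7 then 20 else n - 1 choose 2)"

definition nonstar_bd :: "nat \<Rightarrow> nat" where
  "nonstar_bd n = (if n \<le> 12 then 20 + (n - 6 choose 3) else if n = 13 then 40 else 4 + (n - 4 choose 2))"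

lemma choose_3_vals: "(3 choose 3) = (1::nat)" "(4 choose 3) = (4::nat)" "(5 choose 3) = (10::nat)" "(6 choose 3) = (20::nat)"
  "(Suc 0 choose 3) = (0::nat)" "(2 choose 3) = (0::nat)"
  by (simp_all add: numeral_eq_Suc)

lemma nonstar_bd_vals: "nonstar_bd 8 = 20" "nonstar_bd 9 = 21" "nonstar_bd 10 = 24" "nonstar_bd 11 = 30" "nonstar_bd 12 = 40" "nonstar_bd 13 = 40" "nonstar_bd 14 = 49"
  by (simp_all add: nonstar_bd_def choose_3_vals choose_two)

lemma all_bd_vals: "all_bd 3 = 1" "all_bd 4 = 4" "all_bd 5 = 10" "all_bd 6 = 20" "all_bd 7 = 20" "all_bd 8 = 21" "all_bd 9 = 28" "all_bd 10 = 36"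
  by (simp_all add: all_bd_def choose_3_vals choose_two)

lemma nat_8_12_cases:
  assumes "8 \<le> (n::nat)" "n \<le> 12"
  obtains "n = 8" | "n = 9" | "n = 10" | "n = 11" | "n = 12"
  using assms by linarith

lemma conn_bd_less_nonstar_bd: "8 \<le> n \<Longrightarrow> conn_bd n < nonstar_bd n"
proof (cases "n \<le> 12")
  case True
  assume "8 \<le> n"
  from this True show ?thesis by (cases rule: nat_8_12_cases) (simp_all add: nonstar_bd_vals conn_bd_def)
next
  case False then show ?thesis by (simp add: nonstar_bd_def conn_bd_def choose_two)
qed

lemma nonstar_bd_less_star: "8 \<le> n \<Longrightarrow> nonstar_bd n < (n - 1 choose 2)"
proof (cases "n \<le> 13")
  case True
  assume "8 \<le> n"
  with True consider "n = 8" | "n = 9" | "n = 10" | "n = 11" | "n = 12" | "n = 13" by linarith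
  then show ?thesis by cases (simp_all add: nonstar_bd_vals choose_two)
next
  case False
  define j where "j = n - 4"
  have "n = Suc (Suc (Suc (Suc j)))" "10 \<le> j" using False j_def by auto
  then show ?thesis by (simp add: nonstar_bd_def choose_two_Suc)
qed

text \<open>So an isolated vertex rules out extremality among larger systems, except in passing from
  12 to 13, where two copies of K6 keep their 40 edges.\<close>

lemma nonstar_bd_Suc: "8 \<le> n \<Longrightarrow> nonstar_bd n \<le> nonstar_bd (Suc n) \<and> (n \<noteq> 12 \<longrightarrow> nonstar_bd n < nonstar_bd (Suc n))"
proof (cases "n \<le> 13")
  case True
  assume "8 \<le> n"
  with True consider "n = 8" | "n = 9" | "n = 10" | "n = 11" | "n = 12" | "n = 13" by linarith
  then show ?thesis by cases (simp_all add: nonstar_bd_def choose_3_vals choose_two)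
next
  case False
  define j where "j = n - 4"
  have "n = Suc (Suc (Suc (Suc j)))" "10 \<le> j" using False j_def by auto
  then show ?thesis by (simp add: nonstar_bd_def choose_two_Suc)
qed

lemma all_bd_superadd_large:
  assumes "3 \<le> a" "8 \<le> b"
  shows "all_bd a + all_bd b < nonstar_bd (a + b)"
proof (cases "a + b \<le> 13")
  case True
  then consider "a = 3" "b = 8" | "a = 3" "b = 9" | "a = 3" "b = 10" | "a = 4" "b = 8" | "a = 4" "b = 9" | "a = 5" "b = 8"
    using assms by linarith
  then show ?thesis by cases (simp_all add: all_bd_vals nonstar_bd_vals)
next
  case False
  have F: "all_bd b = (b - 1 choose 2)" using assms by (simp add: all_bd_def)
  have f: "nonstar_bd (a + b) = 4 + (a + b - 4 choose 2)" using False by (simp add: nonstar_bd_def)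
  \<comment> \<open>This splitting exposes the star value of b; the cross term, at least 7 (a - 3),
    helps to absorb \<open>all_bd a\<close>.\<close>
  have "a - 3 + (b - 1) = a + b - 4" using assms by simp
  then have s: "(a + b - 4 choose 2) = (a - 3 choose 2) + (b - 1 choose 2) + (a - 3) * (b - 1)"
    using choose_two_add[of "a - 3" "b - 1"] by simp
  have p: "(a - 3) * 7 \<le> (a - 3) * (b - 1)" by (intro mult_le_mono2) (use assms in linarith)
  have "all_bd a < 4 + (a - 3 choose 2) + (a - 3) * 7"
  proof (cases "a \<le> 7")
    case True
    then consider "a = 3" | "a = 4" | "a = 5" | "a = 6" | "a = 7" using assms by linarith
    then show ?thesis by cases (simp_all add: all_bd_vals choose_two)
  next
    case False
    define j where "j = a - 3"
    have "a = Suc (Suc (Suc j))" "5 \<le> j" using False j_def by auto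
    then show ?thesis by (simp add: all_bd_def choose_two_Suc)
  qed
  then show ?thesis using F f s p by linarith
qed

text \<open>The equality cases are the extremal splits: K6 beside a clique on three to six vertices,
  or K6 beside seven vertices that again hold a K6.\<close>

lemma all_bd_superadd_small:
  assumes "3 \<le> a" "a \<le> b" "b \<le> 7" "8 \<le> a + b"
  shows "all_bd a + all_bd b \<le> nonstar_bd (a + b)" "all_bd a + all_bd b = nonstar_bd (a + b) \<Longrightarrow> b = 6 \<or> a = 6 \<and> b = 7"
proof -
  have "a = 3 \<or> a = 4 \<or> a = 5 \<or> a = 6 \<or> a = 7" "b = 4 \<or> b = 5 \<or> b = 6 \<or> b = 7" using assms by linarith+
  then have "all_bd a + all_bd b \<le> nonstar_bd (a + b) \<and> (all_bd a + all_bd b = nonstar_bd (a + b) \<longrightarrow> b = 6 \<or> a = 6 \<and> b = 7)"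
    using assms by (elim disjE) (simp_all add: all_bd_vals nonstar_bd_vals)
  then show "all_bd a + all_bd b \<le> nonstar_bd (a + b)" "all_bd a + all_bd b = nonstar_bd (a + b) \<Longrightarrow> b = 6 \<or> a = 6 \<and> b = 7" by auto
qed

definition extremal :: "nat set \<Rightarrow> nat set set \<Rightarrow> bool" where
  "extremal V H \<longleftrightarrow>
     card V \<le> 12 \<and> (\<exists>A\<subseteq>V. card A = 6 \<and> H = triples A \<union> triples (V - A)) \<or>
     card V = 13 \<and> (\<exists>A\<subseteq>V. \<exists>B\<subseteq>V. A \<inter> B = {} \<and> card A = 6 \<and> card B = 6 \<and> H = triples A \<union> triples B) \<or>
     13 \<le> card V \<and> is_comet V H"

text \<open>The parts of a split may be stars, so they need a bound for all P-free systems. The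
  assumption \<open>main\<close> is where the induction hypothesis of \<open>nonstar_bound\<close>
  enters.\<close>

lemma card_le_all_bd:
  fixes V :: "nat set"
  assumes ts: "triple_system V H" and pf: "Pfree H"
    and main: "8 \<le> card V \<Longrightarrow> (\<And>z. z \<in> V \<Longrightarrow> \<exists>e\<in>H. z \<notin> e) \<Longrightarrow> card H \<le> nonstar_bd (card V)"
  shows "card H \<le> all_bd (card V)"
proof -
  note fV = ts_finite(1)[OF ts]
  consider "card V \<le> 6" | "card V = 7" | "8 \<le> card V" by linarith
  then show ?thesis
  proof cases
    case 1 then show ?thesis using card_triple_system[OF ts] by (simp add: all_bd_def)
  next
    case 2
    from seven_vertices[OF ts pf 2] consider z where "z \<in> V" "\<forall>e\<in>H. z \<in> e" | A where "A \<subseteq> V" "card A = 6" "H \<subseteq> triples A"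
      | "card H \<le> 14" by blast
    then have "card H \<le> 20"
    proof cases
      case (1 z) then show ?thesis using card_star[OF ts 1] 2 by (simp add: choose_two)
    next
      case (2 A)
      have fA: "finite A" using 2(1) fV finite_subset by blast
      show ?thesis using card_mono[OF finite_triples[OF fA] 2(3)] card_triples[OF fA] 2(2) by (simp add: choose_3_vals)
    qed simp
    then show ?thesis using 2 by (simp add: all_bd_vals)
  next
    case 3
    show ?thesis
    proof (cases "\<exists>z\<in>V. \<forall>e\<in>H. z \<in> e")
      case True
      then obtain z where "z \<in> V" "\<forall>e\<in>H. z \<in> e" by blast
      then show ?thesis using card_star[OF ts] 3 by (simp add: all_bd_def)
    next
      case False
      then have "card H \<le> nonstar_bd (card V)" using main 3 by blast
      then show ?thesis using nonstar_bd_less_star[OF 3] 3 by (simp add: all_bd_def)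
    qed
  qed
qed

text \<open>Small closed parts are treated by removing an isolated vertex, because the
  superadditivity lemmas start at three vertices per part. Connected systems are settled without the
  induction.\<close>

theorem nonstar_bound:
  assumes "triple_system V H" "Pfree H" "8 \<le> card V" "\<And>z. z \<in> V \<Longrightarrow> \<exists>e\<in>H. z \<notin> e"
  shows "card H \<le> nonstar_bd (card V) \<and> (card H = nonstar_bd (card V) \<longrightarrow> extremal V (H :: nat set set))"
  using assms
proof (induction "card V" arbitrary: V H rule: less_induct)
  case less
  note ts = less.prems(1) and pf = less.prems(2) and n8 = less.prems(3) and ns = less.prems(4)
  note fV = ts_finite(1)[OF ts]
  show ?case
  proof (cases "connected_on V H")
    case True
    have "7 \<le> card V" using n8 by simp
    from connected_bound[OF ts pf True this ns] show ?thesis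
    proof
      assume "card H \<le> conn_bd (card V)"
      then show ?thesis using conn_bd_less_nonstar_bd[OF n8] by linarith
    next
      assume c: "13 \<le> card V \<and> is_comet V H"
      then have "card H = 4 + (card V - 4 choose 2)" using card_comet_on[OF fV] unfolding is_comet_def by blast
      moreover have "nonstar_bd (card V) = 4 + (card V - 4 choose 2)" using c by (simp add: nonstar_bd_def choose_two)
      ultimately show ?thesis using c unfolding extremal_def by simp
    qed
  next
    case False
    obtain A where A: "A \<subseteq> V" "A \<noteq> {}" "closed_in H A" "card A \<le> card (V - A)" "card V = card A + card (V - A)"
      "card H = card {e \<in> H. e \<subseteq> A} + card {e \<in> H. e \<subseteq> V - A}"
      by (rule disconnected_small_part[OF ts False])
    show ?thesis
    proof (cases "card A \<le> 2")
      case True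
      obtain v where v: "v \<in> A" using A(2) by blast
      then have vV: "v \<in> V" using A(1) by blast
      let ?V = "V - {v}"
      have ts': "triple_system ?V H" by (rule ts_remove_isolated[OF ts closed_small_isolated[OF ts A(1,3) True v]])
      have cV: "card ?V = card V - 1" using vV fV by simp
      show ?thesis
      \<comment> \<open>Without the isolated vertex seven vertices remain, below the range of the
        induction hypothesis.\<close>
      proof (cases "card V = 8")
        case True
        then have "card ?V = 7" using cV by simp
        then consider B where "B \<subseteq> ?V" "card B = 6" "H \<subseteq> triples B" | "card H \<le> 14"
          using seven_vertices[OF ts' pf] ns by blast
        then show ?thesis
        proof cases
          case (1 B)
          have BV: "B \<subseteq> V" using 1 by blast
          then have fB: "finite B" using fV finite_subset by blast
          have cB: "card (triples B) = 20" using card_triples[OF fB] 1(2) by (simp add: choose_3_vals)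
          have le: "card H \<le> 20" using card_mono[OF finite_triples[OF fB] 1(3)] cB by simp
          have "extremal V H" if "card H = 20"
          proof -
            have "H = triples B" using card_seteq[OF finite_triples[OF fB] 1(3)] cB that by simp
            moreover have "triples (V - B) = {}"
            proof -
              have "card (V - B) = 2" using card_parts[OF fV BV] True 1(2) by simp
              then have "card (triples (V - B)) = 0" using card_triples[of "V - B"] fV by (simp add: choose_3_vals)
              then show ?thesis using finite_triples[of "V - B"] fV by simp
            qed
            ultimately have "H = triples B \<union> triples (V - B)" by simp
            then show ?thesis using BV 1(2) True unfolding extremal_def by auto
          qed
          then show ?thesis using le True by (simp add: nonstar_bd_vals)
        next
          case 2 then show ?thesis using True by (simp add: nonstar_bd_vals)
        qed
      next
        case False
        then have c8: "8 \<le> card ?V" "Suc (card ?V) = card V" using n8 cV by auto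
        have lt: "card ?V < card V" using c8 by simp
        have "\<exists>e\<in>H. z \<notin> e" if "z \<in> ?V" for z using ns that by blast
        then have IH: "card H \<le> nonstar_bd (card ?V)" "card H = nonstar_bd (card ?V) \<Longrightarrow> extremal ?V H"
          using less.hyps[OF lt ts' pf c8(1)] by auto
        note s = nonstar_bd_Suc[OF c8(1), unfolded c8(2)]
        have "extremal V H" if eq: "card H = nonstar_bd (card V)"
        proof -
          have 12: "card ?V = 12" using IH(1) s eq by linarith
          then have "nonstar_bd (card ?V) = nonstar_bd (card V)" using c8(2) by (simp add: nonstar_bd_vals flip: c8(2))
          then have "extremal ?V H" using IH(2) eq by simp
          then obtain B where B: "B \<subseteq> ?V" "card B = 6" "H = triples B \<union> triples (?V - B)" unfolding extremal_def using 12 by auto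
          have "card (?V - B) = 6" using card_parts[OF _ B(1)] fV 12 B(2) by simp
          moreover have "card V = 13" using 12 c8(2) by simp
          moreover have "B \<subseteq> V" "?V - B \<subseteq> V" "B \<inter> (?V - B) = {}" using B(1) by auto
          ultimately show ?thesis using B unfolding extremal_def by blast
        qed
        then show ?thesis using IH(1) s by linarith
      qed
    next
      case False
      let ?B = "V - A"
      let ?HA = "{e \<in> H. e \<subseteq> A}" and ?HB = "{e \<in> H. e \<subseteq> ?B}"
      have BV: "?B \<subseteq> V" by simp
      have tsA: "triple_system A ?HA" and tsB: "triple_system ?B ?HB" by (rule ts_restrict[OF ts A(1)], rule ts_restrict[OF ts BV])
      have pfA: "Pfree ?HA" and pfB: "Pfree ?HB" by (rule Pfree_subset[OF pf], simp)+
      have lt: "card A < card V" "card ?B < card V" using A(4,5) False by linarith+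
      have FA: "card ?HA \<le> all_bd (card A)" using less.hyps[OF lt(1) tsA pfA] by (intro card_le_all_bd[OF tsA pfA]) blast
      have FB: "card ?HB \<le> all_bd (card ?B)" using less.hyps[OF lt(2) tsB pfB] by (intro card_le_all_bd[OF tsB pfB]) blast
      have a3: "3 \<le> card A" using False by simp
      have HAB: "H = ?HA \<union> ?HB"
        using A(3) tsD(1)[OF ts] unfolding closed_in_def by blast
      show ?thesis
      proof (cases "8 \<le> card ?B")
        case True
        then show ?thesis using all_bd_superadd_large[OF a3 True] FA FB A(5,6) by simp
      next
        case b7: False
        then have b7: "card ?B \<le> 7" by simp
        have n8': "8 \<le> card A + card ?B" using n8 A(5) by simp
        note sm = all_bd_superadd_small[OF a3 A(4) b7 n8']
        have le: "card H \<le> nonstar_bd (card V)" using sm(1) FA FB A(5,6) by simp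
        have "extremal V H" if eq: "card H = nonstar_bd (card V)"
        proof -
          have eqs: "card ?HA = all_bd (card A)" "card ?HB = all_bd (card ?B)" "all_bd (card A) + all_bd (card ?B) = nonstar_bd (card A + card ?B)"
            using eq sm(1) FA FB A(5,6) by simp_all
          then have cs: "card ?B = 6 \<or> card A = 6 \<and> card ?B = 7" using sm(2) by blast
          then have a6: "card A \<le> 6" using A(4) by auto
          then have tA: "?HA = triples A" using ts_eq_triples[OF tsA] eqs(1) by (simp add: all_bd_def)
          show ?thesis
          proof (cases "card ?B = 6")
            case True
            then have tB: "?HB = triples ?B" using ts_eq_triples[OF tsB] eqs(2) by (simp add: all_bd_def)
            have "V - ?B = A" using A(1) by blast
            then have "H = triples ?B \<union> triples (V - ?B)" using HAB tA tB by auto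
            moreover have "card V \<le> 12" using a6 True A(5) by simp
            ultimately show ?thesis using True BV unfolding extremal_def by blast
          next
            case False
            then have c: "card A = 6" "card ?B = 7" using cs by auto
            \<comment> \<open>Twenty edges on seven vertices exceed the 15 of a star, so they fill a
              K6 and leave one vertex isolated.\<close>
            have hb: "card ?HB = 20" using eqs(2) c by (simp add: all_bd_vals)
            have "\<not> (\<exists>z\<in>?B. \<forall>e\<in>?HB. z \<in> e)"
            proof
              assume "\<exists>z\<in>?B. \<forall>e\<in>?HB. z \<in> e"
              then obtain z where "z \<in> ?B" "\<forall>e\<in>?HB. z \<in> e" by blast
              then have "card ?HB \<le> card ?B - 1 choose 2" by (rule card_star[OF tsB])
              then show False using hb c by (simp add: choose_two)
            qed
            then obtain C where C: "C \<subseteq> ?B" "card C = 6" "?HB \<subseteq> triples C"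
              using seven_vertices[OF tsB pfB c(2)] hb by auto
            have fC: "finite C" using C(1) fV finite_subset by blast
            have "?HB = triples C"
              by (rule card_seteq[OF finite_triples[OF fC] C(3)]) (use card_triples[OF fC] C(2) hb in \<open>simp add: choose_3_vals\<close>)
            then have "H = triples A \<union> triples C" using HAB tA by simp
            moreover have "A \<inter> C = {}" "C \<subseteq> V" using C(1) by auto
            moreover have "card V = 13" using c A(5) by simp
            ultimately show ?thesis using A(1) c(1) C(2) unfolding extremal_def by blast
          qed
        qed
        then show ?thesis using le by blast
      qed
    qed
  qed
qed

section \<open>Extremal systems and isomorphism classes\<close>

lemma hg3_ts: "hg3 n H \<longleftrightarrow> triple_system {..<n} H"
  unfolding hg3_def triple_system_def by simp

definition full_star :: "nat \<Rightarrow> nat set \<Rightarrow> nat set set" where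
  "full_star z V = {e \<in> triples V. z \<in> e}"

lemma card_full_star:
  assumes "finite V" "z \<in> V"
  shows "card (full_star z V) = card V - 1 choose 2"
proof -
  let ?Y = "{p. p \<subseteq> V - {z} \<and> card p = 2}"
  have inj: "inj_on (insert z) ?Y"
  proof (rule inj_onI)
    fix p q assume "p \<in> ?Y" "q \<in> ?Y" "insert z p = insert z q"
    moreover from this have "z \<notin> p" "z \<notin> q" by auto
    ultimately show "p = q" by (metis Diff_insert_absorb)
  qed
  have "full_star z V = insert z ` ?Y"
  proof (intro equalityI subsetI)
    fix e assume "e \<in> full_star z V"
    then have e: "e \<subseteq> V" "card e = 3" "z \<in> e" unfolding full_star_def triples_def by auto
    then have "e - {z} \<subseteq> V - {z}" "card (e - {z}) = 2" "e = insert z (e - {z})" by (auto simp: card_Diff_singleton)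
    then show "e \<in> insert z ` ?Y" by blast
  next
    fix e assume "e \<in> insert z ` ?Y"
    then obtain p where p: "p \<subseteq> V - {z}" "card p = 2" "e = insert z p" by blast
    have "finite p" using p(1) assms(1) finite_subset by blast
    moreover have "z \<notin> p" using p(1) by blast
    ultimately have "card e = 3" using p by simp
    then show "e \<in> full_star z V" using p assms(2) unfolding full_star_def triples_def by auto
  qed
  then have "card (full_star z V) = card ?Y" using card_image[OF inj] by simp
  also have "\<dots> = card (V - {z}) choose 2" using assms(1) by (intro n_subsets) simp
  finally show ?thesis using assms by simp
qed

lemma full_star_ts: "finite V \<Longrightarrow> triple_system V (full_star z V)"
  unfolding full_star_def by (rule ts_subset[OF triples_ts]) auto

lemma Pfree_star: "(\<And>e. e \<in> H \<Longrightarrow> z \<in> e) \<Longrightarrow> Pfree H"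
proof (rule PfreeI)
  fix a b c d e f g
  assume st: "\<And>e. e \<in> H \<Longrightarrow> z \<in> e" and d: "distinct [a,b,c,d,e,f,g]" and "{a,b,c} \<in> H" "{e,f,g} \<in> H"
  then have "z \<in> {a,b,c}" "z \<in> {e,f,g}" by blast+
  then show False using d by auto
qed

text \<open>Consecutive edges of P intersect, so all its seven vertices would lie in one clique on
  at most six.\<close>

lemma Pfree_two_cliques:
  assumes "A \<inter> B = {}" "finite A" "finite B" "card A \<le> 6" "card B \<le> 6"
  shows "Pfree (triples A \<union> triples B)"
proof (rule PfreeI)
  fix a b c d e f g
  assume d: "distinct [a,b,c,d,e,f,g]"
    and h: "{a,b,c} \<in> triples A \<union> triples B" "{c,d,e} \<in> triples A \<union> triples B" "{e,f,g} \<in> triples A \<union> triples B"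
  have "x \<subseteq> A \<or> x \<subseteq> B" if "x \<in> triples A \<union> triples B" for x using that unfolding triples_def by blast
  from this[OF h(1)] this[OF h(2)] this[OF h(3)]
  have "{a,b,c,d,e,f,g} \<subseteq> A \<or> {a,b,c,d,e,f,g} \<subseteq> B" using assms(1) by auto
  moreover have "card {a,b,c,d,e,f,g} = 7" using d by simp
  ultimately show False using card_mono[OF assms(2), of "{a,b,c,d,e,f,g}"] card_mono[OF assms(3), of "{a,b,c,d,e,f,g}"] assms(4,5)
    by linarith
qed

text \<open>One end edge of a loose path misses c and is therefore S itself. The middle edge then
  meets S in exactly one vertex, which no edge of the comet does.\<close>

lemma Pfree_comet:
  assumes S: "card S = 3" "c \<notin> S"
  shows "Pfree (comet_on c S V)"
proof (rule PfreeI)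
  fix a b x d e f g
  assume d: "distinct [a,b,x,d,e,f,g]"
    and h: "{a,b,x} \<in> comet_on c S V" "{x,d,e} \<in> comet_on c S V" "{e,f,g} \<in> comet_on c S V"
  have fS: "finite S" using S(1) by (metis card.infinite zero_neq_numeral)
  have end_edge: "h1 = S" if "h1 \<in> comet_on c S V" "c \<notin> h1" for h1
  proof -
    have "h1 \<subseteq> S" "card h1 = 3" using that unfolding comet_on_def by auto
    then show ?thesis using card_seteq[OF fS] S by simp
  qed
  have mid: False if h2: "h2 \<in> comet_on c S V" "\<exists>v. h2 \<inter> S = {v}" for h2
  proof -
    obtain v where v: "h2 \<inter> S = {v}" using h2(2) by blast
    have "card h2 = 3" "h2 \<subseteq> insert c S" using h2(1) v unfolding comet_on_def by auto
    then have "h2 \<subseteq> {c,v}" using v by blast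
    then have "card h2 \<le> card {c,v}" by (intro card_mono) auto
    also have "\<dots> \<le> 2" by (simp add: card_insert_if)
    finally show False using \<open>card h2 = 3\<close> by simp
  qed
  have "c \<notin> {a,b,x} \<or> c \<notin> {e,f,g}" using d by auto
  then show False
  proof
    assume "c \<notin> {a,b,x}"
    then have "{a,b,x} = S" using end_edge h(1) by blast
    then have "{x,d,e} \<inter> S = {x}" using d by auto
    then show False using mid[OF h(2)] by blast
  next
    assume "c \<notin> {e,f,g}"
    then have "{e,f,g} = S" using end_edge h(3) by blast
    then have "{x,d,e} \<inter> S = {e}" using d by auto
    then show False using mid[OF h(2)] by blast
  qed
qed

lemma card3_subset_ex:
  assumes "3 \<le> card A"
  obtains e where "e \<in> triples A"
  using obtain_subset_with_card_n[OF assms] unfolding triples_def by blast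

lemma nonstar_clique:
  assumes "triples A \<subseteq> H" "4 \<le> card A"
  shows "\<exists>e\<in>H. z \<notin> e"
proof -
  have "3 \<le> card (A - {z})" using assms(2) by (cases "z \<in> A") (auto simp: card_Diff_singleton)
  then obtain e where "e \<in> triples (A - {z})" by (rule card3_subset_ex)
  then have "e \<in> triples A" "z \<notin> e" unfolding triples_def by auto
  then show ?thesis using assms(1) by blast
qed

lemma comet_on_subset_clique: "insert c S \<subseteq> V \<Longrightarrow> triples (insert c S) \<subseteq> comet_on c S V"
  unfolding triples_def comet_on_def by auto

lemma hg3_finite: "finite {f H | H. hg3 n H \<and> Q H}"
proof -
  have "{H. hg3 n H} \<subseteq> Pow (Pow {..<n})" unfolding hg3_def by auto
  then have "finite {H. hg3 n H}" by (rule finite_subset) simp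
  then show ?thesis by simp
qed

section \<open>First-order extremal families\<close>

lemma ex1_Ex1_7: "ex1 7 = 20" "Ex1 7 = {triples A | A. A \<subseteq> {..<7} \<and> card A = 6}"
proof -
  have cl: "hg3 7 (triples A) \<and> Pfree (triples A) \<and> card (triples A) = 20" if "A \<subseteq> {..<7}" "card A = 6" for A
  proof -
    have fA: "finite A" using that(1) finite_subset by blast
    have "Pfree (triples A \<union> triples {})" by (rule Pfree_two_cliques) (use fA that in auto)
    moreover have "triples {} = {}" unfolding triples_def by auto
    moreover have "hg3 7 (triples A)" using that(1) unfolding hg3_def triples_def by auto
    ultimately show ?thesis using card_triples[OF fA] that(2) by (simp add: choose_3_vals)
  qed
  have b: "card H \<le> 20 \<and> (card H = 20 \<longrightarrow> (\<exists>A\<subseteq>{..<7}. card A = 6 \<and> H = triples A))" if H: "hg3 7 H" "Pfree H" for H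
  proof -
    have ts: "triple_system {..<7} H" using H(1) hg3_ts by simp
    have "card {..<7::nat} = 7" by simp
    from seven_vertices[OF ts H(2) this] consider z where "z \<in> {..<7}" "\<forall>e\<in>H. z \<in> e"
      | A where "A \<subseteq> {..<7}" "card A = 6" "H \<subseteq> triples A" | "card H \<le> 14" by blast
    then show ?thesis
    proof cases
      case (1 z) then show ?thesis using card_star[OF ts 1] by (simp add: choose_two)
    next
      case (2 A)
      then have fA: "finite A" using finite_subset by blast
      have c: "card (triples A) = 20" using cl 2 by blast
      then have "card H \<le> 20" using card_mono[OF finite_triples[OF fA] 2(3)] by simp
      moreover have "card H = 20 \<Longrightarrow> H = triples A" using card_seteq[OF finite_triples[OF fA] 2(3)] c by simp
      ultimately show ?thesis using 2 by blast
    qed simp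
  qed
  show e: "ex1 7 = 20" unfolding ex1_def
  proof (rule Max_eqI)
    show "finite {card H | H. hg3 7 H \<and> Pfree H}" by (rule hg3_finite)
    show "y \<le> 20" if "y \<in> {card H | H. hg3 7 H \<and> Pfree H}" for y using that b by auto
    have "{..<6} \<subseteq> {..<7::nat}" "card {..<6::nat} = 6" by auto
    from cl[OF this] show "20 \<in> {card H | H. hg3 7 H \<and> Pfree H}" by force
  qed
  show "Ex1 7 = {triples A | A. A \<subseteq> {..<7} \<and> card A = 6}"
    unfolding Ex1_def e using b cl by blast
qed

lemma full_star_facts:
  assumes "z < n"
  shows "hg3 n (full_star z {..<n})" "Pfree (full_star z {..<n})" "card (full_star z {..<n}) = n - 1 choose 2"
proof -
  show "hg3 n (full_star z {..<n})" using full_star_ts hg3_ts by simp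
  show "Pfree (full_star z {..<n})" by (rule Pfree_star[of _ z]) (auto simp: full_star_def)
  show "card (full_star z {..<n}) = n - 1 choose 2" using card_full_star[of "{..<n}" z] assms by simp
qed

lemma subset_full_star: "triple_system V H \<Longrightarrow> \<forall>e\<in>H. z \<in> e \<Longrightarrow> H \<subseteq> full_star z V"
  unfolding full_star_def using ts_subset_triples by blast

text \<open>Makes the second-order condition concrete: from eight vertices on, not lying in a
  first-order extremal system means that no vertex is common to all edges.\<close>

lemma Ex1_large:
  assumes "8 \<le> n" and H: "hg3 n H" "Pfree H"
  shows "(\<exists>G\<in>Ex1 n. H \<subseteq> G) \<longleftrightarrow> (\<exists>z<n. \<forall>e\<in>H. z \<in> e)"
proof -
  have b: "card H \<le> (n - 1 choose 2) \<and> (card H = (n - 1 choose 2) \<longrightarrow> (\<exists>z<n. \<forall>e\<in>H. z \<in> e))" if H: "hg3 n H" "Pfree H" for H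
  proof (cases "\<exists>z<n. \<forall>e\<in>H. z \<in> e")
    case True
    then obtain z where "z \<in> {..<n}" "\<forall>e\<in>H. z \<in> e" by auto
    then show ?thesis using card_star[of "{..<n}" H z] H(1) True unfolding hg3_ts by simp
  next
    case False
    have "card H \<le> nonstar_bd n" using nonstar_bound[of "{..<n}" H] H False assms(1) unfolding hg3_ts by auto
    then show ?thesis using nonstar_bd_less_star[OF assms(1)] by linarith
  qed
  have n0: "0 < n" using assms(1) by simp
  have e: "ex1 n = n - 1 choose 2" unfolding ex1_def
  proof (rule Max_eqI)
    show "finite {card H | H. hg3 n H \<and> Pfree H}" by (rule hg3_finite)
    show "y \<le> n - 1 choose 2" if "y \<in> {card H | H. hg3 n H \<and> Pfree H}" for y using that b by auto
    show "n - 1 choose 2 \<in> {card H | H. hg3 n H \<and> Pfree H}" using full_star_facts[OF n0] by force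
  qed
  show ?thesis
  proof
    assume "\<exists>G\<in>Ex1 n. H \<subseteq> G"
    then obtain G where "hg3 n G" "Pfree G" "card G = n - 1 choose 2" "H \<subseteq> G" unfolding Ex1_def e by blast
    then show "\<exists>z<n. \<forall>e\<in>H. z \<in> e" using b[of G] by blast
  next
    assume "\<exists>z<n. \<forall>e\<in>H. z \<in> e"
    then obtain z where z: "z < n" "\<forall>e\<in>H. z \<in> e" by blast
    have "H \<subseteq> full_star z {..<n}" using subset_full_star z(2) H(1) hg3_ts by blast
    moreover have "full_star z {..<n} \<in> Ex1 n" unfolding Ex1_def e using full_star_facts[OF z(1)] by simp
    ultimately show "\<exists>G\<in>Ex1 n. H \<subseteq> G" by blast
  qed
qed

lemma ex2_Ex2_eqI:
  assumes sound: "\<And>H. H \<in> F \<Longrightarrow> hg3 n H \<and> Pfree H \<and> \<not> (\<exists>G\<in>Ex1 n. H \<subseteq> G) \<and> card H = k"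
    and upper: "\<And>H. hg3 n H \<Longrightarrow> Pfree H \<Longrightarrow> \<not> (\<exists>G\<in>Ex1 n. H \<subseteq> G) \<Longrightarrow> card H \<le> k \<and> (card H = k \<longrightarrow> H \<in> F)"
    and ne: "F \<noteq> {}"
  shows "ex2 n = k \<and> Ex2 n = F"
proof -
  have e: "ex2 n = k" unfolding ex2_def
  proof (rule Max_eqI)
    show "finite {card H | H. hg3 n H \<and> Pfree H \<and> \<not> (\<exists>G\<in>Ex1 n. H \<subseteq> G)}" by (rule hg3_finite)
    show "y \<le> k" if "y \<in> {card H | H. hg3 n H \<and> Pfree H \<and> \<not> (\<exists>G\<in>Ex1 n. H \<subseteq> G)}" for y
      using that upper by auto
    obtain H where "H \<in> F" using ne by blast
    then show "k \<in> {card H | H. hg3 n H \<and> Pfree H \<and> \<not> (\<exists>G\<in>Ex1 n. H \<subseteq> G)}" using sound[of H] by auto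
  qed
  moreover have "Ex2 n = F" unfolding Ex2_def e using sound upper by blast
  ultimately show ?thesis ..
qed

text \<open>Two prescribed disjoint sets cover every use: two cliques, the centre and S of a comet,
  or the centre of a star with empty B.\<close>

lemma ex_bij_extending:
  fixes V :: "nat set"
  assumes fV: "finite V" and A: "A \<union> B \<subseteq> V" "A \<inter> B = {}" and A': "A' \<union> B' \<subseteq> V" "A' \<inter> B' = {}"
    and c: "card A = card A'" "card B = card B'"
  shows "\<exists>\<sigma>. bij_betw \<sigma> V V \<and> \<sigma> ` A = A' \<and> \<sigma> ` B = B'"
proof -
  have fin: "finite A" "finite B" "finite A'" "finite B'" using A(1) A'(1) fV finite_subset by auto
  have un: "card (A \<union> B) = card (A' \<union> B')" using c card_Un_disjoint[OF fin(1,2) A(2)] card_Un_disjoint[OF fin(3,4) A'(2)] by simp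
  then have cc: "card (V - (A \<union> B)) = card (V - (A' \<union> B'))"
    using card_parts[OF fV A(1)] card_parts[OF fV A'(1)] by linarith
  obtain f where f: "bij_betw f A A'" using finite_same_card_bij[OF fin(1,3) c(1)] by blast
  obtain g where g: "bij_betw g B B'" using finite_same_card_bij[OF fin(2,4) c(2)] by blast
  obtain h where h: "bij_betw h (V - (A \<union> B)) (V - (A' \<union> B'))" using finite_same_card_bij[OF _ _ cc] fV by auto
  define \<sigma> where "\<sigma> x = (if x \<in> A then f x else if x \<in> B then g x else h x)" for x
  have sA: "bij_betw \<sigma> A A'" using f by (rule bij_betw_cong[THEN iffD1, rotated]) (simp add: \<sigma>_def)
  have sB: "bij_betw \<sigma> B B'" using g by (rule bij_betw_cong[THEN iffD1, rotated]) (use A(2) in \<open>auto simp: \<sigma>_def\<close>)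
  have sC: "bij_betw \<sigma> (V - (A \<union> B)) (V - (A' \<union> B'))"
    using h by (rule bij_betw_cong[THEN iffD1, rotated]) (auto simp: \<sigma>_def)
  have "bij_betw \<sigma> (A \<union> B) (A' \<union> B')" by (rule bij_betw_combine[OF sA sB A'(2)])
  then have "bij_betw \<sigma> ((A \<union> B) \<union> (V - (A \<union> B))) ((A' \<union> B') \<union> (V - (A' \<union> B')))"
    by (rule bij_betw_combine[OF _ sC]) blast
  moreover have "(A \<union> B) \<union> (V - (A \<union> B)) = V" "(A' \<union> B') \<union> (V - (A' \<union> B')) = V" using A(1) A'(1) by blast+
  ultimately have "bij_betw \<sigma> V V" by simp
  moreover have "\<sigma> ` A = A'" "\<sigma> ` B = B'" using sA sB by (simp_all add: bij_betw_def)
  ultimately show ?thesis by blast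
qed

lemma image_triples_filter:
  assumes inj: "inj_on \<sigma> V" and Q: "\<And>e. e \<subseteq> V \<Longrightarrow> Q e \<longleftrightarrow> Q' (\<sigma> ` e)"
  shows "(\<lambda>e. \<sigma> ` e) ` {e. e \<subseteq> V \<and> card e = 3 \<and> Q e} = {e. e \<subseteq> \<sigma> ` V \<and> card e = 3 \<and> Q' e}"
proof (intro equalityI subsetI)
  fix e assume "e \<in> (\<lambda>e. \<sigma> ` e) ` {e. e \<subseteq> V \<and> card e = 3 \<and> Q e}"
  then obtain p where p: "p \<subseteq> V" "card p = 3" "Q p" "e = \<sigma> ` p" by blast
  moreover have "card (\<sigma> ` p) = 3" using card_image[OF inj_on_subset[OF inj p(1)]] p(2) by simp
  ultimately show "e \<in> {e. e \<subseteq> \<sigma> ` V \<and> card e = 3 \<and> Q' e}" using Q by auto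
next
  fix e assume "e \<in> {e. e \<subseteq> \<sigma> ` V \<and> card e = 3 \<and> Q' e}"
  then obtain p where p: "p \<subseteq> V" "e = \<sigma> ` p" "card e = 3" "Q' e" by (auto simp: subset_image_iff)
  moreover have "card p = 3" using card_image[OF inj_on_subset[OF inj p(1)]] p(2,3) by simp
  ultimately show "e \<in> (\<lambda>e. \<sigma> ` e) ` {e. e \<subseteq> V \<and> card e = 3 \<and> Q e}" using Q by auto
qed

lemma image_triples:
  assumes "inj_on \<sigma> V" "A \<subseteq> V"
  shows "(\<lambda>e. \<sigma> ` e) ` triples A = triples (\<sigma> ` A)"
  using image_triples_filter[of \<sigma> A "\<lambda>_. True" "\<lambda>_. True"] inj_on_subset[OF assms] unfolding triples_def by simp

lemma image_full_star:
  assumes "inj_on \<sigma> V" "z \<in> V"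
  shows "(\<lambda>e. \<sigma> ` e) ` full_star z V = full_star (\<sigma> z) (\<sigma> ` V)"
proof -
  have "(\<lambda>e. \<sigma> ` e) ` {e. e \<subseteq> V \<and> card e = 3 \<and> z \<in> e} = {e. e \<subseteq> \<sigma> ` V \<and> card e = 3 \<and> \<sigma> z \<in> e}"
    by (rule image_triples_filter[OF assms(1)]) (use assms inj_on_image_mem_iff in metis)
  then show ?thesis unfolding full_star_def triples_def by simp
qed

lemma image_comet_on:
  assumes inj: "inj_on \<sigma> V" and "c \<in> V" "S \<subseteq> V"
  shows "(\<lambda>e. \<sigma> ` e) ` comet_on c S V = comet_on (\<sigma> c) (\<sigma> ` S) (\<sigma> ` V)"
  unfolding comet_on_def
proof (rule image_triples_filter[OF inj])
  fix e assume e: "e \<subseteq> V"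
  have "e \<subseteq> insert c S \<longleftrightarrow> \<sigma> ` e \<subseteq> \<sigma> ` (insert c S)"
  proof
    assume s: "\<sigma> ` e \<subseteq> \<sigma> ` (insert c S)"
    have K: "insert c S \<subseteq> V" using assms(2,3) by simp
    show "e \<subseteq> insert c S"
    proof
      fix x assume x: "x \<in> e"
      then have "x \<in> V" "\<sigma> x \<in> \<sigma> ` (insert c S)" using e s by blast+
      then show "x \<in> insert c S" using inj_on_image_mem_iff[OF inj _ K] by simp
    qed
  qed blast
  moreover have "c \<in> e \<longleftrightarrow> \<sigma> c \<in> \<sigma> ` e" using inj_on_image_mem_iff[OF inj assms(2) e] by simp
  moreover have "\<sigma> ` e \<inter> \<sigma> ` S = \<sigma> ` (e \<inter> S)" using inj_on_image_Int[OF inj e assms(3)] by simp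
  ultimately show "(e \<subseteq> insert c S \<or> c \<in> e \<and> e \<inter> S = {}) \<longleftrightarrow> (\<sigma> ` e \<subseteq> insert (\<sigma> c) (\<sigma> ` S) \<or> \<sigma> c \<in> \<sigma> ` e \<and> \<sigma> ` e \<inter> \<sigma> ` S = {})"
    by simp
qed

section \<open>Isomorphism classes of the target systems\<close>

lemma star3_class:
  assumes "0 < n"
  shows "H \<in> iso_class n (star3 n) \<longleftrightarrow> (\<exists>z<n. H = full_star z {..<n})"
proof
  have st: "star3 n = full_star 0 {..<n}" unfolding star3_def full_star_def by simp
  assume "H \<in> iso_class n (star3 n)"
  then obtain \<sigma> where s: "bij_betw \<sigma> {..<n} {..<n}" "H = (\<lambda>e. \<sigma> ` e) ` full_star 0 {..<n}"
    unfolding iso_class_def iso3_def st by blast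
  have "H = full_star (\<sigma> 0) {..<n}" using image_full_star[of \<sigma> "{..<n}" 0] s assms by (simp add: bij_betw_def)
  moreover have "\<sigma> 0 < n" using s(1) assms bij_betwE by fastforce
  ultimately show "\<exists>z<n. H = full_star z {..<n}" by blast
next
  have st: "star3 n = full_star 0 {..<n}" unfolding star3_def full_star_def by simp
  assume "\<exists>z<n. H = full_star z {..<n}"
  then obtain z where z: "z < n" "H = full_star z {..<n}" by blast
  obtain \<sigma> where s: "bij_betw \<sigma> {..<n} {..<n}" "\<sigma> ` {0} = {z}"
    using ex_bij_extending[of "{..<n}" "{0}" "{}" "{z}" "{}"] assms z(1) by auto
  have "H = (\<lambda>e. \<sigma> ` e) ` full_star 0 {..<n}" using image_full_star[of \<sigma> "{..<n}" 0] s assms z(2) by (simp add: bij_betw_def)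
  then show "H \<in> iso_class n (star3 n)" using s(1) unfolding iso_class_def iso3_def st by blast
qed

lemma two_cliques_class:
  assumes X: "X \<union> Y \<subseteq> {..<n}" "X \<inter> Y = {}"
  shows "H \<in> iso_class n (triples X \<union> triples Y) \<longleftrightarrow>
    (\<exists>A B. A \<union> B \<subseteq> {..<n} \<and> A \<inter> B = {} \<and> card A = card X \<and> card B = card Y \<and> H = triples A \<union> triples B)"
proof
  have im: "(\<lambda>e. \<sigma> ` e) ` (triples X \<union> triples Y) = triples (\<sigma> ` X) \<union> triples (\<sigma> ` Y)" if "inj_on \<sigma> {..<n}" for \<sigma>
    using image_triples[OF that] X(1) by (simp add: image_Un)
  {
    assume "H \<in> iso_class n (triples X \<union> triples Y)"
    then obtain \<sigma> where s: "bij_betw \<sigma> {..<n} {..<n}" "H = (\<lambda>e. \<sigma> ` e) ` (triples X \<union> triples Y)"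
      unfolding iso_class_def iso3_def by blast
    have inj: "inj_on \<sigma> {..<n}" and img: "\<sigma> ` {..<n} = {..<n}" using s(1) by (simp_all add: bij_betw_def)
    have XY: "X \<subseteq> {..<n}" "Y \<subseteq> {..<n}" using X(1) by auto
    have "\<sigma> ` X \<union> \<sigma> ` Y \<subseteq> {..<n}" using XY img by blast
    moreover have "\<sigma> ` X \<inter> \<sigma> ` Y = {}" using inj_on_image_Int[OF inj XY] X(2) by simp
    moreover have "card (\<sigma> ` X) = card X" "card (\<sigma> ` Y) = card Y"
      using card_image inj_on_subset[OF inj] XY by blast+
    ultimately show "\<exists>A B. A \<union> B \<subseteq> {..<n} \<and> A \<inter> B = {} \<and> card A = card X \<and> card B = card Y \<and> H = triples A \<union> triples B"
      using s(2) im[OF inj] by blast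
  }
  assume "\<exists>A B. A \<union> B \<subseteq> {..<n} \<and> A \<inter> B = {} \<and> card A = card X \<and> card B = card Y \<and> H = triples A \<union> triples B"
  then obtain A B where AB: "A \<union> B \<subseteq> {..<n}" "A \<inter> B = {}" "card A = card X" "card B = card Y" "H = triples A \<union> triples B" by blast
  obtain \<sigma> where s: "bij_betw \<sigma> {..<n} {..<n}" "\<sigma> ` X = A" "\<sigma> ` Y = B"
    using ex_bij_extending[OF finite_lessThan X AB(1,2)] AB(3,4) by auto
  have "H = (\<lambda>e. \<sigma> ` e) ` (triples X \<union> triples Y)" using im[of \<sigma>] s AB(5) by (simp add: bij_betw_def)
  then show "H \<in> iso_class n (triples X \<union> triples Y)" using s(1) unfolding iso_class_def iso3_def by blast
qed

lemma comet_eq: "4 \<le> n \<Longrightarrow> comet n = comet_on 0 {1,2,3} {..<n}"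
proof (intro equalityI subsetI)
  fix e assume n: "4 \<le> n" and "e \<in> comet n"
  then consider "e \<in> triples {0,1,2,3}" | u v where "e = {0,u,v}" "u \<in> {4..<n}" "v \<in> {4..<n}" "u \<noteq> v"
    unfolding comet_def by blast
  then show "e \<in> comet_on 0 {1,2,3} {..<n}"
  proof cases
    case 1
    then show ?thesis using n unfolding triples_def comet_on_def by auto
  next
    case 2
    then show ?thesis using n unfolding comet_on_def by auto
  qed
next
  fix e assume n: "4 \<le> n" and "e \<in> comet_on 0 {1,2,3} {..<n}"
  then have e: "e \<subseteq> {..<n}" "card e = 3" "e \<subseteq> {0,1,2,3} \<or> 0 \<in> e \<and> e \<inter> {1,2,3} = {}" unfolding comet_on_def by auto
  show "e \<in> comet n"
  proof (cases "e \<subseteq> {0,1,2,3}")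
    case True then show ?thesis using e(2) unfolding comet_def triples_def by blast
  next
    case False
    then have 0: "0 \<in> e" "e \<inter> {1,2,3} = {}" using e(3) by auto
    obtain u v where uv: "e = {0,u,v}" "0 \<noteq> u" "0 \<noteq> v" "u \<noteq> v" using card3_elem[OF e(2) 0(1)] by metis
    have "u \<notin> {1,2,3}" "v \<notin> {1,2,3}" "u < n" "v < n" using uv 0(2) e(1) by auto
    then have "u \<in> {4..<n}" "v \<in> {4..<n}" using uv by auto
    then show ?thesis using uv unfolding comet_def by blast
  qed
qed

lemma comet_class:
  assumes n: "4 \<le> n"
  shows "H \<in> iso_class n (comet n) \<longleftrightarrow> is_comet {..<n} H"
proof
  have cS: "(0::nat) \<in> {..<n}" "{1,2,3} \<subseteq> {..<n}" using n by auto
  {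
    assume "H \<in> iso_class n (comet n)"
    then obtain \<sigma> where s: "bij_betw \<sigma> {..<n} {..<n}" "H = (\<lambda>e. \<sigma> ` e) ` comet_on 0 {1,2,3} {..<n}"
      unfolding iso_class_def iso3_def comet_eq[OF n] by blast
    have inj: "inj_on \<sigma> {..<n}" and img: "\<sigma> ` {..<n} = {..<n}" using s(1) by (simp_all add: bij_betw_def)
    have "H = comet_on (\<sigma> 0) (\<sigma> ` {1,2,3}) {..<n}" using image_comet_on[OF inj cS] s(2) img by simp
    moreover have "\<sigma> 0 \<in> {..<n}" "\<sigma> ` {1,2,3} \<subseteq> {..<n}" using cS img by blast+
    moreover have "card (\<sigma> ` {1,2,3}) = 3" using card_image[OF inj_on_subset[OF inj cS(2)]] by simp
    moreover have "\<sigma> 0 \<notin> \<sigma> ` {1,2,3}" using inj_on_image_mem_iff[OF inj cS] by simp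
    ultimately show "is_comet {..<n} H" unfolding is_comet_def by blast
  }
  assume "is_comet {..<n} H"
  then obtain c S where c: "c \<in> {..<n}" "S \<subseteq> {..<n}" "card S = 3" "c \<notin> S" "H = comet_on c S {..<n}" unfolding is_comet_def by blast
  obtain \<sigma> where s: "bij_betw \<sigma> {..<n} {..<n}" "\<sigma> ` {0} = {c}" "\<sigma> ` {1,2,3} = S"
    using ex_bij_extending[of "{..<n}" "{0}" "{1,2,3}" "{c}" S] cS c by auto
  have "H = (\<lambda>e. \<sigma> ` e) ` comet_on 0 {1,2,3} {..<n}"
    using image_comet_on[of \<sigma> "{..<n}" 0 "{1,2,3}"] cS s c(5) by (simp add: bij_betw_def)
  then show "H \<in> iso_class n (comet n)" using s(1) unfolding iso_class_def iso3_def comet_eq[OF n] by blast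
qed

lemma K6_Kn6_class:
  assumes "6 \<le> n"
  shows "H \<in> iso_class n (K6_Kn6 n) \<longleftrightarrow> (\<exists>A\<subseteq>{..<n}. card A = 6 \<and> H = triples A \<union> triples ({..<n} - A))"
proof -
  have "{..<6} \<union> {6..<n} \<subseteq> {..<n}" "{..<6} \<inter> {6..<n} = {}" using assms by auto
  note t = two_cliques_class[OF this, folded K6_Kn6_def, of H]
  have "(\<exists>A B. A \<union> B \<subseteq> {..<n} \<and> A \<inter> B = {} \<and> card A = 6 \<and> card B = n - 6 \<and> H = triples A \<union> triples B) \<longleftrightarrow>
    (\<exists>A\<subseteq>{..<n}. card A = 6 \<and> H = triples A \<union> triples ({..<n} - A))" (is "?L \<longleftrightarrow> ?R")
  proof
    assume ?L
    then obtain A B where AB: "A \<union> B \<subseteq> {..<n}" "A \<inter> B = {}" "card A = 6" "card B = n - 6" "H = triples A \<union> triples B" by blast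
    have An: "A \<subseteq> {..<n}" using AB(1) by simp
    have "B \<subseteq> {..<n} - A" using AB by blast
    moreover have "card ({..<n} - A) = n - 6" using card_parts[OF _ An] AB(3) by simp
    ultimately have "B = {..<n} - A" using AB(4) card_subset_eq[of "{..<n} - A" B] by simp
    then show ?R using AB An by blast
  next
    assume ?R
    then obtain A where A: "A \<subseteq> {..<n}" "card A = 6" "H = triples A \<union> triples ({..<n} - A)" by blast
    have "card ({..<n} - A) = n - 6" using card_parts[OF _ A(1)] A(2) by simp
    moreover have "A \<union> ({..<n} - A) \<subseteq> {..<n}" "A \<inter> ({..<n} - A) = {}" using A(1) by auto
    ultimately show ?L using A by blast
  qed
  then show ?thesis using t by simp
qed

lemma K6_K6_K1_class:
  "H \<in> iso_class 13 K6_K6_K1 \<longleftrightarrow>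
    (\<exists>A\<subseteq>{..<13}. \<exists>B\<subseteq>{..<13}. A \<inter> B = {} \<and> card A = 6 \<and> card B = 6 \<and> H = triples A \<union> triples B)"
proof -
  have "{..<6} \<union> {6..<12} \<subseteq> {..<13::nat}" "{..<6} \<inter> {6..<12::nat} = {}" by auto
  note t = two_cliques_class[OF this, folded K6_K6_K1_def, of H]
  show ?thesis unfolding t by auto
qed

lemma two_cliques_facts:
  assumes "A \<subseteq> {..<n}" "B \<subseteq> {..<n}" "A \<inter> B = {}" "card A = 6" "card B \<le> 6"
  shows "hg3 n (triples A \<union> triples B)" "Pfree (triples A \<union> triples B)"
    "\<exists>e\<in>triples A \<union> triples B. z \<notin> e" "card (triples A \<union> triples B) = 20 + (card B choose 3)"
proof -
  have fin: "finite A" "finite B" using assms(1,2) finite_subset by blast+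
  show "hg3 n (triples A \<union> triples B)" using assms(1,2) unfolding hg3_def triples_def by auto
  show "Pfree (triples A \<union> triples B)" by (rule Pfree_two_cliques) (use assms fin in simp_all)
  show "\<exists>e\<in>triples A \<union> triples B. z \<notin> e" by (rule nonstar_clique[of A]) (use assms(4) in simp_all)
  have "triples A \<inter> triples B = {}"
  proof -
    have "e \<notin> triples B" if "e \<in> triples A" for e
    proof
      assume "e \<in> triples B"
      then have "e \<subseteq> A \<inter> B" "card e = 3" using that unfolding triples_def by auto
      then show False using assms(3) by simp
    qed
    then show ?thesis by blast
  qed
  then have "card (triples A \<union> triples B) = card (triples A) + card (triples B)"
    by (rule card_Un_disjoint[OF finite_triples[OF fin(1)] finite_triples[OF fin(2)]])
  then show "card (triples A \<union> triples B) = 20 + (card B choose 3)"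
    using card_triples fin assms(4) by (simp add: choose_3_vals)
qed

lemma is_comet_facts:
  assumes "is_comet {..<n} H"
  shows "hg3 n H" "Pfree H" "\<exists>e\<in>H. z \<notin> e" "card H = 4 + (n - 4 choose 2)"
proof -
  obtain c S where c: "c \<in> {..<n}" "S \<subseteq> {..<n}" "card S = 3" "c \<notin> S" "H = comet_on c S {..<n}"
    using assms unfolding is_comet_def by blast
  show "hg3 n H" unfolding c(5) hg3_ts by (rule comet_on_ts) simp
  show "Pfree H" unfolding c(5) by (rule Pfree_comet[OF c(3,4)])
  have "finite S" using c(2) finite_subset by blast
  then have "card (insert c S) = 4" using c by simp
  then show "\<exists>e\<in>H. z \<notin> e" unfolding c(5)
    using nonstar_clique[OF comet_on_subset_clique[of c S "{..<n}"]] c(1,2) by simp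
  show "card H = 4 + (n - 4 choose 2)" unfolding c(5) using card_comet_on[OF finite_lessThan c(1-4)] by simp
qed

text \<open>All n \<ge> 8 at once: the ranges are built into \<open>extremal\<close>, so each range
  only has to identify its isomorphism classes with that predicate.\<close>

lemma second_order_large:
  assumes n: "8 \<le> n"
    and F: "\<And>H. H \<in> F \<longleftrightarrow> extremal {..<n} H" and ne: "F \<noteq> {}"
  shows "ex2 n = nonstar_bd n \<and> Ex2 n = F"
proof (rule ex2_Ex2_eqI)
  fix H assume "H \<in> F"
  then have "extremal {..<n} H" using F by simp
  then consider A where "n \<le> 12" "A \<subseteq> {..<n}" "card A = 6" "H = triples A \<union> triples ({..<n} - A)"
    | A B where "n = 13" "A \<subseteq> {..<n}" "B \<subseteq> {..<n}" "A \<inter> B = {}" "card A = 6" "card B = 6" "H = triples A \<union> triples B"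
    | "13 \<le> n" "is_comet {..<n} H" unfolding extremal_def by auto
  then have "hg3 n H \<and> Pfree H \<and> (\<forall>z. \<exists>e\<in>H. z \<notin> e) \<and> card H = nonstar_bd n"
  proof cases
    case (1 A)
    have c: "card ({..<n} - A) = n - 6" using card_parts[OF _ 1(2)] 1(3) by simp
    have "hg3 n H" "Pfree H" "\<And>z. \<exists>e\<in>H. z \<notin> e" "card H = 20 + (n - 6 choose 3)"
      using two_cliques_facts[of A n "{..<n} - A"] 1 c by (simp_all add: Diff_Int_distrib)
    then show ?thesis using 1(1) by (simp add: nonstar_bd_def)
  next
    case (2 A B)
    then show ?thesis using two_cliques_facts[of A n B] by (simp add: nonstar_bd_vals choose_3_vals)
  next
    case 3
    then show ?thesis using is_comet_facts[OF 3(2)] by (simp add: nonstar_bd_def choose_two)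
  qed
  then show "hg3 n H \<and> Pfree H \<and> \<not> (\<exists>G\<in>Ex1 n. H \<subseteq> G) \<and> card H = nonstar_bd n" using Ex1_large[OF n, of H] by blast
next
  fix H assume H: "hg3 n H" "Pfree H" "\<not> (\<exists>G\<in>Ex1 n. H \<subseteq> G)"
  have "\<exists>e\<in>H. z \<notin> e" if "z \<in> {..<n}" for z using H(3) Ex1_large[OF n H(1,2)] that by blast
  then show "card H \<le> nonstar_bd n \<and> (card H = nonstar_bd n \<longrightarrow> H \<in> F)"
    using nonstar_bound[of "{..<n}" H] H(1,2) n F unfolding hg3_ts by simp
qed (rule ne)

lemma iso_class_refl: "G \<in> iso_class n G"
  unfolding iso_class_def iso3_def by (auto intro!: exI[of _ id])

lemma second_order_seven: "ex2 7 = 15 \<and> Ex2 7 = iso_class 7 (star3 7)"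
proof (rule ex2_Ex2_eqI)
  fix H assume "H \<in> iso_class 7 (star3 7)"
  then obtain z where z: "z < 7" "H = full_star z {..<7}" using star3_class[of 7 H] by auto
  \<comment> \<open>Some vertex v is outside A, and the star has an edge through v: any edge if v is
    the centre, otherwise one through the centre and v.\<close>
  have "\<not> H \<subseteq> triples A" if A: "A \<subseteq> {..<7}" "card A = 6" for A
  proof
    assume s: "H \<subseteq> triples A"
    obtain v where v: "v < 7" "v \<notin> A"
    proof -
      have "\<not> {..<7} \<subseteq> A"
      proof
        assume "{..<7} \<subseteq> A"
        then have "A = {..<7}" using A(1) by blast
        then show False using A(2) by simp
      qed
      then show ?thesis using that by auto
    qed
    have "card ({..<7} - {z,v}) \<ge> 5" using card_Diff_subset[of "{z,v}" "{..<7::nat}"] z(1) v(1) card_insert_le_m1[of 2 "{v}" z]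
      by (simp add: card_insert_if)
    then obtain w where w: "w \<in> {..<7} - {z,v}" by (metis card.empty not_numeral_le_zero ex_in_conv)
    have "\<exists>x. x < 7 \<and> x \<noteq> z \<and> x \<noteq> v \<and> x \<noteq> w"
    proof -
      have "card {z,v,w} \<le> 3" by (simp add: card_insert_if)
      then have "\<not> {..<7} \<subseteq> {z,v,w}" using card_mono[of "{z,v,w}" "{..<7::nat}"] by auto
      then show ?thesis by auto
    qed
    then obtain x where x: "x < 7" "x \<noteq> z" "x \<noteq> v" "x \<noteq> w" by blast
    show False
    proof (cases "v = z")
      case True
      have "{z,w,x} \<in> H" using z w x unfolding full_star_def triples_def by auto
      then show False using s v True unfolding triples_def by auto
    next
      case False
      have "{z,v,w} \<in> H" using z w v False unfolding z(2) full_star_def triples_def by auto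
      then show False using s v unfolding triples_def by auto
    qed
  qed
  then have "\<not> (\<exists>G\<in>Ex1 7. H \<subseteq> G)" unfolding ex1_Ex1_7(2) by blast
  then show "hg3 7 H \<and> Pfree H \<and> \<not> (\<exists>G\<in>Ex1 7. H \<subseteq> G) \<and> card H = 15"
    using full_star_facts[OF z(1)] z(2) by (simp add: choose_two)
next
  fix H assume H: "hg3 7 H" "Pfree H" "\<not> (\<exists>G\<in>Ex1 7. H \<subseteq> G)"
  have ts: "triple_system {..<7} H" using H(1) hg3_ts by simp
  have "card {..<7::nat} = 7" by simp
  from seven_vertices[OF ts H(2) this] consider z where "z \<in> {..<7}" "\<forall>e\<in>H. z \<in> e"
    | A where "A \<subseteq> {..<7}" "card A = 6" "H \<subseteq> triples A" | "card H \<le> 14" by blast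
  then show "card H \<le> 15 \<and> (card H = 15 \<longrightarrow> H \<in> iso_class 7 (star3 7))"
  proof cases
    case (1 z)
    have z7: "z < 7" using 1(1) by simp
    have sub: "H \<subseteq> full_star z {..<7}" by (rule subset_full_star[OF ts 1(2)])
    have c: "card (full_star z {..<7}) = 15" using full_star_facts(3)[OF z7] by (simp add: choose_two)
    have fin: "finite (full_star z {..<7})" by (rule ts_finite(2)[OF full_star_ts]) simp
    have "card H \<le> 15" using card_mono[OF fin sub] c by simp
    moreover have "card H = 15 \<Longrightarrow> H = full_star z {..<7}" using card_seteq[OF fin sub] c by simp
    ultimately show ?thesis using star3_class[of 7 H] z7 by auto
  next
    case (2 A)
    then show ?thesis using H(3) unfolding ex1_Ex1_7(2) by blast
  qed simp
next
  show "iso_class 7 (star3 7) \<noteq> {}" using iso_class_refl by blast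
qed

theorem mainTheorem2:
  shows "(ex2 7 = 15 \<and> Ex2 7 = iso_class 7 (star3 7))
    \<and> (\<forall>n. 8 \<le> n \<and> n \<le> 12 \<longrightarrow>
          ex2 n = 20 + (n - 6 choose 3) \<and> Ex2 n = iso_class n (K6_Kn6 n))
    \<and> (ex2 13 = 40 \<and> Ex2 13 = iso_class 13 K6_K6_K1 \<union> iso_class 13 (comet 13))
    \<and> (\<forall>n\<ge>14. ex2 n = 4 + (n - 4 choose 2) \<and> Ex2 n = iso_class n (comet n))"
proof -
  have small: "ex2 n = 20 + (n - 6 choose 3) \<and> Ex2 n = iso_class n (K6_Kn6 n)" if n: "8 \<le> n \<and> n \<le> 12" for n
  proof -
    have "H \<in> iso_class n (K6_Kn6 n) \<longleftrightarrow> extremal {..<n} H" for H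
      using K6_Kn6_class[of n H] n unfolding extremal_def by simp
    then have "ex2 n = nonstar_bd n \<and> Ex2 n = iso_class n (K6_Kn6 n)"
      by (intro second_order_large) (use n iso_class_refl in auto)
    then show ?thesis using n by (simp add: nonstar_bd_def)
  qed
  have "H \<in> iso_class 13 K6_K6_K1 \<union> iso_class 13 (comet 13) \<longleftrightarrow> extremal {..<13} H" for H
    using K6_K6_K1_class[of H] comet_class[of 13 H] unfolding extremal_def by simp
  then have "ex2 13 = nonstar_bd 13 \<and> Ex2 13 = iso_class 13 K6_K6_K1 \<union> iso_class 13 (comet 13)"
    by (intro second_order_large) (use iso_class_refl in auto)
  then have thirteen: "ex2 13 = 40 \<and> Ex2 13 = iso_class 13 K6_K6_K1 \<union> iso_class 13 (comet 13)"
    by (simp add: nonstar_bd_vals)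
  have large: "ex2 n = 4 + (n - 4 choose 2) \<and> Ex2 n = iso_class n (comet n)" if n: "14 \<le> n" for n
  proof -
    have "H \<in> iso_class n (comet n) \<longleftrightarrow> extremal {..<n} H" for H
      using comet_class[of n H] n unfolding extremal_def by simp
    then have "ex2 n = nonstar_bd n \<and> Ex2 n = iso_class n (comet n)"
      by (intro second_order_large) (use n iso_class_refl in auto)
    then show ?thesis using n by (simp add: nonstar_bd_def)
  qed
  show ?thesis using second_order_seven small thirteen large by blast
qed

end
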